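(* Let $n\ge2$ and let $f:\mathbb R^n\to\mathbb R$ be a non-zero, non-negative continuous function with compact support and integrable weak gradient. Then $$\left(\frac1n\int_{S^{n-1}}\left(\frac12\int_{\mathbb R^n}|\langle\nabla f(x),\xi\rangle|\,dx\right)^{-n}d\xi\right)^{-\frac1n}\ \ge\ \left(\frac{1}{\omega_n^2\,n!}\int_{\mathbb R^n}\cdots\int_{\mathbb R^n}D_n(\nabla f(x_1),\dots,\nabla f(x_n))\,dx_1\cdots dx_n\right)^{\frac1n}.$$
   Context: $D_n(v_1,\dots,v_n)=|\det(v_1,\dots,v_n)|$, $\omega_n$ is the volume of the unit Euclidean ball of $\mathbb R^n$, and $d\xi$ is the standard surface measure on the unit sphere $S^{n-1}$. *)

theory Defs
  imports "HOL-Analysis.Analysis"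
begin

definition compactly_supported :: "('a::euclidean_space \<Rightarrow> real) \<Rightarrow> bool" where
  "compactly_supported f \<longleftrightarrow> compact (closure {x. f x \<noteq> 0})"

definition partial_deriv :: "'n::finite \<Rightarrow> (real^'n \<Rightarrow> real) \<Rightarrow> real^'n \<Rightarrow> real" where
  "partial_deriv i \<phi> x = frechet_derivative \<phi> (at x) (axis i 1)"

primrec Ck_function :: "nat \<Rightarrow> (real^'n::finite \<Rightarrow> real) \<Rightarrow> bool" where
  "Ck_function 0 \<phi> \<longleftrightarrow> continuous_on UNIV \<phi>"
| "Ck_function (Suc k) \<phi> \<longleftrightarrow>
     (\<forall>x. \<phi> differentiable (at x)) \<and> (\<forall>i. Ck_function k (partial_deriv i \<phi>))"

definition test_function :: "(real^'n::finite \<Rightarrow> real) \<Rightarrow> bool" where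
  "test_function \<phi> \<longleftrightarrow> (\<forall>k. Ck_function k \<phi>) \<and> compactly_supported \<phi>"

definition locally_integrable :: "(real^'n::finite \<Rightarrow> 'b::euclidean_space) \<Rightarrow> bool" where
  "locally_integrable f \<longleftrightarrow> (\<forall>K. compact K \<longrightarrow> set_integrable lebesgue K f)"

definition has_weak_gradient ::
    "(real^'n::finite \<Rightarrow> real) \<Rightarrow> (real^'n \<Rightarrow> real^'n) \<Rightarrow> bool" where
  "has_weak_gradient f g \<longleftrightarrow>
     locally_integrable f \<and> locally_integrable g \<and>
     (\<forall>\<phi> i. test_function \<phi> \<longrightarrow>
        (LINT x|lebesgue. f x * partial_deriv i \<phi> x) = - (LINT x|lebesgue. (g x $ i) * \<phi> x))"

definition D :: "('n::finite \<Rightarrow> real^'n) \<Rightarrow> real" where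
  "D v = \<bar>det (\<chi> i j. v j $ i)\<bar>"

definition ball_volume :: "'n::finite itself \<Rightarrow> real" where
  "ball_volume _ = measure lborel (cball (0::real^'n) 1)"

(* The surface measure given by polar coordinates: the radial projection of the punctured
   open unit ball onto the sphere pushes Lebesgue measure forward to 1/n times the surface
   measure; see emeasure_sphere_surface below. *)
definition sphere_surface :: "(real^'n::finite) measure" where
  "sphere_surface = scale_measure (of_nat CARD('n))
     (distr (restrict_space lborel (ball 0 1 - {0})) (restrict_space borel (sphere 0 1))
        (\<lambda>x. x /\<^sub>R norm x))"

lemma space_sphere_surface: "space sphere_surface = sphere 0 1"
  by (simp add: sphere_surface_def space_scale_measure space_restrict_space)

lemma sets_sphere_surface: "sets sphere_surface = sets (restrict_space borel (sphere 0 1))"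
  by (simp add: sphere_surface_def)

lemma measurable_radial_projection:
  "(\<lambda>x. x /\<^sub>R norm x) \<in>
     restrict_space lborel (ball 0 1 - {0 :: real^'n::finite}) \<rightarrow>\<^sub>M restrict_space borel (sphere 0 1)"
proof (rule measurable_restrict_space2)
  show "(\<lambda>x. x /\<^sub>R norm x) \<in>
      space (restrict_space lborel (ball 0 1 - {0 :: real^'n})) \<rightarrow> sphere 0 1"
    by (auto simp: space_restrict_space)
  have "(\<lambda>x::real^'n. x /\<^sub>R norm x) \<in> borel_measurable lborel"
    by simp
  then show "(\<lambda>x. x /\<^sub>R norm x) \<in>
      borel_measurable (restrict_space lborel (ball 0 1 - {0 :: real^'n}))"
    by (rule measurable_restrict_space1)
qed

lemma emeasure_sphere_surface:
  fixes A :: "(real^'n::finite) set"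
  assumes A: "A \<in> sets borel" "A \<subseteq> sphere 0 1"
  shows "emeasure sphere_surface A =
           of_nat CARD('n) * emeasure lborel {r *\<^sub>R \<xi> | r \<xi>. 0 < r \<and> r < 1 \<and> \<xi> \<in> A}"
proof -
  have A': "A \<in> sets (restrict_space borel (sphere 0 1))"
    using A by (auto simp: sets_restrict_space image_iff)
  have eq: "(\<lambda>x. x /\<^sub>R norm x) -` A \<inter> (ball 0 1 - {0}) =
            {r *\<^sub>R \<xi> | r \<xi>. 0 < r \<and> r < 1 \<and> \<xi> \<in> A}"
  proof (intro set_eqI iffI)
    fix x assume x: "x \<in> (\<lambda>x. x /\<^sub>R norm x) -` A \<inter> (ball 0 1 - {0})"
    then have "x = norm x *\<^sub>R (x /\<^sub>R norm x)" "0 < norm x" "norm x < 1" "x /\<^sub>R norm x \<in> A"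
      by auto
    then show "x \<in> {r *\<^sub>R \<xi> | r \<xi>. 0 < r \<and> r < 1 \<and> \<xi> \<in> A}"
      by blast
  next
    fix x assume "x \<in> {r *\<^sub>R \<xi> | r \<xi>. 0 < r \<and> r < 1 \<and> \<xi> \<in> A}"
    then obtain r \<xi> where x: "x = r *\<^sub>R \<xi>" "0 < r" "r < 1" "\<xi> \<in> A"
      by blast
    moreover have "norm \<xi> = 1"
      using A x by auto
    ultimately show "x \<in> (\<lambda>x. x /\<^sub>R norm x) -` A \<inter> (ball 0 1 - {0})"
      by auto
  qed
  have "emeasure sphere_surface A = of_nat CARD('n) *
      emeasure (restrict_space lborel (ball 0 1 - {0}))
        ((\<lambda>x. x /\<^sub>R norm x) -` A \<inter> space (restrict_space lborel (ball 0 1 - {0})))"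
    using emeasure_distr[OF measurable_radial_projection A']
    by (simp add: sphere_surface_def)
  also have "\<dots> = of_nat CARD('n) * emeasure lborel
      ((\<lambda>x. x /\<^sub>R norm x) -` A \<inter> (ball 0 1 - {0}))"
    by (subst emeasure_restrict_space) (auto simp: space_restrict_space)
  finally show ?thesis
    unfolding eq .
qed

end

theory Submission
  imports Defs "HOL-Real_Asymp.Real_Asymp"
begin

text \<open>
  Write \<open>h x = 1/2 * \<integral>\<bar>grad w \<bullet> x\<bar> dw\<close>. This is the support function of a zonoid
  \<open>Z = {y. \<forall>x. x \<bullet> y \<le> h x}\<close>, whose polar body is \<open>K = {x. h x \<le> 1}\<close>. In polar coordinates
  \<open>1/n * \<integral> h powr -n\<close> over the sphere is the volume of \<open>K\<close>, and \<open>1/n! * \<integral> D\<close> is the volume of \<open>Z\<close>.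
  So the theorem is the Blaschke-Santalo inequality \<open>vol K * vol Z \<le> \<omega>\<^sup>2\<close> for zonoids,
  \<open>\<omega>\<close> being the volume of the unit ball. If \<open>h\<close> vanishes at some \<open>\<xi> \<noteq> 0\<close>, then almost all gradients are orthogonal to \<open>\<xi>\<close>, the integral of \<open>D\<close> is \<open>0\<close>, and
  there is nothing to prove (\<open>degenerate_zero\<close>).

  The estimate \<open>1/n! * \<integral> D \<le> vol Z\<close> (\<open>zonoid_volume\<close>) comes from a transport map. Let \<open>\<phi>\<close> be
  an increasing bijection from the line onto \<open>(-1/2, 1/2)\<close> and \<open>u = v / \<bar>v\<bar>\<close>, where \<open>v = grad\<close>. The
  map \<open>G x = \<integral> \<phi> (u w \<bullet> x) v w dw\<close> is injective, takes values in \<open>Z\<close>, and its derivative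
  \<open>\<integral> \<phi>' (u w \<bullet> x) v w u w\<^sup>T dw\<close> has, by the Cauchy-Binet formula, the determinant
  \<open>1/n! * \<integral> (\<Prod>i. \<phi>' (u w\<^sub>i \<bullet> x)) det (v w\<^sub>1, ..., v w\<^sub>n) det (u w\<^sub>1, ..., u w\<^sub>n) dw\<^sub>1 ... dw\<^sub>n\<close>. For
  fixed \<open>w\<close> the integral over \<open>x\<close> of \<open>\<Prod>i. \<phi>' (u w\<^sub>i \<bullet> x)\<close> is \<open>1 / \<bar>det (u w\<^sub>1, ..., u w\<^sub>n)\<bar>\<close>, because the map
  with components \<open>\<phi> (u w\<^sub>i \<bullet> x)\<close> sends the whole space onto the unit cube. Integrating the determinant over \<open>x\<close>
  leaves \<open>1/n! * \<integral> D\<close>.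

  The inequality \<open>vol K * vol Z \<le> \<omega>\<^sup>2\<close> (\<open>blaschke_santalo\<close>) follows from its functional form: if
  \<open>f x * g y \<le> exp (- (x \<bullet> y))\<close> for all \<open>x, y\<close> and \<open>f\<close> has its barycentre at \<open>0\<close>, then
  \<open>\<integral> f * \<integral> g \<le> (2 \<pi>)\<^sup>n\<close>. One applies it to \<open>exp (- h\<^sup>2 / 2)\<close> and \<open>exp (- N\<^sup>2 / 2)\<close>, where \<open>N\<close> is the
  gauge of \<open>Z\<close>; these integrals are the same multiple of the volumes of \<open>K\<close> and \<open>Z\<close> as the Gaussian
  integral is of \<open>\<omega>\<close>. The functional form is proved by Lehec's induction on the dimension
  (\<open>santalo_PL_step\<close>). A hyperplane \<open>x\<^sub>k = c\<close> halves the mass of \<open>g\<close>; after a translation and a shear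
  the barycentres of both halves of \<open>g\<close> lie on the \<open>k\<close>-axis, on either side of the hyperplane
  \<open>x\<^sub>k = 0\<close>. Integrating along the \<open>k\<close>-axis over each half-space gives pairs of functions of one variable
  less, to which the induction hypothesis applies; the hypothesis linking them is the one-dimensional case on a
  half-line (\<open>half_line_santalo\<close>), which is the Prekopa-Leindler inequality after the substitution
  \<open>s = exp r\<close>.
\<close>

section \<open>The Prekopa-Leindler inequality on the line\<close>

text \<open>
  If \<open>s\<close> is the maximum of \<open>A\<close> and \<open>t\<close> the minimum of \<open>B\<close>, then the translates \<open>t + A\<close> and \<open>s + B\<close>
  both lie in the sumset and meet only in \<open>s + t\<close>.
\<close>

lemma brunn_minkowski_compact_real:
  fixes A B L :: "real set"
  assumes A: "compact A" "A \<noteq> {}" and B: "compact B" "B \<noteq> {}" and L: "L \<in> sets borel"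
    and mid: "\<And>a b. a \<in> A \<Longrightarrow> b \<in> B \<Longrightarrow> (a + b) / 2 \<in> L"
  shows "emeasure lborel A + emeasure lborel B \<le> 2 * emeasure lborel L"
proof -
  obtain s where s: "s \<in> A" "\<And>a. a \<in> A \<Longrightarrow> a \<le> s" using compact_attains_sup[OF A] by auto
  obtain t where t: "t \<in> B" "\<And>b. b \<in> B \<Longrightarrow> t \<le> b" using compact_attains_inf[OF B] by auto
  have Am: "A \<in> sets borel" and Bm: "B \<in> sets borel"
    using A B by (auto intro: borel_closed compact_imp_closed)
  have "AE x in lborel. x \<noteq> s + t" by (rule AE_lborel_singleton)
  then have le: "AE x in lborel. (indicator A (x - t) :: ennreal) + indicator B (x - s) \<le> indicator L (x / 2)"
  proof (rule AE_mp, intro AE_I2 impI)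
    fix x assume x: "x \<noteq> s + t"
    show "(indicator A (x - t) :: ennreal) + indicator B (x - s) \<le> indicator L (x / 2)"
    proof -
      have "\<not> (x - t \<in> A \<and> x - s \<in> B)" using s(2)[of "x - t"] t(2)[of "x - s"] x by linarith
      moreover have "x / 2 \<in> L" if "x - t \<in> A" using mid[of "x - t" t] that t by simp
      moreover have "x / 2 \<in> L" if "x - s \<in> B" using mid[of s "x - s"] that s by simp
      ultimately show ?thesis by (simp add: indicator_def)
    qed
  qed
  have "emeasure lborel A = (\<integral>\<^sup>+x. indicator A (x - t) \<partial>lborel)"
    using nn_integral_real_affine[of "indicator A" 1 "-t"] Am by (simp add: nn_integral_indicator)
  moreover have "emeasure lborel B = (\<integral>\<^sup>+x. indicator B (x - s) \<partial>lborel)"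
    using nn_integral_real_affine[of "indicator B" 1 "-s"] Bm by (simp add: nn_integral_indicator)
  ultimately have "emeasure lborel A + emeasure lborel B
      = (\<integral>\<^sup>+x. indicator A (x - t) + indicator B (x - s) \<partial>lborel)"
    using Am Bm by (subst nn_integral_add) auto
  also have "\<dots> \<le> (\<integral>\<^sup>+x. indicator L (x / 2) \<partial>lborel)"
    using le by (rule nn_integral_mono_AE)
  also have "\<dots> = 2 * (\<integral>\<^sup>+x. indicator L x \<partial>lborel)"
    using L nn_integral_real_affine[of "\<lambda>x. indicator L (x/2)" 2 0] by simp
  finally show ?thesis using L by (simp add: nn_integral_indicator)
qed

lemma inner_compact_approx:
  fixes A :: "real set"
  assumes A: "A \<in> sets borel" "bounded A" "A \<noteq> {}" and e: "e > 0"
  obtains K where "compact K" "K \<subseteq> A" "K \<noteq> {}" "emeasure lborel A \<le> emeasure lborel K + ennreal e"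
proof -
  obtain a where a: "a \<in> A" using A by auto
  have "A \<in> sets lebesgue" using A by auto
  then obtain T where T: "closed T" "T \<subseteq> A" "A - T \<in> lmeasurable" "emeasure lebesgue (A - T) < ennreal e"
    by (rule sets_lebesgue_inner_closed[OF _ e])
  let ?K = "insert a T"
  have K: "compact ?K" using T A bounded_subset[OF A(2) T(2)] by (auto simp: compact_eq_bounded_closed)
  have Tm: "T \<in> sets borel" using T by (auto intro: borel_closed)
  have "emeasure lborel A \<le> emeasure lborel (T \<union> (A - T))"
    using A Tm by (intro emeasure_mono) auto
  also have "\<dots> \<le> emeasure lborel T + emeasure lborel (A - T)"
    using A Tm by (intro emeasure_subadditive) auto
  also have "\<dots> \<le> emeasure lborel ?K + ennreal e"
    using T(4) A Tm K by (intro add_mono emeasure_mono) (auto simp: borel_closed compact_imp_closed)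
  finally show ?thesis using that[of ?K] K T a by auto
qed

lemma brunn_minkowski_real:
  fixes A B L :: "real set"
  assumes A: "A \<in> sets borel" "bounded A" "A \<noteq> {}" and B: "B \<in> sets borel" "bounded B" "B \<noteq> {}"
    and L: "L \<in> sets borel"
    and mid: "\<And>a b. a \<in> A \<Longrightarrow> b \<in> B \<Longrightarrow> (a + b) / 2 \<in> L"
  shows "emeasure lborel A + emeasure lborel B \<le> 2 * emeasure lborel L"
proof (rule ennreal_le_epsilon)
  fix e :: real assume e: "e > 0"
  obtain K where K: "compact K" "K \<subseteq> A" "K \<noteq> {}" "emeasure lborel A \<le> emeasure lborel K + ennreal (e/2)"
    using inner_compact_approx[OF A, of "e/2"] e by auto
  obtain K' where K': "compact K'" "K' \<subseteq> B" "K' \<noteq> {}" "emeasure lborel B \<le> emeasure lborel K' + ennreal (e/2)"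
    using inner_compact_approx[OF B, of "e/2"] e by auto
  have "emeasure lborel A + emeasure lborel B
      \<le> (emeasure lborel K + ennreal (e/2)) + (emeasure lborel K' + ennreal (e/2))"
    using K K' by (intro add_mono)
  also have "\<dots> = (emeasure lborel K + emeasure lborel K') + (ennreal (e/2) + ennreal (e/2))"
    by (simp add: ac_simps)
  also have "ennreal (e/2) + ennreal (e/2) = ennreal e"
    using e by (subst ennreal_plus[symmetric]) auto
  also have "emeasure lborel K + emeasure lborel K' \<le> 2 * emeasure lborel L"
    using K K' mid by (intro brunn_minkowski_compact_real L) auto
  finally show "emeasure lborel A + emeasure lborel B \<le> 2 * emeasure lborel L + ennreal e"
    by (simp add: add_right_mono)
qed

lemma layer_cake:
  fixes f :: "'a \<Rightarrow> real"
  assumes M: "sigma_finite_measure M" and f[measurable]: "f \<in> borel_measurable M"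
  shows "(\<integral>\<^sup>+x. ennreal (f x) \<partial>M) = (\<integral>\<^sup>+t. indicator {0<..} t * emeasure M {x\<in>space M. t < f x} \<partial>lborel)"
proof -
  interpret sigma_finite_measure M by fact
  interpret pair_sigma_finite M "lborel :: real measure" by standard
  have "(\<integral>\<^sup>+x. ennreal (f x) \<partial>M) = (\<integral>\<^sup>+x. \<integral>\<^sup>+t. (indicator {0<..} t * indicator {x\<in>space M. t < f x} x) \<partial>lborel \<partial>M)"
  proof (intro nn_integral_cong)
    fix x assume x: "x \<in> space M"
    have "(\<integral>\<^sup>+t. (indicator {0<..} t * indicator {x\<in>space M. t < f x} x) \<partial>lborel)
        = (\<integral>\<^sup>+t. indicator {0<..<f x} t \<partial>lborel)"
      using x by (intro nn_integral_cong) (auto simp: indicator_def)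
    also have "\<dots> = ennreal (f x)"
      by (cases "f x \<ge> 0") (auto simp: ennreal_neg)
    finally show "ennreal (f x) = (\<integral>\<^sup>+t. (indicator {0<..} t * indicator {x\<in>space M. t < f x} x) \<partial>lborel)" ..
  qed
  also have "\<dots> = (\<integral>\<^sup>+t. \<integral>\<^sup>+x. (indicator {0<..} t * indicator {x\<in>space M. t < f x} x) \<partial>M \<partial>lborel)"
    by (rule Fubini'[symmetric]) measurable
  also have "\<dots> = (\<integral>\<^sup>+t. indicator {0<..} t * emeasure M {x\<in>space M. t < f x} \<partial>lborel)"
    by (intro nn_integral_cong) (auto simp: nn_integral_cmult)
  finally show ?thesis .
qed

text \<open>
  When both suprema are \<open>1\<close>, the superlevel sets of \<open>A\<close> and \<open>B\<close> at each level below \<open>1\<close> are non-empty and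
  their midpoints lie in the superlevel set of \<open>M\<close>, so the inequality is Brunn-Minkowski integrated over the levels.
\<close>

lemma prekopa_leindler_sup_one:
  fixes A B M :: "real \<Rightarrow> real"
  assumes [measurable]: "A \<in> borel_measurable borel" "B \<in> borel_measurable borel" "M \<in> borel_measurable borel"
    and A1: "\<And>x. A x \<le> 1" "\<And>t. t < 1 \<Longrightarrow> \<exists>x. t < A x" "\<And>t. t > 0 \<Longrightarrow> bounded {x. t < A x}"
    and B1: "\<And>x. B x \<le> 1" "\<And>t. t < 1 \<Longrightarrow> \<exists>x. t < B x" "\<And>t. t > 0 \<Longrightarrow> bounded {x. t < B x}"
    and M: "\<And>x. 0 \<le> M x" "\<And>x y. 0 \<le> A x \<Longrightarrow> 0 \<le> B y \<Longrightarrow> A x * B y \<le> (M ((x + y) / 2))\<^sup>2"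
  shows "(\<integral>\<^sup>+x. A x \<partial>lborel) + (\<integral>\<^sup>+x. B x \<partial>lborel) \<le> 2 * (\<integral>\<^sup>+x. M x \<partial>lborel)"
proof -
  have sf: "sigma_finite_measure (lborel :: real measure)" by standard
  have "(\<integral>\<^sup>+x. A x \<partial>lborel) + (\<integral>\<^sup>+x. B x \<partial>lborel) =
    (\<integral>\<^sup>+t. indicator {0<..} t * emeasure lborel {x. t < A x} + indicator {0<..} t * emeasure lborel {x. t < B x} \<partial>lborel)"
    using layer_cake[OF sf, of A] layer_cake[OF sf, of B] by (simp add: nn_integral_add)
  also have "\<dots> \<le> (\<integral>\<^sup>+t. 2 * (indicator {0<..} t * emeasure lborel {x. t < M x}) \<partial>lborel)"
  proof (intro nn_integral_mono)
    fix t :: real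
    consider "t \<le> 0" | "t \<ge> 1" | "0 < t" "t < 1" by linarith
    then show "indicator {0<..} t * emeasure lborel {x. t < A x} + indicator {0<..} t * emeasure lborel {x. t < B x}
      \<le> 2 * (indicator {0<..} t * emeasure lborel {x. t < M x})"
    proof cases
      case 2
      then have "{x. t < A x} = {}" "{x. t < B x} = {}" using A1(1) B1(1) by (auto simp: not_less intro: order_trans)
      then show ?thesis by simp
    next
      case 3
      have "emeasure lborel {x. t < A x} + emeasure lborel {x. t < B x} \<le> 2 * emeasure lborel {x. t < M x}"
      proof (rule brunn_minkowski_real)
        fix a b assume "a \<in> {x. t < A x}" "b \<in> {x. t < B x}"
        then have "t * t < A a * B b" using 3 by (intro mult_strict_mono) auto
        also have "\<dots> \<le> (M ((a + b) / 2))\<^sup>2" using \<open>a \<in> _\<close> \<open>b \<in> _\<close> 3 by (intro M) auto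
        finally have "t\<^sup>2 < (M ((a + b) / 2))\<^sup>2" by (simp add: power2_eq_square)
        then show "(a + b) / 2 \<in> {x. t < M x}" using M(1) power_less_imp_less_base by blast
      qed (use 3 A1 B1 in auto)
      then show ?thesis using 3 by simp
    qed simp
  qed
  also have "\<dots> = 2 * (\<integral>\<^sup>+x. M x \<partial>lborel)"
    using layer_cake[OF sf, of M] by (simp add: nn_integral_cmult)
  finally show ?thesis .
qed

lemma ennreal_four_mult_le_square: "4 * (x * y) \<le> (x + y)\<^sup>2" for x y :: ennreal
proof (cases "x = top \<or> y = top")
  case True
  then have "(x + y)\<^sup>2 = top" by (auto simp: power2_eq_square ennreal_mult_eq_top_iff)
  then show ?thesis by simp
next
  case False
  then obtain a b where ab: "x = ennreal a" "y = ennreal b" "0 \<le> a" "0 \<le> b"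
    by (metis ennreal_cases)
  have "4 * (a * b) \<le> (a + b)\<^sup>2" using sum_squares_ge_zero[of "a - b" 0] by (simp add: power2_eq_square algebra_simps)
  then have "ennreal (4 * (a * b)) \<le> ennreal ((a + b)\<^sup>2)" by (rule ennreal_leI)
  then show ?thesis using ab by (simp add: ennreal_mult ennreal_plus[symmetric] ennreal_power del: ennreal_plus)
qed

lemma prekopa_leindler_real:
  fixes A B M :: "real \<Rightarrow> real"
  assumes [measurable]: "A \<in> borel_measurable borel" "B \<in> borel_measurable borel" "M \<in> borel_measurable borel"
    and A: "\<And>x. 0 \<le> A x" "bdd_above (range A)" "\<And>t. t > 0 \<Longrightarrow> bounded {x. t < A x}"
    and B: "\<And>x. 0 \<le> B x" "bdd_above (range B)" "\<And>t. t > 0 \<Longrightarrow> bounded {x. t < B x}"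
    and M: "\<And>x. 0 \<le> M x" "\<And>x y. A x * B y \<le> (M ((x + y) / 2))\<^sup>2"
  shows "(\<integral>\<^sup>+x. A x \<partial>lborel) * (\<integral>\<^sup>+x. B x \<partial>lborel) \<le> (\<integral>\<^sup>+x. M x \<partial>lborel)\<^sup>2"
proof -
  define \<alpha> where "\<alpha> = (SUP x. A x)"
  define \<beta> where "\<beta> = (SUP x. B x)"
  have Ale: "A x \<le> \<alpha>" and Ble: "B x \<le> \<beta>" for x unfolding \<alpha>_def \<beta>_def using A(2) B(2) by (auto intro: cSUP_upper)
  have a0: "0 \<le> \<alpha>" "0 \<le> \<beta>" using Ale[of 0] A(1)[of 0] Ble[of 0] B(1)[of 0] by auto
  show ?thesis
  proof (cases "\<alpha> = 0 \<or> \<beta> = 0")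
    case True
    then have "(\<forall>x. A x = 0) \<or> (\<forall>x. B x = 0)" using Ale Ble A(1) B(1) by (metis antisym)
    then show ?thesis by auto
  next
    case False
    then have pos: "\<alpha> > 0" "\<beta> > 0" using a0 by auto
    define m where "m = sqrt (\<alpha> * \<beta>)"
    have m: "m > 0" "m\<^sup>2 = \<alpha> * \<beta>" using pos by (auto simp: m_def)
    let ?X = "\<integral>\<^sup>+x. A x \<partial>lborel" and ?Y = "\<integral>\<^sup>+x. B x \<partial>lborel" and ?Z = "\<integral>\<^sup>+x. M x \<partial>lborel"
    have "(\<integral>\<^sup>+x. ennreal (A x / \<alpha>) \<partial>lborel) + (\<integral>\<^sup>+x. ennreal (B x / \<beta>) \<partial>lborel) \<le> 2 * (\<integral>\<^sup>+x. ennreal (M x / m) \<partial>lborel)"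
    proof (rule prekopa_leindler_sup_one)
      show "\<exists>x. t < A x / \<alpha>" if "t < 1" for t
        using less_cSUP_iff[of UNIV A "t * \<alpha>"] A(2) pos that by (auto simp: \<alpha>_def[symmetric] field_simps)
      show "\<exists>x. t < B x / \<beta>" if "t < 1" for t
        using less_cSUP_iff[of UNIV B "t * \<beta>"] B(2) pos that by (auto simp: \<beta>_def[symmetric] field_simps)
      show "bounded {x. t < A x / \<alpha>}" if "t > 0" for t
        using A(3)[of "t * \<alpha>"] pos that by (simp add: field_simps)
      show "bounded {x. t < B x / \<beta>}" if "t > 0" for t
        using B(3)[of "t * \<beta>"] pos that by (simp add: field_simps)
      show "A x / \<alpha> * (B y / \<beta>) \<le> (M ((x + y) / 2) / m)\<^sup>2" for x y
        using M(2)[of x y] m pos by (simp add: power_divide divide_right_mono)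
    qed (use pos Ale Ble M m in auto)
    moreover have "(\<integral>\<^sup>+x. ennreal (A x / \<alpha>) \<partial>lborel) = ennreal (1/\<alpha>) * ?X"
      using pos A(1) by (subst nn_integral_cmult[symmetric]) (auto simp: ennreal_mult[symmetric])
    moreover have "(\<integral>\<^sup>+x. ennreal (B x / \<beta>) \<partial>lborel) = ennreal (1/\<beta>) * ?Y"
      using pos B(1) by (subst nn_integral_cmult[symmetric]) (auto simp: ennreal_mult[symmetric])
    moreover have "(\<integral>\<^sup>+x. ennreal (M x / m) \<partial>lborel) = ennreal (1/m) * ?Z"
      using m M(1) by (subst nn_integral_cmult[symmetric]) (auto simp: ennreal_mult[symmetric])
    ultimately have le: "ennreal (1/\<alpha>) * ?X + ennreal (1/\<beta>) * ?Y \<le> 2 * (ennreal (1/m) * ?Z)" by simp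
    have "4 * ((ennreal (1/\<alpha>) * ?X) * (ennreal (1/\<beta>) * ?Y)) \<le> (ennreal (1/\<alpha>) * ?X + ennreal (1/\<beta>) * ?Y)\<^sup>2"
      by (rule ennreal_four_mult_le_square)
    also have "\<dots> \<le> (2 * (ennreal (1/m) * ?Z))\<^sup>2"
      using le by (intro power_mono) auto
    finally have "4 * ((ennreal (1/\<alpha>) * ?X) * (ennreal (1/\<beta>) * ?Y)) \<le> (2 * (ennreal (1/m) * ?Z))\<^sup>2" .
    then have "ennreal (4 * m\<^sup>2 / 4) * (4 * ((ennreal (1/\<alpha>) * ?X) * (ennreal (1/\<beta>) * ?Y))) \<le> ennreal (4 * m\<^sup>2 / 4) * (2 * (ennreal (1/m) * ?Z))\<^sup>2"
      by (intro mult_left_mono) auto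
    also have "ennreal (4 * m\<^sup>2 / 4) * (4 * ((ennreal (1/\<alpha>) * ?X) * (ennreal (1/\<beta>) * ?Y))) = 4 * ((ennreal (m\<^sup>2) * ennreal (1/\<alpha>) * ennreal (1/\<beta>)) * (?X * ?Y))"
      by (simp add: ac_simps)
    also have "ennreal (m\<^sup>2) * ennreal (1/\<alpha>) * ennreal (1/\<beta>) = 1"
      using m pos by (simp add: ennreal_mult[symmetric])
    also have "ennreal (4 * m\<^sup>2 / 4) * (2 * (ennreal (1/m) * ?Z))\<^sup>2 = 4 * ((ennreal (m\<^sup>2) * ennreal (1/m) * ennreal (1/m)) * ?Z\<^sup>2)"
      by (simp add: power2_eq_square ac_simps)
    also have "ennreal (m\<^sup>2) * ennreal (1/m) * ennreal (1/m) = 1"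
      using m(1) by (simp add: ennreal_mult[symmetric] power2_eq_square)
    finally have "4 * (?X * ?Y) \<le> 4 * ?Z\<^sup>2" by simp
    then show ?thesis by (subst (asm) ennreal_mult_le_mult_iff) auto
  qed
qed

lemma nn_integral_exp_substitution:
  fixes f :: "real \<Rightarrow> ennreal"
  assumes [measurable]: "f \<in> borel_measurable borel"
  shows "(\<integral>\<^sup>+s. f s * indicator {0<..} s \<partial>lborel) = (\<integral>\<^sup>+u. f (exp u) * ennreal (exp u) \<partial>lborel)"
proof -
  have ind: "(SUP n::nat. indicator {- real n..real n} u) = (1::ennreal)" for u
  proof -
    have "\<exists>n::nat. \<bar>u\<bar> \<le> real n" by (rule real_arch_simple)
    then obtain n :: nat where "\<bar>u\<bar> \<le> real n" by auto
    then have "indicator {- real n..real n} u = (1::ennreal)" by (simp add: indicator_def abs_le_iff)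
    then have "1 \<le> (SUP n::nat. indicator {- real n..real n} u :: ennreal)"
      using SUP_upper[of n UNIV "\<lambda>n. indicator {- real n..real n} u :: ennreal"] by simp
    moreover have "(SUP n::nat. indicator {- real n..real n} u :: ennreal) \<le> 1"
      by (intro SUP_least) (auto simp: indicator_def)
    ultimately show ?thesis by (rule antisym[rotated])
  qed
  have ind': "(SUP n::nat. indicator {exp (- real n)..exp (real n)} s) = (indicator {0<..} s::ennreal)" for s
  proof (cases "s > 0")
    case True
    then have "indicator {exp (- real n)..exp (real n)} s = (indicator {- real n..real n} (ln s) :: ennreal)" for n
      using exp_le_cancel_iff[of "- real n" "ln s"] exp_le_cancel_iff[of "ln s" "real n"]
      by (simp add: indicator_def)
    then show ?thesis using ind True by simp
  next
    case False
    then have "indicator {exp (- real n)..exp (real n)} s = (0 :: ennreal)" for n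
      using exp_gt_zero[of "- real n"] by (simp add: indicator_def del: exp_gt_zero)
    then show ?thesis using False by simp
  qed
  have "(\<integral>\<^sup>+s. f s * indicator {0<..} s \<partial>lborel)
      = (\<integral>\<^sup>+s. (SUP n::nat. f s * indicator {exp (- real n)..exp (real n)} s) \<partial>lborel)"
    by (simp add: ind' SUP_mult_left_ennreal[symmetric])
  also have "\<dots> = (SUP n::nat. \<integral>\<^sup>+s. f s * indicator {exp (- real n)..exp (real n)} s \<partial>lborel)"
    by (intro nn_integral_monotone_convergence_SUP incseq_SucI le_funI mult_left_mono)
       (auto simp: indicator_def elim!: order_trans[rotated] order_trans)
  also have "\<dots> = (SUP n::nat. \<integral>\<^sup>+u. f (exp u) * ennreal (exp u) * indicator {- real n..real n} u \<partial>lborel)"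
  proof (intro SUP_cong refl)
    fix n :: nat
    show "(\<integral>\<^sup>+s. f s * indicator {exp (- real n)..exp (real n)} s \<partial>lborel) = 
       (\<integral>\<^sup>+u. f (exp u) * ennreal (exp u) * indicator {- real n..real n} u \<partial>lborel)"
    proof (cases "n = 0")
      case True
      have "AE s in lborel. s \<noteq> (1::real)" by (rule AE_lborel_singleton)
      then have 1: "(\<integral>\<^sup>+s. f s * indicator {1} s \<partial>lborel) = 0"
        by (subst nn_integral_0_iff_AE) (auto simp: indicator_def)
      have "AE s in lborel. s \<noteq> (0::real)" by (rule AE_lborel_singleton)
      then have 2: "(\<integral>\<^sup>+s. f (exp s) * ennreal (exp s) * indicator {0} s \<partial>lborel) = 0"
        by (subst nn_integral_0_iff_AE) (auto simp: indicator_def)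
      show ?thesis using 1 2 True by simp
    next
      case False
      show ?thesis
        by (rule nn_integral_substitution_aux[where g=exp and g'=exp])
           (use False in \<open>auto intro!: derivative_eq_intros continuous_intros\<close>)
    qed
  qed
  also have "\<dots> = (\<integral>\<^sup>+u. (SUP n::nat. f (exp u) * ennreal (exp u) * indicator {- real n..real n} u) \<partial>lborel)"
    by (intro nn_integral_monotone_convergence_SUP[symmetric] incseq_SucI le_funI mult_left_mono)
       (auto simp: indicator_def)
  also have "\<dots> = (\<integral>\<^sup>+u. f (exp u) * ennreal (exp u) \<partial>lborel)"
    by (simp add: ind SUP_mult_left_ennreal[symmetric])
  finally show ?thesis .
qed

text \<open>
  The value is \<open>sqrt (\<pi> / 2)\<close>. It enters the Blaschke-Santalo inequality through the Gaussian integral over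
  the whole space, which is also expressed by it.
\<close>

definition half_gauss :: ennreal where
  "half_gauss = (\<integral>\<^sup>+r. ennreal (exp (- r\<^sup>2 / 2)) * indicator {0<..} r \<partial>lborel)"

lemma half_gauss_finite: "half_gauss < top"
proof -
  have "half_gauss \<le> (\<integral>\<^sup>+r. ennreal (exp (1 - r)) * indicator {0..} r \<partial>lborel)"
    unfolding half_gauss_def
  proof (intro nn_integral_mono)
    fix r :: real
    have "- r\<^sup>2 / 2 \<le> 1 - r" using zero_le_power2[of "r - 1"] by (simp add: power2_eq_square algebra_simps)
    then show "ennreal (exp (- r\<^sup>2 / 2)) * indicator {0<..} r \<le> ennreal (exp (1 - r)) * indicator {0..} r"
      by (auto simp: indicator_def intro!: ennreal_leI)
  qed
  also have "\<dots> = ennreal (0 - (- exp (1 - 0 :: real)))"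
  proof (rule nn_integral_FTC_atLeast)
    show "((\<lambda>r::real. - exp (1 - r)) \<longlongrightarrow> 0) at_top"
      by real_asymp
  qed (auto intro!: derivative_eq_intros)
  finally show ?thesis by (rule le_less_trans) (rule ennreal_less_top)
qed

text \<open>
  With \<open>s = exp x\<close> and \<open>t = exp y\<close>, the product \<open>s * t\<close> is the square of \<open>exp ((x + y) / 2)\<close>, so the hypothesis
  becomes that of the Prekopa-Leindler inequality. The bounds on \<open>a\<close> and \<open>b\<close> make the superlevel sets of
  \<open>a (exp x) * exp x\<close> bounded in both directions.
\<close>

lemma half_line_santalo:
  fixes a b :: "real \<Rightarrow> real"
  assumes [measurable]: "a \<in> borel_measurable borel" "b \<in> borel_measurable borel"
    and a: "\<And>s. 0 \<le> a s" "\<And>s. a s \<le> K" "\<And>s. a s \<noteq> 0 \<Longrightarrow> s \<le> R"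
    and b: "\<And>s. 0 \<le> b s" "\<And>s. b s \<le> K" "\<And>s. b s \<noteq> 0 \<Longrightarrow> s \<le> R"
    and C: "C \<ge> 0" and ab: "\<And>s t. s > 0 \<Longrightarrow> t > 0 \<Longrightarrow> a s * b t \<le> C * exp (- (s * t))"
  shows "(\<integral>\<^sup>+s. ennreal (a s) * indicator {0<..} s \<partial>lborel) * (\<integral>\<^sup>+s. ennreal (b s) * indicator {0<..} s \<partial>lborel)
    \<le> ennreal C * half_gauss\<^sup>2"
proof -
  have bdd: "bdd_above (range (\<lambda>u. c (exp u) * exp u))" and bnd: "t > 0 \<Longrightarrow> bounded {u. t < c (exp u) * exp u}"
    if c: "\<And>s. 0 \<le> c s" "\<And>s. c s \<le> K" "\<And>s. c s \<noteq> 0 \<Longrightarrow> s \<le> R" for c :: "real \<Rightarrow> real" and t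
  proof -
    have K: "0 \<le> K" using c(1,2)[of 0] by linarith
    have le: "c (exp u) * exp u \<le> K * \<bar>R\<bar>" for u
    proof (cases "c (exp u) = 0")
      case False
      then have "exp u \<le> \<bar>R\<bar>" using c(3) by fastforce
      then show ?thesis using c K by (intro mult_mono) auto
    qed (use K in auto)
    then show "bdd_above (range (\<lambda>u. c (exp u) * exp u))" by (intro bdd_aboveI) auto
    show "bounded {u. t < c (exp u) * exp u}" if "t > 0"
    proof -
      have "{u. t < c (exp u) * exp u} \<subseteq> {ln (t / (K + 1)) .. ln R}"
      proof safe
        fix u assume u: "t < c (exp u) * exp u"
        then have nz: "c (exp u) \<noteq> 0" using that by auto
        then have "exp u \<le> R" by (rule c(3))
        moreover have "t < (K + 1) * exp u" using u c(2)[of "exp u"]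
          by (smt (verit) exp_gt_zero mult_right_mono)
        ultimately show "u \<in> {ln (t / (K + 1)) .. ln R}" using K that
          by (smt (verit) atLeastAtMost_iff divide_pos_pos exp_gt_zero ln_exp ln_le_cancel_iff pos_divide_le_eq mult.commute)
      qed
      then show ?thesis by (rule bounded_subset[rotated]) auto
    qed
  qed
  let ?A = "\<lambda>u. a (exp u) * exp u" and ?B = "\<lambda>u. b (exp u) * exp u"
  let ?M = "\<lambda>w. sqrt C * (exp (- (exp w)\<^sup>2 / 2) * exp w)"
  have "(\<integral>\<^sup>+s. ennreal (a s) * indicator {0<..} s \<partial>lborel) * (\<integral>\<^sup>+s. ennreal (b s) * indicator {0<..} s \<partial>lborel)
     = (\<integral>\<^sup>+u. ?A u \<partial>lborel) * (\<integral>\<^sup>+u. ?B u \<partial>lborel)"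
    using a b by (simp add: nn_integral_exp_substitution ennreal_mult)
  also have "\<dots> \<le> (\<integral>\<^sup>+u. ?M u \<partial>lborel)\<^sup>2"
  proof (rule prekopa_leindler_real)
    fix x y :: real
    have e: "exp ((x + y) / 2) * exp ((x + y) / 2) = exp x * exp y"
      by (simp add: mult_exp_exp)
    have "?A x * ?B y = (a (exp x) * b (exp y)) * (exp x * exp y)" by simp
    also have "\<dots> \<le> (C * exp (- (exp x * exp y))) * (exp x * exp y)"
      by (intro mult_right_mono ab) auto
    also have "\<dots> = (?M ((x + y) / 2))\<^sup>2"
      using C by (simp add: power_mult_distrib power2_eq_square[of "exp _"] e mult_exp_exp)
    finally show "?A x * ?B y \<le> (?M ((x + y) / 2))\<^sup>2" .
  qed (use a b C bdd bnd in auto)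
  also have "(\<integral>\<^sup>+u. ?M u \<partial>lborel) = ennreal (sqrt C) * half_gauss"
    using C unfolding half_gauss_def
    by (subst nn_integral_exp_substitution) (auto simp: ennreal_mult nn_integral_cmult)
  also have "(ennreal (sqrt C) * half_gauss)\<^sup>2 = ennreal C * half_gauss\<^sup>2"
    using C by (simp add: power_mult_distrib ennreal_power)
  finally show ?thesis .
qed

section \<open>Functions of bounded support on finite products of the line\<close>

text \<open>
  The dimension is the number of elements of \<open>I\<close>, which makes induction over the dimension possible.
\<close>

abbreviation PL :: "'i set \<Rightarrow> ('i \<Rightarrow> real) measure" where
  "PL I \<equiv> Pi\<^sub>M I (\<lambda>_. lborel :: real measure)"

interpretation PiM_lborel: product_sigma_finite "\<lambda>_::'i. lborel :: real measure" by standard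

lemma space_PL: "x \<in> space (PL I) \<longleftrightarrow> x \<in> extensional I"
  by (simp add: space_PiM PiE_def)

lemma integrable_insert_pair:
  fixes f :: "('i \<Rightarrow> real) \<Rightarrow> real"
  assumes I: "finite I" "k \<notin> I" and f: "integrable (PL (insert k I)) f"
  shows "integrable (PL I \<Otimes>\<^sub>M lborel) (\<lambda>(x, t). f (x(k := t)))"
proof -
  let ?M = "PL (insert k I)"
  interpret I: sigma_finite_measure "PL I" by (rule PiM_lborel.sigma_finite) fact
  interpret P: pair_sigma_finite "PL I" "lborel :: real measure" by standard
  have [measurable]: "f \<in> borel_measurable ?M" using f by auto
  have m[measurable]: "(\<lambda>(x, t). x(k := t)) \<in> measurable (PL I \<Otimes>\<^sub>M lborel) ?M"
    unfolding split_beta' by (rule measurable_fun_upd[of _ I]) auto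
  have m2[measurable]: "(\<lambda>p. (fst p)(k := snd p)) \<in> measurable (PL I \<Otimes>\<^sub>M lborel) ?M"
    by (rule measurable_fun_upd[of _ I]) auto
  show ?thesis
  proof (rule integrableI_bounded)
    show "(\<lambda>(x, t). f (x(k := t))) \<in> borel_measurable (PL I \<Otimes>\<^sub>M lborel)"
      unfolding split_beta' by measurable
    have "(\<integral>\<^sup>+p. ennreal (norm (case p of (x, t) \<Rightarrow> f (x(k := t)))) \<partial>(PL I \<Otimes>\<^sub>M lborel))
       = (\<integral>\<^sup>+x. \<integral>\<^sup>+t. ennreal (norm (f (x(k := t)))) \<partial>lborel \<partial>PL I)"
      by (subst lborel.nn_integral_fst[symmetric]) (auto simp: split_beta')
    also have "\<dots> = (\<integral>\<^sup>+x. ennreal (norm (f x)) \<partial>?M)"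
      using I by (subst PiM_lborel.product_nn_integral_insert) auto
    also have "\<dots> < \<infinity>" using f by (simp add: integrable_iff_bounded)
    finally show "(\<integral>\<^sup>+p. ennreal (norm (case p of (x, t) \<Rightarrow> f (x(k := t)))) \<partial>(PL I \<Otimes>\<^sub>M lborel)) < \<infinity>" .
  qed
qed

lemma integral_insert_rev:
  fixes f :: "('i \<Rightarrow> real) \<Rightarrow> real"
  assumes I: "finite I" "k \<notin> I" and f: "integrable (PL (insert k I)) f"
  shows "integral\<^sup>L (PL (insert k I)) f = (\<integral>t. \<integral>x. f (x(k := t)) \<partial>PL I \<partial>lborel)"
proof -
  interpret I: sigma_finite_measure "PL I" by (rule PiM_lborel.sigma_finite) fact
  interpret P: pair_sigma_finite "PL I" "lborel :: real measure" by standard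
  show ?thesis
    unfolding PiM_lborel.product_integral_insert[OF I f]
    by (rule P.Fubini_integral[symmetric]) (rule integrable_insert_pair[OF I f])
qed

lemma distr_PL_translate:
  assumes I: "finite I"
  shows "distr (PL I) (PL I) (\<lambda>x. \<lambda>i\<in>I. x i + a i) = PL I"
proof (rule PiM_lborel.PiM_eqI[OF I])
  fix A :: "'a \<Rightarrow> real set" assume A: "\<And>i. i \<in> I \<Longrightarrow> A i \<in> sets lborel"
  have [measurable]: "(\<lambda>x. \<lambda>i\<in>I. x i + a i) \<in> measurable (PL I) (PL I)"
    by (intro measurable_restrict) (simp, measurable)
  have tr: "(\<lambda>x. x + a i) -` A i \<in> sets borel" if "i \<in> I" for i
    using measurable_sets[of "\<lambda>x. x + a i" borel borel "A i"] A[OF that] by simp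
  have "emeasure (distr (PL I) (PL I) (\<lambda>x. \<lambda>i\<in>I. x i + a i)) (Pi\<^sub>E I A) = 
      emeasure (PL I) ((\<lambda>x. \<lambda>i\<in>I. x i + a i) -` Pi\<^sub>E I A \<inter> space (PL I))"
    using A I by (intro emeasure_distr) (auto intro!: sets_PiM_I_finite)
  also have "(\<lambda>x. \<lambda>i\<in>I. x i + a i) -` Pi\<^sub>E I A \<inter> space (PL I) = (\<Pi>\<^sub>E i\<in>I. (\<lambda>x. x + a i) -` A i)"
    by (auto simp: space_PiM PiE_iff)
  also have "emeasure (PL I) \<dots> = (\<Prod>i\<in>I. emeasure lborel ((\<lambda>x. x + a i) -` A i))"
    using tr I by (intro PiM_lborel.emeasure_PiM) auto
  also have "\<dots> = (\<Prod>i\<in>I. emeasure lborel (A i))"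
  proof (intro prod.cong refl)
    fix i assume i: "i \<in> I"
    have "emeasure lborel (A i) = emeasure (distr lborel borel ((+) (a i))) (A i)"
      by (simp add: lborel_distr_plus)
    also have "\<dots> = emeasure lborel ((\<lambda>x. x + a i) -` A i)"
      using A[OF i] by (subst emeasure_distr) (auto simp: add.commute[of _ "a i"])
    finally show "emeasure lborel ((\<lambda>x. x + a i) -` A i) = emeasure lborel (A i)" ..
  qed
  finally show "emeasure (distr (PL I) (PL I) (\<lambda>x. \<lambda>i\<in>I. x i + a i)) (Pi\<^sub>E I A) = (\<Prod>i\<in>I. emeasure lborel (A i))" .
qed simp

lemma integral_PL_translate:
  fixes f :: "('i \<Rightarrow> real) \<Rightarrow> real"
  assumes I: "finite I" and f: "f \<in> borel_measurable (PL I)"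
  shows "(\<integral>x. f (\<lambda>i\<in>I. x i + a i) \<partial>PL I) = integral\<^sup>L (PL I) f"
proof -
  have "(\<lambda>x. \<lambda>i\<in>I. x i + a i) \<in> measurable (PL I) (PL I)"
    by (intro measurable_restrict) (simp, measurable)
  from integral_distr[OF this f] show ?thesis by (simp add: distr_PL_translate[OF I])
qed

text \<open>
  Barycentres and half-space integrals of such functions exist, and the class is closed under the operations of the
  induction step: multiplication by locally bounded functions, shears, and integration over one coordinate.
\<close>

definition bounded_support :: "'i set \<Rightarrow> (('i \<Rightarrow> real) \<Rightarrow> real) \<Rightarrow> bool" where
  "bounded_support I f \<longleftrightarrow> f \<in> borel_measurable (PL I) \<and>
     (\<exists>R\<ge>0. \<forall>x\<in>space (PL I). \<bar>f x\<bar> \<le> R \<and> (f x \<noteq> 0 \<longrightarrow> (\<forall>i\<in>I. \<bar>x i\<bar> \<le> R)))"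

text \<open>
  One number bounds the values of \<open>f\<close> and the coordinates of the points of its support.
\<close>

definition support_bound :: "'i set \<Rightarrow> (('i \<Rightarrow> real) \<Rightarrow> real) \<Rightarrow> real" where
  "support_bound I f = (SOME R. R \<ge> 0 \<and> (\<forall>x\<in>space (PL I). \<bar>f x\<bar> \<le> R \<and> (f x \<noteq> 0 \<longrightarrow> (\<forall>i\<in>I. \<bar>x i\<bar> \<le> R))))"

lemma support_bound:
  assumes "bounded_support I f"
  shows "support_bound I f \<ge> 0" "\<And>x. x \<in> space (PL I) \<Longrightarrow> \<bar>f x\<bar> \<le> support_bound I f"
    "\<And>x i. x \<in> space (PL I) \<Longrightarrow> f x \<noteq> 0 \<Longrightarrow> i \<in> I \<Longrightarrow> \<bar>x i\<bar> \<le> support_bound I f"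
proof -
  let ?P = "\<lambda>R. R \<ge> 0 \<and> (\<forall>x\<in>space (PL I). \<bar>f x\<bar> \<le> R \<and> (f x \<noteq> 0 \<longrightarrow> (\<forall>i\<in>I. \<bar>x i\<bar> \<le> R)))"
  have "\<exists>R. ?P R" using assms unfolding bounded_support_def by blast
  then have "?P (support_bound I f)" unfolding support_bound_def by (rule someI_ex)
  then show "support_bound I f \<ge> 0" "\<And>x. x \<in> space (PL I) \<Longrightarrow> \<bar>f x\<bar> \<le> support_bound I f"
    "\<And>x i. x \<in> space (PL I) \<Longrightarrow> f x \<noteq> 0 \<Longrightarrow> i \<in> I \<Longrightarrow> \<bar>x i\<bar> \<le> support_bound I f" by blast+
qed

lemma bounded_support_measurable: "bounded_support I f \<Longrightarrow> f \<in> borel_measurable (PL I)"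
  by (simp add: bounded_support_def)

lemma bounded_supportI:
  assumes "f \<in> borel_measurable (PL I)" "\<And>x. x \<in> space (PL I) \<Longrightarrow> \<bar>f x\<bar> \<le> K"
    "\<And>x i. x \<in> space (PL I) \<Longrightarrow> f x \<noteq> 0 \<Longrightarrow> i \<in> I \<Longrightarrow> \<bar>x i\<bar> \<le> R"
  shows "bounded_support I f"
  unfolding bounded_support_def
proof (intro conjI exI[of _ "max 0 (max K R)"] ballI impI)
  show "\<bar>f x\<bar> \<le> max 0 (max K R)" if "x \<in> space (PL I)" for x using assms(2)[OF that] by linarith
  show "\<bar>x i\<bar> \<le> max 0 (max K R)" if "x \<in> space (PL I)" "f x \<noteq> 0" "i \<in> I" for x i
    using assms(3)[OF that] by linarith
qed (use assms in auto)

lemma box_integrable: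
  assumes I: "finite I"
  shows "integrable (PL I) (\<lambda>x. R * (\<Prod>i\<in>I. indicator {-R..R} (x i)))"
  using I by (intro integrable_mult_right PiM_lborel.product_integrable_prod) (auto intro!: integrable_real_indicator simp: emeasure_lborel_Icc_eq)

lemma bounded_by_box:
  fixes x :: "'i \<Rightarrow> real"
  assumes "R \<ge> 0" "\<bar>f x\<bar> \<le> R" "\<And>i. f x \<noteq> 0 \<Longrightarrow> i \<in> I \<Longrightarrow> \<bar>x i\<bar> \<le> R"
  shows "\<bar>f x\<bar> \<le> R * (\<Prod>i\<in>I. indicator {-R..R} (x i))"
proof (cases "f x = 0")
  case False
  then have "x i \<in> {-R..R}" if "i \<in> I" for i
    using assms(3)[OF False that] by (simp add: abs_le_iff minus_le_iff)
  then have "(\<Prod>i\<in>I. indicator {-R..R} (x i)) = (1::real)"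
    by (intro prod.neutral) (simp add: indicator_def)
  then show ?thesis using assms by simp
qed (use assms in \<open>auto intro!: mult_nonneg_nonneg prod_nonneg\<close>)

lemma bounded_support_integrable:
  assumes I: "finite I" and f: "bounded_support I f"
  shows "integrable (PL I) f"
proof -
  define R where "R = support_bound I f"
  note R = support_bound[OF f, folded R_def]
  show ?thesis
  proof (rule Bochner_Integration.integrable_bound[OF box_integrable[OF I, of R]])
    show "AE x in PL I. norm (f x) \<le> norm (R * (\<Prod>i\<in>I. indicator {-R..R} (x i)))"
    proof (intro AE_I2)
      fix x assume x: "x \<in> space (PL I)"
      have "\<bar>f x\<bar> \<le> R * (\<Prod>i\<in>I. indicator {-R..R} (x i))"
        using R x by (intro bounded_by_box) auto
      then show "norm (f x) \<le> norm (R * (\<Prod>i\<in>I. indicator {-R..R} (x i)))"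
        using R(1) by (simp add: abs_mult abs_prod)
    qed
  qed (use f in \<open>simp add: bounded_support_def\<close>)
qed

lemma bounded_support_mult:
  assumes f: "bounded_support I f" and u: "u \<in> borel_measurable (PL I)"
    and bd: "\<And>R::real. \<exists>K. \<forall>x\<in>space (PL I). (\<forall>i\<in>I. \<bar>x i\<bar> \<le> R) \<longrightarrow> \<bar>u x\<bar> \<le> K"
  shows "bounded_support I (\<lambda>x. u x * f x)"
proof -
  define R where "R = support_bound I f"
  note R = support_bound[OF f, folded R_def]
  obtain K where K: "\<And>x. x\<in>space (PL I) \<Longrightarrow> (\<forall>i\<in>I. \<bar>x i\<bar> \<le> R) \<Longrightarrow> \<bar>u x\<bar> \<le> K" using bd[of R] by blast
  show ?thesis
  proof (rule bounded_supportI)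
    show "(\<lambda>x. u x * f x) \<in> borel_measurable (PL I)"
      using u bounded_support_measurable[OF f] by measurable
    show "\<bar>u x * f x\<bar> \<le> \<bar>K\<bar> * R" if x: "x \<in> space (PL I)" for x
    proof (cases "f x = 0")
      case False
      then have "\<bar>u x\<bar> \<le> \<bar>K\<bar>" using K[OF x] R(3)[OF x] by fastforce
      then show ?thesis unfolding abs_mult using R(2)[OF x] by (intro mult_mono) auto
    qed (use R in auto)
    show "\<bar>x i\<bar> \<le> R" if "x \<in> space (PL I)" "u x * f x \<noteq> 0" "i \<in> I" for x i
      using R(3)[OF that(1) _ that(3)] that(2) by auto
  qed
qed

lemma bounded_support_coord:
  assumes f: "bounded_support I f" and i: "i \<in> I"
  shows "bounded_support I (\<lambda>x. x i * f x)"
  using i by (intro bounded_support_mult[OF f] exI) (auto simp: i)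

lemma bounded_support_indicator:
  assumes f: "bounded_support I f" and P: "Measurable.pred (PL I) P"
  shows "bounded_support I (\<lambda>x. (if P x then 1 else 0) * f x)"
  using P by (intro bounded_support_mult[OF f]) (auto intro!: exI[of _ 1])

lemma measurable_line:
  fixes f :: "('i \<Rightarrow> real) \<Rightarrow> real"
  assumes "f \<in> borel_measurable (PL (insert k I))"
  shows "(\<lambda>(x, t). f (x(k := t))) \<in> borel_measurable (PL I \<Otimes>\<^sub>M lborel)"
proof -
  have "(\<lambda>p. (fst p)(k := snd p)) \<in> measurable (PL I \<Otimes>\<^sub>M lborel) (PL (insert k I))"
    by (rule measurable_fun_upd[of _ I]) auto
  from measurable_compose[OF this assms] show ?thesis by (simp add: split_beta')
qed

lemma measurable_slice:
  fixes f :: "('i \<Rightarrow> real) \<Rightarrow> real"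
  assumes f: "f \<in> borel_measurable (PL (insert k I))" and x: "x \<in> space (PL I)"
  shows "(\<lambda>t. f (x(k := t))) \<in> borel_measurable borel"
  using measurable_compose_Pair1[OF x measurable_line[OF f]] by simp

lemma upd_space_PL: "x \<in> space (PL I) \<Longrightarrow> x(k := t) \<in> space (PL (insert k I))"
  by (auto simp: space_PL extensional_def)

lemma bounded_support_line:
  assumes I: "k \<notin> I" and f: "bounded_support (insert k I) f"
  shows "bounded_support I (\<lambda>x. \<integral>t. f (x(k := t)) \<partial>lborel)"
proof -
  define R where "R = support_bound (insert k I) f"
  note R = support_bound[OF f, folded R_def]
  note fm = bounded_support_measurable[OF f]
  show ?thesis
  proof (rule bounded_supportI)
    show "(\<lambda>x. \<integral>t. f (x(k := t)) \<partial>lborel) \<in> borel_measurable (PL I)"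
      using measurable_line[OF fm] by (rule lborel.borel_measurable_lebesgue_integral)
    fix x assume x: "x \<in> space (PL I)"
    have "\<bar>f (x(k := t))\<bar> \<le> R * indicator {-R..R} t" for t
      using R(1) R(2)[OF upd_space_PL[OF x]] R(3)[OF upd_space_PL[OF x], of t k]
      by (cases "f (x(k := t)) = 0") (auto simp: indicator_def abs_le_iff)
    then have "(\<integral>t. \<bar>f (x(k := t))\<bar> \<partial>lborel) \<le> (\<integral>t. R * indicator {-R..R} t \<partial>lborel)"
      using R(1) by (intro integral_mono') (auto simp: emeasure_lborel_Icc_eq)
    moreover have "\<bar>\<integral>t. f (x(k := t)) \<partial>lborel\<bar> \<le> (\<integral>t. \<bar>f (x(k := t))\<bar> \<partial>lborel)"
      by (rule integral_abs_bound)
    ultimately have "\<bar>\<integral>t. f (x(k := t)) \<partial>lborel\<bar> \<le> (\<integral>t. R * indicator {-R..R} t \<partial>lborel)"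
      by linarith
    also have "\<dots> = R * (2 * R)" using R(1) by simp
    finally show "\<bar>\<integral>t. f (x(k := t)) \<partial>lborel\<bar> \<le> R * (2 * R)" .
    fix i assume nz: "(\<integral>t. f (x(k := t)) \<partial>lborel) \<noteq> 0" and i: "i \<in> I"
    have "\<exists>t. f (x(k := t)) \<noteq> 0" using nz by (rule contrapos_np) simp
    then obtain t where "f (x(k := t)) \<noteq> 0" ..
    from R(3)[OF upd_space_PL[OF x] this, of i] i I show "\<bar>x i\<bar> \<le> R" by (auto split: if_splits)
  qed
qed

section \<open>The functional Santalo inequality\<close>

text \<open>
  The sign \<open>\<sigma>\<close> selects one of the two half-lines; they are exchanged by the reflection \<open>s \<mapsto> - s\<close>, which preserves
  products \<open>s * t\<close>.
\<close>

lemma half_line_santalo_real: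
  fixes a b :: "real \<Rightarrow> real"
  assumes m[measurable]: "a \<in> borel_measurable borel" "b \<in> borel_measurable borel"
    and a: "\<And>s. 0 \<le> a s" "\<And>s. a s \<le> K" "\<And>s. a s \<noteq> 0 \<Longrightarrow> \<bar>s\<bar> \<le> K"
    and b: "\<And>s. 0 \<le> b s" "\<And>s. b s \<le> K" "\<And>s. b s \<noteq> 0 \<Longrightarrow> \<bar>s\<bar> \<le> K"
    and \<sigma>: "\<sigma> = 1 \<or> \<sigma> = -1"
    and C: "C \<ge> 0" and ab: "\<And>s t. a s * b t \<le> C * exp (- (s * t))"
  shows "(\<integral>s. (if 0 < \<sigma> * s then a s else 0) \<partial>lborel) * (\<integral>s. (if 0 < \<sigma> * s then b s else 0) \<partial>lborel)
    \<le> C * (enn2real half_gauss)\<^sup>2"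
proof -
  have ss: "\<sigma> * (\<sigma> * s) = s" for s using \<sigma> by auto
  have conv: "(\<integral>s. (if 0 < \<sigma> * s then c s else 0) \<partial>lborel) =
      enn2real (\<integral>\<^sup>+s. ennreal (c (\<sigma> * s)) * indicator {0<..} s \<partial>lborel)"
    if [measurable]: "c \<in> borel_measurable borel" and c: "\<And>s. 0 \<le> c s" for c :: "real \<Rightarrow> real"
  proof -
    have "(\<integral>s. (if 0 < \<sigma> * s then c s else 0) \<partial>lborel) = (\<integral>s. (if 0 < s then c (\<sigma> * s) else 0) \<partial>lborel)"
      using \<sigma> lborel_integral_real_affine[of \<sigma> "\<lambda>s. if 0 < \<sigma> * s then c s else 0" 0]
      unfolding add_0 ss by (auto simp del: mult_minus1 mult_1)
    also have "\<dots> = enn2real (\<integral>\<^sup>+s. ennreal (if 0 < s then c (\<sigma> * s) else 0) \<partial>lborel)"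
      using c by (intro integral_eq_nn_integral) auto
    also have "(\<integral>\<^sup>+s. ennreal (if 0 < s then c (\<sigma> * s) else 0) \<partial>lborel) = (\<integral>\<^sup>+s. ennreal (c (\<sigma> * s)) * indicator {0<..} s \<partial>lborel)"
      by (intro nn_integral_cong) auto
    finally show ?thesis .
  qed
  have fin: "ennreal C * half_gauss\<^sup>2 < top"
    using half_gauss_finite by (auto simp: power2_eq_square ennreal_mult_less_top)
  have sm: "s \<noteq> 0 \<Longrightarrow> s \<le> \<bar>\<sigma> * s\<bar>" for s using \<sigma> by auto
  have "(\<integral>\<^sup>+s. ennreal (a (\<sigma> * s)) * indicator {0<..} s \<partial>lborel) * (\<integral>\<^sup>+s. ennreal (b (\<sigma> * s)) * indicator {0<..} s \<partial>lborel)
     \<le> ennreal C * half_gauss\<^sup>2"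
  proof (rule half_line_santalo[where K=K and R=K])
    show "a (\<sigma> * s) \<noteq> 0 \<Longrightarrow> s \<le> K" for s using a(3)[of "\<sigma> * s"] \<sigma> by auto
    show "b (\<sigma> * s) \<noteq> 0 \<Longrightarrow> s \<le> K" for s using b(3)[of "\<sigma> * s"] \<sigma> by auto
    show "a (\<sigma> * s) * b (\<sigma> * t) \<le> C * exp (- (s * t))" for s t using ab[of "\<sigma> * s" "\<sigma> * t"] \<sigma> by auto
  qed (use a b C in auto)
  from enn2real_mono[OF this fin] show ?thesis
    using C by (simp add: conv a b enn2real_mult enn2real_ennreal power2_eq_square)
qed

abbreviation gauss_sq :: real where "gauss_sq \<equiv> (enn2real half_gauss)\<^sup>2"

text \<open>
  The functional Santalo inequality with the constant \<open>B\<close>. The factor \<open>C\<close> allows the constant of the half-line to be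
  carried along when one coordinate is integrated out.
\<close>

definition santalo_bound :: "'i set \<Rightarrow> real \<Rightarrow> bool" where
  "santalo_bound I B \<longleftrightarrow> (\<forall>f g C. bounded_support I f \<longrightarrow> bounded_support I g \<longrightarrow>
     (\<forall>x\<in>space (PL I). 0 \<le> f x) \<longrightarrow> (\<forall>x\<in>space (PL I). 0 \<le> g x) \<longrightarrow> 0 \<le> C \<longrightarrow>
     (\<forall>x\<in>space (PL I). \<forall>y\<in>space (PL I). f x * g y \<le> C * exp (- (\<Sum>i\<in>I. x i * y i))) \<longrightarrow>
     (\<forall>i\<in>I. (\<integral>x. x i * f x \<partial>PL I) = 0) \<longrightarrow> integral\<^sup>L (PL I) f * integral\<^sup>L (PL I) g \<le> C * B)"

lemma santalo_boundD:
  assumes "santalo_bound I B" "bounded_support I f" "bounded_support I g"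
    "\<And>x. x \<in> space (PL I) \<Longrightarrow> 0 \<le> f x" "\<And>x. x \<in> space (PL I) \<Longrightarrow> 0 \<le> g x" "0 \<le> C"
    "\<And>x y. x \<in> space (PL I) \<Longrightarrow> y \<in> space (PL I) \<Longrightarrow> f x * g y \<le> C * exp (- (\<Sum>i\<in>I. x i * y i))"
    "\<And>i. i \<in> I \<Longrightarrow> (\<integral>x. x i * f x \<partial>PL I) = 0"
  shows "integral\<^sup>L (PL I) f * integral\<^sup>L (PL I) g \<le> C * B"
  using assms(1)[unfolded santalo_bound_def, rule_format, OF assms(2-8)] .

lemma santalo_boundI:
  assumes "\<And>f g C. bounded_support I f \<Longrightarrow> bounded_support I g \<Longrightarrow>
     (\<And>x. x \<in> space (PL I) \<Longrightarrow> 0 \<le> f x) \<Longrightarrow> (\<And>x. x \<in> space (PL I) \<Longrightarrow> 0 \<le> g x) \<Longrightarrow> 0 \<le> C \<Longrightarrow>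
     (\<And>x y. x \<in> space (PL I) \<Longrightarrow> y \<in> space (PL I) \<Longrightarrow> f x * g y \<le> C * exp (- (\<Sum>i\<in>I. x i * y i))) \<Longrightarrow>
     (\<And>i. i \<in> I \<Longrightarrow> (\<integral>x. x i * f x \<partial>PL I) = 0) \<Longrightarrow> integral\<^sup>L (PL I) f * integral\<^sup>L (PL I) g \<le> C * B"
  shows "santalo_bound I B"
  unfolding santalo_bound_def by (intro allI impI) (rule assms; simp)

text \<open>
  Integrating \<open>f\<close> and \<open>g\<close> along the \<open>k\<close>-axis over the same half-space gives two functions on the hyperplane which
  satisfy the induction hypothesis with \<open>C\<close> multiplied by the constant of the half-line; the condition on \<open>f\<close> puts the barycentre
  of the first one at \<open>0\<close>.
\<close>

lemma santalo_halfspace: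
  fixes f g :: "('i \<Rightarrow> real) \<Rightarrow> real"
  assumes I: "finite I" "k \<notin> I"
    and IH: "santalo_bound I B"
    and f: "bounded_support (insert k I) f" and g: "bounded_support (insert k I) g"
    and f0: "\<And>x. x \<in> space (PL (insert k I)) \<Longrightarrow> 0 \<le> f x" and g0: "\<And>x. x \<in> space (PL (insert k I)) \<Longrightarrow> 0 \<le> g x"
    and C: "0 \<le> C"
    and fg: "\<And>x y. x \<in> space (PL (insert k I)) \<Longrightarrow> y \<in> space (PL (insert k I)) \<Longrightarrow> f x * g y \<le> C * exp (- (\<Sum>i\<in>insert k I. x i * y i))"
    and \<sigma>: "\<sigma> = 1 \<or> \<sigma> = -1"
    and bary: "\<And>i. i \<in> I \<Longrightarrow> (\<integral>x. (if 0 < \<sigma> * x k then x i * f x else 0) \<partial>PL (insert k I)) = 0"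
  shows "(\<integral>x. (if 0 < \<sigma> * x k then f x else 0) \<partial>PL (insert k I)) * (\<integral>x. (if 0 < \<sigma> * x k then g x else 0) \<partial>PL (insert k I))
      \<le> C * gauss_sq * B"
proof -
  let ?M = "PL (insert k I)"
  define h where "h u = (\<lambda>x::'i \<Rightarrow> real. if 0 < \<sigma> * x k then u x else (0::real))" for u
  have hb: "bounded_support (insert k I) (h u)" if "bounded_support (insert k I) u" for u
  proof -
    have "h u = (\<lambda>x. (if 0 < \<sigma> * x k then 1 else 0) * u x)" by (auto simp: h_def)
    then show ?thesis using bounded_support_indicator[OF that, of "\<lambda>x. 0 < \<sigma> * x k"] by simp
  qed
  have fub: "integral\<^sup>L ?M u = (\<integral>x. \<integral>t. u (x(k := t)) \<partial>lborel \<partial>PL I)"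
    if "bounded_support (insert k I) u" for u
    using I that by (intro PiM_lborel.product_integral_insert bounded_support_integrable) auto
  have "(\<integral>x. \<integral>t. h f (x(k := t)) \<partial>lborel \<partial>PL I) * (\<integral>x. \<integral>t. h g (x(k := t)) \<partial>lborel \<partial>PL I) \<le> (C * gauss_sq) * B"
  proof (rule santalo_boundD[OF IH])
    show "bounded_support I (\<lambda>x. \<integral>t. h f (x(k := t)) \<partial>lborel)" "bounded_support I (\<lambda>x. \<integral>t. h g (x(k := t)) \<partial>lborel)"
      using I f g by (auto intro!: bounded_support_line hb)
    show "0 \<le> (\<integral>t. h f (x(k := t)) \<partial>lborel)" if "x \<in> space (PL I)" for x
      using f0[OF upd_space_PL[OF that]] by (auto simp: h_def)
    show "0 \<le> (\<integral>t. h g (x(k := t)) \<partial>lborel)" if "x \<in> space (PL I)" for x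
      using g0[OF upd_space_PL[OF that]] by (auto simp: h_def)
    show "0 \<le> C * gauss_sq" using C by simp
    show "(\<integral>t. h f (x(k := t)) \<partial>lborel) * (\<integral>t. h g (y(k := t)) \<partial>lborel) \<le> C * gauss_sq * exp (- (\<Sum>i\<in>I. x i * y i))"
      if x: "x \<in> space (PL I)" and y: "y \<in> space (PL I)" for x y
    proof -
      note ux = upd_space_PL[OF x, of k] and uy = upd_space_PL[OF y, of k]
      define R where "R = support_bound (insert k I) f"
      note R = support_bound[OF f, folded R_def]
      define S where "S = support_bound (insert k I) g"
      note S = support_bound[OF g, folded S_def]
      have "(\<integral>t. (if 0 < \<sigma> * t then f (x(k := t)) else 0) \<partial>lborel) * (\<integral>t. (if 0 < \<sigma> * t then g (y(k := t)) else 0) \<partial>lborel)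
         \<le> (C * exp (- (\<Sum>i\<in>I. x i * y i))) * gauss_sq"
      proof (rule half_line_santalo_real[where K="max R S"])
        show "(\<lambda>t. f (x(k := t))) \<in> borel_measurable borel" by (rule measurable_slice[OF bounded_support_measurable[OF f] x])
        show "(\<lambda>t. g (y(k := t))) \<in> borel_measurable borel" by (rule measurable_slice[OF bounded_support_measurable[OF g] y])
        show "f (x(k := s)) \<le> max R S" "g (y(k := s)) \<le> max R S" for s
          using R(2)[OF ux, of s] S(2)[OF uy, of s] by auto
        show "f (x(k := s)) \<noteq> 0 \<Longrightarrow> \<bar>s\<bar> \<le> max R S" for s using R(3)[OF ux, of s k] by auto
        show "g (y(k := s)) \<noteq> 0 \<Longrightarrow> \<bar>s\<bar> \<le> max R S" for s using S(3)[OF uy, of s k] by auto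
        fix s t
        have "(\<Sum>i\<in>insert k I. (x(k := s)) i * (y(k := t)) i) = s * t + (\<Sum>i\<in>I. x i * y i)"
        proof -
          have "(\<Sum>i\<in>I. (x(k := s)) i * (y(k := t)) i) = (\<Sum>i\<in>I. x i * y i)"
            using I(2) by (intro sum.cong) auto
          then show ?thesis using I by simp
        qed
        then show "f (x(k := s)) * g (y(k := t)) \<le> C * exp (- (\<Sum>i\<in>I. x i * y i)) * exp (- (s * t))"
          using fg[OF ux uy, of s t] by (simp add: mult_exp_exp algebra_simps)
      qed (use f0[OF ux] g0[OF uy] \<sigma> C in auto)
      then show ?thesis by (simp add: h_def mult_ac)
    qed
    show "(\<integral>x. x i * (\<integral>t. h f (x(k := t)) \<partial>lborel) \<partial>PL I) = 0" if i: "i \<in> I" for i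
    proof -
      have ik: "i \<noteq> k" using i I by auto
      have "(\<integral>x. x i * (\<integral>t. h f (x(k := t)) \<partial>lborel) \<partial>PL I) = (\<integral>x. (\<integral>t. h (\<lambda>x. x i * f x) (x(k := t)) \<partial>lborel) \<partial>PL I)"
        using ik by (auto intro!: Bochner_Integration.integral_cong simp: h_def simp flip: integral_mult_right_zero)
      also have "\<dots> = (\<integral>x. h (\<lambda>x. x i * f x) x \<partial>?M)"
        by (intro fub[symmetric] hb bounded_support_coord f) (use i in auto)
      also have "\<dots> = 0" using bary[OF i] by (simp add: h_def)
      finally show ?thesis .
    qed
  qed
  then show ?thesis using fub[OF hb[OF f]] fub[OF hb[OF g]] by (simp add: h_def)
qed

text \<open>
  \<open>shear\<close> moves the origin to \<open>z\<close> and the \<open>k\<close>-axis to the direction \<open>e\<close>, whose \<open>k\<close>-th component is taken to be \<open>1\<close>;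
  \<open>dual_shear\<close> is the inverse transpose of its linear part, so both preserve volume.
\<close>

definition shear :: "'i set \<Rightarrow> 'i \<Rightarrow> ('i \<Rightarrow> real) \<Rightarrow> ('i \<Rightarrow> real) \<Rightarrow> ('i \<Rightarrow> real) \<Rightarrow> 'i \<Rightarrow> real" where
  "shear I k z e x = (\<lambda>i\<in>insert k I. if i = k then z k + x k else z i + x i + x k * e i)"

definition dual_shear :: "'i set \<Rightarrow> 'i \<Rightarrow> ('i \<Rightarrow> real) \<Rightarrow> ('i \<Rightarrow> real) \<Rightarrow> 'i \<Rightarrow> real" where
  "dual_shear I k e x = (\<lambda>i\<in>insert k I. if i = k then x k - (\<Sum>j\<in>I. e j * x j) else x i)"

lemma shear_pairing:
  assumes I: "finite I" "k \<notin> I"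
  shows "(\<Sum>i\<in>insert k I. shear I k z e x i * dual_shear I k e y i)
    = (\<Sum>i\<in>insert k I. z i * dual_shear I k e y i) + (\<Sum>i\<in>insert k I. x i * y i)"
proof -
  have "(\<Sum>i\<in>I. shear I k z e x i * dual_shear I k e y i) = (\<Sum>i\<in>I. z i * y i + (x i * y i + x k * (e i * y i)))"
    using I by (intro sum.cong) (auto simp: shear_def dual_shear_def algebra_simps)
  moreover have "(\<Sum>i\<in>I. z i * dual_shear I k e y i) = (\<Sum>i\<in>I. z i * y i)"
    using I by (intro sum.cong) (auto simp: dual_shear_def)
  ultimately show ?thesis using I
    by (simp add: sum.distrib sum_distrib_left[symmetric]) (simp add: shear_def dual_shear_def algebra_simps)
qed

lemma shear_apply:
  assumes "i \<in> I" "k \<notin> I"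
  shows "shear I k z e x i = z i + x i + x k * e i"
proof -
  have "i \<noteq> k" using assms by blast
  then show ?thesis using assms(1) by (simp add: shear_def)
qed

lemma measurable_shear[measurable]: "shear I k z e \<in> measurable (PL (insert k I)) (PL (insert k I))"
proof -
  have "(\<lambda>x. \<lambda>i\<in>insert k I. if i = k then z k + x k else z i + x i + x k * e i) \<in> measurable (PL (insert k I)) (PL (insert k I))"
    by (intro measurable_restrict) (simp, measurable)
  then show ?thesis by (simp add: shear_def[abs_def])
qed

lemma measurable_dual_shear[measurable]: 
  assumes I: "finite I"
  shows "dual_shear I k e \<in> measurable (PL (insert k I)) (PL (insert k I))"
proof -
  have "(\<lambda>x. \<lambda>i\<in>insert k I. if i = k then x k - (\<Sum>j\<in>I. e j * x j) else x i) \<in> measurable (PL (insert k I)) (PL (insert k I))"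
    by (intro measurable_restrict) (simp, measurable)
  then show ?thesis by (simp add: dual_shear_def[abs_def])
qed

lemma bounded_support_shear:
  assumes I: "finite I" "k \<notin> I" and f: "bounded_support (insert k I) f"
  shows "bounded_support (insert k I) (\<lambda>x. f (shear I k z e x))"
proof -
  let ?M = "PL (insert k I)"
  define R where "R = support_bound (insert k I) f"
  note R = support_bound[OF f, folded R_def]
  define A where "A = (\<Sum>i\<in>insert k I. \<bar>z i\<bar>)"
  define E where "E = (\<Sum>i\<in>I. \<bar>e i\<bar>)"
  have A: "\<bar>z i\<bar> \<le> A" if "i \<in> insert k I" for i
    unfolding A_def using I that by (intro member_le_sum) auto
  have E: "\<bar>e i\<bar> \<le> E" if "i \<in> I" for i
    unfolding E_def using I that by (intro member_le_sum) auto
  have E0: "0 \<le> E" by (auto simp: E_def intro: sum_nonneg)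
  have A0: "0 \<le> A" by (auto simp: A_def intro: sum_nonneg)
  show ?thesis
  proof (rule bounded_supportI)
    show "(\<lambda>x. f (shear I k z e x)) \<in> borel_measurable ?M"
      by (rule measurable_compose[OF measurable_shear bounded_support_measurable[OF f]])
    fix x assume x: "x \<in> space ?M"
    have sx: "shear I k z e x \<in> space ?M" by (rule measurable_space[OF measurable_shear x])
    show "\<bar>f (shear I k z e x)\<bar> \<le> R" by (rule R(2)[OF sx])
    fix i assume nz: "f (shear I k z e x) \<noteq> 0" and i: "i \<in> insert k I"
    have k: "\<bar>x k\<bar> \<le> R + A" using R(3)[OF sx nz, of k] A[of k] by (simp add: shear_def)
    show "\<bar>x i\<bar> \<le> (R + A) + (R + A) * E"
    proof (cases "i = k")
      case True
      have "0 \<le> (R + A) * E" using R A0 E0 by simp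
      then show ?thesis using k True by simp
    next
      case False
      then have iI: "i \<in> I" using i by auto
      have "\<bar>x k * e i\<bar> \<le> (R + A) * E" unfolding abs_mult using k E[OF iI] by (intro mult_mono) auto
      then show ?thesis using R(3)[OF sx nz i] A[OF i] False iI by (simp add: shear_def)
    qed
  qed
qed

lemma bounded_support_dual_shear:
  assumes I: "finite I" "k \<notin> I" and f: "bounded_support (insert k I) f"
  shows "bounded_support (insert k I) (\<lambda>x. f (dual_shear I k e x))"
proof -
  let ?M = "PL (insert k I)"
  define R where "R = support_bound (insert k I) f"
  note R = support_bound[OF f, folded R_def]
  show ?thesis
  proof (rule bounded_supportI)
    show "(\<lambda>x. f (dual_shear I k e x)) \<in> borel_measurable ?M"
      by (rule measurable_compose[OF measurable_dual_shear[OF I(1)] bounded_support_measurable[OF f]])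
    fix x assume x: "x \<in> space ?M"
    have sx: "dual_shear I k e x \<in> space ?M" by (rule measurable_space[OF measurable_dual_shear[OF I(1)] x])
    show "\<bar>f (dual_shear I k e x)\<bar> \<le> R" by (rule R(2)[OF sx])
    fix i assume nz: "f (dual_shear I k e x) \<noteq> 0" and i: "i \<in> insert k I"
    have xi: "\<bar>x j\<bar> \<le> R" if "j \<in> I" for j using R(3)[OF sx nz, of j] that I by (auto simp: dual_shear_def split: if_splits)
    have "\<bar>\<Sum>j\<in>I. e j * x j\<bar> \<le> (\<Sum>j\<in>I. \<bar>e j\<bar> * R)"
      by (rule order_trans[OF sum_abs]) (auto intro!: sum_mono mult_left_mono xi simp: abs_mult)
    moreover have "\<bar>x k - (\<Sum>j\<in>I. e j * x j)\<bar> \<le> R" using R(3)[OF sx nz, of k] by (simp add: dual_shear_def)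
    ultimately have "\<bar>x k\<bar> \<le> R + (\<Sum>j\<in>I. \<bar>e j\<bar> * R)" by linarith
    moreover have "0 \<le> (\<Sum>j\<in>I. \<bar>e j\<bar> * R)" using R by (auto intro: sum_nonneg)
    ultimately show "\<bar>x i\<bar> \<le> R + (\<Sum>j\<in>I. \<bar>e j\<bar> * R)" using xi i by fastforce
  qed
qed

lemma integral_shear:
  fixes f :: "('i \<Rightarrow> real) \<Rightarrow> real"
  assumes I: "finite I" "k \<notin> I" and f: "bounded_support (insert k I) f"
  shows "(\<integral>x. f (shear I k z e x) \<partial>PL (insert k I)) = integral\<^sup>L (PL (insert k I)) f"
proof -
  let ?M = "PL (insert k I)"
  have fin: "finite (insert k I)" using I by simp
  have "(\<integral>x. f (shear I k z e x) \<partial>?M) = (\<integral>t. \<integral>x. f (shear I k z e (x(k := t))) \<partial>PL I \<partial>lborel)"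
    by (intro integral_insert_rev I bounded_support_integrable fin bounded_support_shear f)
  also have "\<dots> = (\<integral>t. \<integral>x. f (x(k := z k + t)) \<partial>PL I \<partial>lborel)"
  proof (rule Bochner_Integration.integral_cong[OF refl])
    fix t
    have "(\<integral>x. f (shear I k z e (x(k := t))) \<partial>PL I) = (\<integral>x. f ((\<lambda>i\<in>I. x i + (z i + t * e i))(k := z k + t)) \<partial>PL I)"
      using I by (intro Bochner_Integration.integral_cong refl arg_cong[where f=f]) (auto simp: shear_def fun_eq_iff)
    also have "\<dots> = (\<integral>x. f (x(k := z k + t)) \<partial>PL I)"
      using bounded_support_measurable[OF f] I
      by (intro integral_PL_translate[of I "\<lambda>x. f (x(k := z k + t))" "\<lambda>i. z i + t * e i"] measurable_compose[OF _ bounded_support_measurable[OF f]] measurable_fun_upd[of _ I]) auto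
    finally show "(\<integral>x. f (shear I k z e (x(k := t))) \<partial>PL I) = (\<integral>x. f (x(k := z k + t)) \<partial>PL I)" .
  qed
  also have "\<dots> = (\<integral>t. \<integral>x. f (x(k := t)) \<partial>PL I \<partial>lborel)"
    using lborel_integral_real_affine[of 1 "\<lambda>t. \<integral>x. f (x(k := t)) \<partial>PL I" "z k"] by simp
  also have "\<dots> = integral\<^sup>L ?M f"
    by (intro integral_insert_rev[symmetric] I bounded_support_integrable fin f)
  finally show ?thesis .
qed

lemma integral_dual_shear:
  fixes f :: "('i \<Rightarrow> real) \<Rightarrow> real"
  assumes I: "finite I" "k \<notin> I" and f: "bounded_support (insert k I) f"
  shows "(\<integral>x. f (dual_shear I k e x) \<partial>PL (insert k I)) = integral\<^sup>L (PL (insert k I)) f"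
proof -
  let ?M = "PL (insert k I)"
  have fin: "finite (insert k I)" using I by simp
  have "(\<integral>x. f (dual_shear I k e x) \<partial>?M) = (\<integral>x. \<integral>t. f (dual_shear I k e (x(k := t))) \<partial>lborel \<partial>PL I)"
    by (intro PiM_lborel.product_integral_insert I bounded_support_integrable fin bounded_support_dual_shear f)
  also have "\<dots> = (\<integral>x. \<integral>t. f (x(k := t)) \<partial>lborel \<partial>PL I)"
  proof (rule Bochner_Integration.integral_cong[OF refl])
    fix x assume x: "x \<in> space (PL I)"
    define s where "s = (\<Sum>j\<in>I. e j * x j)"
    have s: "(\<Sum>j\<in>I. e j * (x(k := t)) j) = s" for t
      unfolding s_def using I by (intro sum.cong) auto
    have "dual_shear I k e (x(k := t)) = x(k := - s + 1 * t)" for t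
      using x I unfolding dual_shear_def s by (auto simp: fun_eq_iff space_PL extensional_def)
    then have "(\<integral>t. f (dual_shear I k e (x(k := t))) \<partial>lborel) = (\<integral>t. f (x(k := - s + 1 * t)) \<partial>lborel)"
      by simp
    also have "\<dots> = (\<integral>t. f (x(k := t)) \<partial>lborel)"
      using lborel_integral_real_affine[of 1 "\<lambda>t. f (x(k := t))" "- s"] by simp
    finally show "(\<integral>t. f (dual_shear I k e (x(k := t))) \<partial>lborel) = (\<integral>t. f (x(k := t)) \<partial>lborel)" .
  qed
  also have "\<dots> = integral\<^sup>L ?M f"
    by (intro PiM_lborel.product_integral_insert[symmetric] I bounded_support_integrable fin f)
  finally show ?thesis .
qed

lemma bounded_support_half:
  assumes "bounded_support I f" "k \<in> I"
  shows "bounded_support I (\<lambda>x. if 0 < \<sigma> * (x k - c) then f x else 0)"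
  using bounded_support_indicator[OF assms(1), of "\<lambda>x. 0 < \<sigma> * (x k - c)"] assms(2)
  by (simp add: if_distrib[where f="\<lambda>a. a * _"] cong: if_cong)

lemma integral_halves:
  assumes I: "finite I" "k \<notin> I" and f: "bounded_support (insert k I) f"
  shows "(\<integral>x. (if 0 < 1 * (x k - c) then f x else 0) \<partial>PL (insert k I)) + (\<integral>x. (if 0 < -1 * (x k - c) then f x else 0) \<partial>PL (insert k I))
    = integral\<^sup>L (PL (insert k I)) f"
proof -
  let ?M = "PL (insert k I)"
  have fin: "finite (insert k I)" using I by simp
  note int = bounded_support_integrable[OF fin bounded_support_half[OF f insertI1]]
  note ins = PiM_lborel.product_integral_insert[OF I]
  let ?h = "\<lambda>x. (if 0 < 1 * (x k - c) then f x else 0) + (if 0 < -1 * (x k - c) then f x else 0)"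
  have "integral\<^sup>L ?M ?h = (\<integral>x. \<integral>t. ?h (x(k := t)) \<partial>lborel \<partial>PL I)"
    by (intro ins Bochner_Integration.integrable_add int)
  also have "\<dots> = (\<integral>x. \<integral>t. f (x(k := t)) \<partial>lborel \<partial>PL I)"
  proof (rule Bochner_Integration.integral_cong[OF refl])
    fix x assume "x \<in> space (PL I)"
    then have [measurable]: "(\<lambda>t. f (x(k := t))) \<in> borel_measurable borel"
      by (rule measurable_slice[OF bounded_support_measurable[OF f]])
    show "(\<integral>t. ?h (x(k := t)) \<partial>lborel) = (\<integral>t. f (x(k := t)) \<partial>lborel)"
    proof (rule integral_cong_AE)
      show "AE t in lborel. ?h (x(k := t)) = f (x(k := t))"
        using AE_lborel_singleton[of c] by eventually_elim auto
    qed simp_all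
  qed
  also have "\<dots> = integral\<^sup>L ?M f"
    by (intro ins[symmetric] bounded_support_integrable fin f)
  finally show ?thesis using Bochner_Integration.integral_add[OF int int, of 1 c "-1" c] by simp
qed

text \<open>
  The mass beyond the hyperplane \<open>x k = c\<close> depends continuously on \<open>c\<close> because hyperplanes are null sets.
\<close>

lemma median_hyperplane:
  fixes g :: "('i \<Rightarrow> real) \<Rightarrow> real"
  assumes I: "finite I" "k \<notin> I" and g: "bounded_support (insert k I) g"
    and g0: "\<And>x. x \<in> space (PL (insert k I)) \<Longrightarrow> 0 \<le> g x"
  obtains c where "(\<integral>x. (if 0 < 1 * (x k - c) then g x else 0) \<partial>PL (insert k I)) = integral\<^sup>L (PL (insert k I)) g / 2"
    "(\<integral>x. (if 0 < -1 * (x k - c) then g x else 0) \<partial>PL (insert k I)) = integral\<^sup>L (PL (insert k I)) g / 2"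
proof -
  let ?M = "PL (insert k I)"
  have fin: "finite (insert k I)" using I by simp
  define R where "R = support_bound (insert k I) g"
  note R = support_bound[OF g, folded R_def]
  define m where "m = integral\<^sup>L ?M g"
  define \<gamma> where "\<gamma> = (\<lambda>t. \<integral>x. g (x(k := t)) \<partial>PL I)"
  have gi: "integrable ?M g" by (rule bounded_support_integrable[OF fin g])
  interpret SI: sigma_finite_measure "PL I" by (rule PiM_lborel.sigma_finite) fact
  interpret P: pair_sigma_finite "PL I" "lborel :: real measure" by standard
  have \<gamma>i: "integrable lborel \<gamma>"
    using P.integrable_snd[OF integrable_insert_pair[OF I gi]] by (simp add: \<gamma>_def)
  have half: "(\<integral>x. (if c < x k then g x else 0) \<partial>?M) = (\<integral>t. (if c < t then \<gamma> t else 0) \<partial>lborel)" for c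
  proof -
    have "bounded_support (insert k I) (\<lambda>x. if c < x k then g x else 0)"
      using bounded_support_half[OF g insertI1, of 1 c] by simp
    then have "(\<integral>x. (if c < x k then g x else 0) \<partial>?M) = (\<integral>t. \<integral>x. (if c < (x(k := t)) k then g (x(k := t)) else 0) \<partial>PL I \<partial>lborel)"
      by (intro integral_insert_rev I bounded_support_integrable fin)
    also have "\<dots> = (\<integral>t. (if c < t then \<gamma> t else 0) \<partial>lborel)"
      by (intro Bochner_Integration.integral_cong) (auto simp: \<gamma>_def)
    finally show ?thesis .
  qed
  have tot: "(\<integral>t. \<gamma> t \<partial>lborel) = m"
    unfolding m_def \<gamma>_def by (rule integral_insert_rev[OF I gi, symmetric])
  define \<phi> where "\<phi> = (\<lambda>c. \<integral>t. (if c < t then \<gamma> t else 0) \<partial>lborel)"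
  have cont: "continuous_on UNIV \<phi>"
    unfolding continuous_on_sequentially
  proof (intro allI ballI impI, unfold o_def)
    fix X :: "nat \<Rightarrow> real" and a assume X: "(\<forall>n. X n \<in> UNIV) \<and> X \<longlonglongrightarrow> a"
    show "(\<lambda>n. \<phi> (X n)) \<longlonglongrightarrow> \<phi> a"
      unfolding \<phi>_def
    proof (rule integral_dominated_convergence[where w="\<lambda>t. \<bar>\<gamma> t\<bar>"])
      have "AE t in lborel. t \<noteq> a" by (rule AE_lborel_singleton)
      then show "AE t in lborel. (\<lambda>n. if X n < t then \<gamma> t else 0) \<longlonglongrightarrow> (if a < t then \<gamma> t else 0)"
      proof (rule AE_mp, intro AE_I2 impI)
        fix t assume "t \<noteq> a"
        then consider "a < t" | "t < a" by linarith
        then show "(\<lambda>n. if X n < t then \<gamma> t else 0) \<longlonglongrightarrow> (if a < t then \<gamma> t else 0)"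
        proof cases
          case 1
          then have "eventually (\<lambda>n. X n < t) sequentially" using X by (intro order_tendstoD) auto
          then have "eventually (\<lambda>n. \<gamma> t = (if X n < t then \<gamma> t else 0)) sequentially" by eventually_elim auto
          then show ?thesis using 1 by (simp add: tendsto_eventually eq_commute)
        next
          case 2
          then have "eventually (\<lambda>n. t < X n) sequentially" using X by (intro order_tendstoD) auto
          then have "eventually (\<lambda>n. (if X n < t then \<gamma> t else 0) = 0) sequentially" by eventually_elim auto
          then show ?thesis using 2 by (simp add: tendsto_eventually)
        qed
      qed
    qed (use \<gamma>i in \<open>auto\<close>)
  qed
  have \<gamma>0: "\<gamma> t = 0" if "\<bar>t\<bar> > R" for t
  proof -
    have "\<gamma> t = (\<integral>x. 0 \<partial>PL I)" unfolding \<gamma>_def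
      using R(3)[OF upd_space_PL[of _ I k t], of _ k] that by (intro Bochner_Integration.integral_cong) (auto simp: not_le)
    then show ?thesis by simp
  qed
  have lo: "\<phi> (- R - 1) = m"
    unfolding \<phi>_def tot[symmetric] using R(1) by (intro Bochner_Integration.integral_cong) (auto intro!: \<gamma>0)
  have "\<phi> (R + 1) = (\<integral>t. 0 \<partial>(lborel::real measure))"
    unfolding \<phi>_def using R(1) by (intro Bochner_Integration.integral_cong) (auto intro!: \<gamma>0)
  then have hi: "\<phi> (R + 1) = 0" by simp
  have m0: "0 \<le> m" unfolding m_def using g0 by (auto intro!: integral_nonneg_AE)
  have "\<exists>c. - R - 1 \<le> c \<and> c \<le> R + 1 \<and> \<phi> c = m / 2"
    using lo hi m0 R(1) continuous_on_subset[OF cont] by (intro IVT2') auto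
  then obtain c where c: "\<phi> c = m / 2" by auto
  have "(\<integral>x. (if 0 < 1 * (x k - c) then g x else 0) \<partial>?M) = m / 2"
    using half[of c] c by (simp add: \<phi>_def)
  then show ?thesis
    using that[of c] integral_halves[OF I g, of c] by (simp add: m_def)
qed

text \<open>
  The translation of \<open>g\<close> by \<open>z\<close> is paid for by a factor \<open>exp (z \<bullet> x)\<close> on \<open>f\<close>. Such a factor can only increase the integral
  of \<open>f\<close>, since \<open>exp t \<ge> 1 + t\<close> and the barycentre of \<open>f\<close> is \<open>0\<close>. The hyperplane halves the mass of \<open>g\<close> rather
  than of \<open>f\<close>, so that the halves of \<open>g\<close> take the centred role in the induction hypothesis.
\<close>

lemma santalo_PL_step:
  fixes I :: "'i set"
  assumes I: "finite I" "k \<notin> I" and IH: "santalo_bound I B"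
  shows "santalo_bound (insert k I) (4 * gauss_sq * B)"
proof (rule santalo_boundI)
  let ?J = "insert k I"
  let ?M = "PL ?J"
  fix f g :: "('i \<Rightarrow> real) \<Rightarrow> real" and C
  assume f: "bounded_support ?J f" and g: "bounded_support ?J g"
    and f0: "\<And>x. x \<in> space ?M \<Longrightarrow> 0 \<le> f x" and g0: "\<And>x. x \<in> space ?M \<Longrightarrow> 0 \<le> g x" and C: "0 \<le> C"
    and fg: "\<And>x y. x \<in> space ?M \<Longrightarrow> y \<in> space ?M \<Longrightarrow> f x * g y \<le> C * exp (- (\<Sum>i\<in>?J. x i * y i))"
    and bary: "\<And>i. i \<in> ?J \<Longrightarrow> (\<integral>x. x i * f x \<partial>?M) = 0"
  show "integral\<^sup>L ?M f * integral\<^sup>L ?M g \<le> C * (4 * gauss_sq * B)"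
  proof (cases "integral\<^sup>L ?M g = 0")
    case True
    have "bounded_support I (\<lambda>_. 0)" by (rule bounded_supportI[where K=0 and R=0]) auto
    then have "0 \<le> B" using santalo_boundD[OF IH, of "\<lambda>_. 0" "\<lambda>_. 0" 1] by simp
    then show ?thesis using True C by simp
  next
    case False
    define \<kappa> where "\<kappa> = gauss_sq"
    define m where "m = integral\<^sup>L ?M g"
    have fin: "finite ?J" and kJ: "k \<in> ?J" using I by simp_all
    have m: "m > 0" using False g0 unfolding m_def by (simp add: less_le integral_nonneg_AE)
    note int = bounded_support_integrable[OF fin]
    note halfb = bounded_support_half[OF _ kJ]
    note coord = bounded_support_coord[OF g]
    obtain c where "(\<integral>x. (if 0 < 1 * (x k - c) then g x else 0) \<partial>?M) = m / 2"
      and "(\<integral>x. (if 0 < -1 * (x k - c) then g x else 0) \<partial>?M) = m / 2"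
      using median_hyperplane[OF I g g0] unfolding m_def by blast
    then have c: "(\<integral>x. (if 0 < \<sigma> * (x k - c) then g x else 0) \<partial>?M) = m / 2" if "\<sigma> = 1 \<or> \<sigma> = -1" for \<sigma>
      using that by blast
    define b where "b \<sigma> i = (\<integral>x. (if 0 < \<sigma> * (x k - c) then x i * g x else 0) \<partial>?M) / (m / 2)" for \<sigma> i
    have b: "(\<integral>x. (if 0 < \<sigma> * (x k - c) then x i * g x else 0) \<partial>?M) = m / 2 * b \<sigma> i" for \<sigma> i
      using m by (simp add: b_def)
    have side: "0 < \<sigma> * (b \<sigma> k - c)" if \<sigma>: "\<sigma> = 1 \<or> \<sigma> = -1" for \<sigma>
    proof -
      let ?q = "\<lambda>x. if 0 < \<sigma> * (x k - c) then g x else 0"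
      let ?h = "\<lambda>x. \<sigma> * (x k - c) * ?q x"
      have e: "?h = (\<lambda>x. \<sigma> * (if 0 < \<sigma> * (x k - c) then x k * g x else 0) - \<sigma> * c * ?q x)" by (auto simp: algebra_simps)
      have i: "integrable ?M (\<lambda>x. \<sigma> * (if 0 < \<sigma> * (x k - c) then x k * g x else 0))" "integrable ?M (\<lambda>x. \<sigma> * c * ?q x)"
        by (intro integrable_mult_right int halfb coord g kJ)+
      have hi: "integrable ?M ?h" unfolding e by (intro Bochner_Integration.integrable_diff i)
      have h0: "0 \<le> ?h x" if "x \<in> space ?M" for x using g0[OF that] by auto
      have "integral\<^sup>L ?M ?h = m / 2 * (\<sigma> * (b \<sigma> k - c))"
        unfolding e Bochner_Integration.integral_diff[OF i] integral_mult_right_zero b c[OF \<sigma>] by (simp add: algebra_simps)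
      moreover have "integral\<^sup>L ?M ?h \<noteq> 0"
      proof
        assume "integral\<^sup>L ?M ?h = 0"
        then have "AE x in ?M. ?h x = 0"
          using integral_nonneg_eq_0_iff_AE[OF hi] h0 by auto
        then have "AE x in ?M. ?q x = 0"
          by (rule eventually_mono) (auto split: if_splits)
        then have "integral\<^sup>L ?M ?q = 0" by (rule integral_eq_zero_AE)
        then show False using c[OF \<sigma>] m by simp
      qed
      moreover have "0 \<le> integral\<^sup>L ?M ?h" using h0 by (auto intro: integral_nonneg_AE)
      ultimately have "0 < m / 2 * (\<sigma> * (b \<sigma> k - c))" by linarith
      then show ?thesis using m by (simp add: zero_less_mult_iff)
    qed
    have bk: "b (-1) k < c" "c < b 1 k" using side[of 1] side[of "-1"] by simp_all
    \<comment> \<open>\<open>z\<close> is the point where the segment joining the barycentres \<open>b (-1)\<close>, \<open>b 1\<close> of the two halves of \<open>g\<close> crosses the hyperplane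
    \<open>x k = c\<close>, and \<open>e\<close> is the direction of that segment scaled to \<open>e k = 1\<close>.\<close>
    define e where "e i = (b 1 i - b (-1) i) / (b 1 k - b (-1) k)" for i
    define z where "z i = b (-1) i + (c - b (-1) k) * e i" for i
    have zk: "z k = c" using bk by (auto simp: e_def z_def)
    have be: "b \<sigma> i - z i - (b \<sigma> k - c) * e i = 0" if "\<sigma> = 1 \<or> \<sigma> = -1" for \<sigma> i
    proof -
      have "b 1 i - b (-1) i = (b 1 k - b (-1) k) * e i" using bk by (simp add: e_def)
      then show ?thesis using that by (auto simp: z_def algebra_simps)
    qed
    define T where "T = shear I k z e"
    define S where "S = dual_shear I k e"
    have Tk: "T x k = c + x k" for x by (simp add: T_def shear_def zk)
    have Ti: "T x i = z i + x i + x k * e i" if "i \<in> I" for x i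
      unfolding T_def by (rule shear_apply[OF that I(2)])
    \<comment> \<open>The factor \<open>exp (z \<bullet> x)\<close> cancels the first sum in \<open>shear_pairing\<close>.\<close>
    define ft where "ft = (\<lambda>x. exp (\<Sum>i\<in>?J. z i * x i) * f x)"
    define f' where "f' = (\<lambda>x. ft (S x))"
    define g' where "g' = (\<lambda>x. g (T x))"
    have ftb: "bounded_support ?J ft"
      unfolding ft_def
    proof (rule bounded_support_mult[OF f])
      fix R :: real
      show "\<exists>K. \<forall>x\<in>space ?M. (\<forall>i\<in>?J. \<bar>x i\<bar> \<le> R) \<longrightarrow> \<bar>exp (\<Sum>i\<in>?J. z i * x i)\<bar> \<le> K"
      proof (intro exI[of _ "exp (\<Sum>i\<in>?J. \<bar>z i\<bar> * R)"] ballI impI)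
        fix x assume b: "\<forall>i\<in>?J. \<bar>x i\<bar> \<le> R"
        have "z i * x i \<le> \<bar>z i\<bar> * R" if "i \<in> ?J" for i
          using abs_ge_self[of "z i * x i"] mult_left_mono[OF bspec[OF b that] abs_ge_zero[of "z i"]]
          unfolding abs_mult by linarith
        then have "(\<Sum>i\<in>?J. z i * x i) \<le> (\<Sum>i\<in>?J. \<bar>z i\<bar> * R)"
          by (rule sum_mono)
        then show "\<bar>exp (\<Sum>i\<in>?J. z i * x i)\<bar> \<le> exp (\<Sum>i\<in>?J. \<bar>z i\<bar> * R)" by simp
      qed
    qed measurable
    have f'b: "bounded_support ?J f'" unfolding f'_def S_def by (rule bounded_support_dual_shear[OF I ftb])
    have g'b: "bounded_support ?J g'" unfolding g'_def T_def by (rule bounded_support_shear[OF I g])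
    have Tsp: "T x \<in> space ?M" if "x \<in> space ?M" for x unfolding T_def by (rule measurable_space[OF measurable_shear that])
    have Ssp: "S x \<in> space ?M" if "x \<in> space ?M" for x unfolding S_def by (rule measurable_space[OF measurable_dual_shear[OF I(1)] that])
    have f'0: "0 \<le> f' x" if "x \<in> space ?M" for x using f0[OF Ssp[OF that]] by (simp add: f'_def ft_def)
    have g'0: "0 \<le> g' x" if "x \<in> space ?M" for x using g0[OF Tsp[OF that]] by (simp add: g'_def)
    have gf': "g' x * f' y \<le> C * exp (- (\<Sum>i\<in>?J. x i * y i))" if "x \<in> space ?M" "y \<in> space ?M" for x y
    proof -
      have "g' x * f' y = (f (S y) * g (T x)) * exp (\<Sum>i\<in>?J. z i * S y i)" by (simp add: g'_def f'_def ft_def)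
      also have "\<dots> \<le> (C * exp (- (\<Sum>i\<in>?J. S y i * T x i))) * exp (\<Sum>i\<in>?J. z i * S y i)"
        by (intro mult_right_mono fg Ssp Tsp that) auto
      also have "(\<Sum>i\<in>?J. S y i * T x i) = (\<Sum>i\<in>?J. z i * S y i) + (\<Sum>i\<in>?J. x i * y i)"
        unfolding T_def S_def shear_pairing[OF I, symmetric] by (simp add: mult.commute)
      finally show ?thesis by (simp add: mult.assoc mult_exp_exp)
    qed
    have T_int: "(\<integral>x. u (T x) \<partial>?M) = integral\<^sup>L ?M u" if "bounded_support ?J u" for u
      unfolding T_def by (rule integral_shear[OF I that])
    have mass: "(\<integral>x. (if 0 < \<sigma> * x k then g' x else 0) \<partial>?M) = m / 2" if "\<sigma> = 1 \<or> \<sigma> = -1" for \<sigma>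
      using T_int[OF halfb[OF g, of \<sigma> c]] c[OF that] by (simp add: g'_def Tk cong: if_cong)
    have moment: "(\<integral>x. (if 0 < \<sigma> * x k then x i * g' x else 0) \<partial>?M) = 0" if \<sigma>: "\<sigma> = 1 \<or> \<sigma> = -1" and i: "i \<in> I" for \<sigma> i
    proof -
      let ?Q = "\<lambda>x. 0 < \<sigma> * (x k - c)"
      let ?u = "\<lambda>x. (if ?Q x then x i * g x else 0) - (z i - c * e i) * (if ?Q x then g x else 0) - e i * (if ?Q x then x k * g x else 0)"
      let ?p = "\<lambda>x. x i - z i - (x k - c) * e i"
      let ?v = "\<lambda>x. if ?Q x then ?p x * g x else 0"
      have iJ: "i \<in> ?J" using i by simp
      have uv: "?u = ?v" by (auto simp: algebra_simps)
      have pm: "?p \<in> borel_measurable ?M" using iJ by measurable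
      have "bounded_support ?J (\<lambda>x. ?p x * g x)"
      proof (rule bounded_support_mult[OF g pm])
        fix R :: real
        show "\<exists>K. \<forall>x\<in>space ?M. (\<forall>i\<in>?J. \<bar>x i\<bar> \<le> R) \<longrightarrow> \<bar>?p x\<bar> \<le> K"
        proof (intro exI[of _ "R + \<bar>z i\<bar> + (R + \<bar>c\<bar>) * \<bar>e i\<bar>"] ballI impI)
          fix x assume b: "\<forall>i\<in>?J. \<bar>x i\<bar> \<le> R"
          have "\<bar>(x k - c) * e i\<bar> \<le> (R + \<bar>c\<bar>) * \<bar>e i\<bar>"
            unfolding abs_mult using b by (intro mult_right_mono) fastforce+
          moreover have "\<bar>x i\<bar> \<le> R" using b iJ by auto
          ultimately show "\<bar>?p x\<bar> \<le> R + \<bar>z i\<bar> + (R + \<bar>c\<bar>) * \<bar>e i\<bar>" by linarith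
        qed
      qed
      from T_int[OF halfb[OF this]] have "(\<integral>x. ?v (T x) \<partial>?M) = (\<integral>x. ?v x \<partial>?M)" .
      moreover have "?v (T x) = (if 0 < \<sigma> * x k then x i * g' x else 0)" for x
        using i by (simp add: Tk Ti g'_def cong: if_cong)
      moreover have "(\<integral>x. ?u x \<partial>?M) = m / 2 * b \<sigma> i - (z i - c * e i) * (m / 2) - e i * (m / 2 * b \<sigma> k)"
        using int[OF halfb[OF coord[OF iJ]], of \<sigma> c] int[OF halfb[OF g], of \<sigma> c] int[OF halfb[OF coord[OF kJ]], of \<sigma> c]
        by (simp add: b c[OF \<sigma>])
      moreover have "\<dots> = m / 2 * (b \<sigma> i - z i - (b \<sigma> k - c) * e i)" by (simp add: algebra_simps)
      ultimately show ?thesis unfolding uv be[OF \<sigma>] by simp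
    qed
    have half: "m / 2 * (\<integral>x. (if 0 < \<sigma> * (x k - 0) then f' x else 0) \<partial>?M) \<le> C * \<kappa> * B" if \<sigma>: "\<sigma> = 1 \<or> \<sigma> = -1" for \<sigma>
    proof -
      have "(\<integral>x. (if 0 < \<sigma> * x k then g' x else 0) \<partial>?M) * (\<integral>x. (if 0 < \<sigma> * x k then f' x else 0) \<partial>?M) \<le> C * gauss_sq * B"
        by (rule santalo_halfspace[OF I IH g'b f'b g'0 f'0 C gf' \<sigma> moment[OF \<sigma>]])
      then show ?thesis unfolding mass[OF \<sigma>] \<kappa>_def by simp
    qed
    have "integral\<^sup>L ?M f' * m \<le> 4 * (C * \<kappa> * B)"
      using half[of 1] half[of "-1"] unfolding integral_halves[OF I f'b, of 0, symmetric] by (simp add: algebra_simps)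
    moreover have "integral\<^sup>L ?M f' = integral\<^sup>L ?M ft"
      unfolding f'_def S_def by (rule integral_dual_shear[OF I ftb])
    moreover have "integral\<^sup>L ?M f \<le> integral\<^sup>L ?M ft"
    proof -
      have ii: "integrable ?M (\<lambda>x. z i * (x i * f x))" if "i \<in> ?J" for i using that by (intro integrable_mult_right int bounded_support_coord f)
      have "integral\<^sup>L ?M f = (\<integral>x. f x + (\<Sum>i\<in>?J. z i * (x i * f x)) \<partial>?M)"
        using int[OF f] ii bary by (subst Bochner_Integration.integral_add) (auto intro!: Bochner_Integration.integrable_sum simp del: sum.insert)
      also have "\<dots> \<le> integral\<^sup>L ?M ft"
      proof (rule integral_mono)
        show "integrable ?M (\<lambda>x. f x + (\<Sum>i\<in>?J. z i * (x i * f x)))"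
          using int[OF f] ii by (intro Bochner_Integration.integrable_add Bochner_Integration.integrable_sum) auto
        show "f x + (\<Sum>i\<in>?J. z i * (x i * f x)) \<le> ft x" if "x \<in> space ?M" for x
        proof -
          have "f x + (\<Sum>i\<in>?J. z i * (x i * f x)) = (1 + (\<Sum>i\<in>?J. z i * x i)) * f x"
            by (simp only: distrib_right sum_distrib_right mult.assoc mult_1)
          also have "\<dots> \<le> ft x" unfolding ft_def by (intro mult_right_mono exp_ge_add_one_self f0 that)
          finally show ?thesis .
        qed
      qed (rule int[OF ftb])
      finally show ?thesis .
    qed
    ultimately have "integral\<^sup>L ?M f * m \<le> 4 * (C * \<kappa> * B)"
      using m by (smt (verit) mult_right_mono)
    then show ?thesis by (simp add: m_def \<kappa>_def mult_ac)
  qed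
qed

lemma santalo_PL:
  fixes I :: "'i set"
  assumes "finite I"
  shows "santalo_bound I ((4 * gauss_sq) ^ card I)"
  using assms
proof (induction I rule: finite_induct)
  case empty
  show ?case
  proof (rule santalo_boundI)
    fix f g :: "('i \<Rightarrow> real) \<Rightarrow> real" and C
    assume "\<And>x y. x \<in> space (PL {}) \<Longrightarrow> y \<in> space (PL {}) \<Longrightarrow> f x * g y \<le> C * exp (- (\<Sum>i\<in>{}. x i * y i))"
    moreover have "integral\<^sup>L (PL {}) u = u (\<lambda>_. undefined)" for u :: "('i \<Rightarrow> real) \<Rightarrow> real"
      by (simp add: PiM_empty lebesgue_integral_count_space_finite)
    ultimately show "integral\<^sup>L (PL {}) f * integral\<^sup>L (PL {}) g \<le> C * (4 * gauss_sq) ^ card {}"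
      by (simp add: space_PL)
  qed
next
  case (insert k I)
  then show ?case using santalo_PL_step[of I k] by simp
qed

section \<open>The Blaschke-Santalo inequality\<close>

lemma nn_integral_lborel_scaleR:
  fixes f :: "'a::euclidean_space \<Rightarrow> ennreal"
  assumes [measurable]: "f \<in> borel_measurable borel" and c: "c \<noteq> 0"
  shows "(\<integral>\<^sup>+x. f x \<partial>lborel) = ennreal (\<bar>c\<bar> ^ DIM('a)) * (\<integral>\<^sup>+x. f (c *\<^sub>R x) \<partial>lborel)"
  by (subst lborel_affine[OF c, of 0])
     (simp add: nn_integral_density nn_integral_distr nn_integral_cmult)

lemma integral_lborel_uminus:
  fixes f :: "'a::euclidean_space \<Rightarrow> real"
  assumes [measurable]: "f \<in> borel_measurable borel"
  shows "(\<integral>x. f (- x) \<partial>lborel) = (\<integral>x. f x \<partial>lborel)"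
proof -
  have "(\<integral>x. f x \<partial>(lborel :: 'a measure)) = (\<integral>x. f x \<partial>distr lborel borel (\<lambda>x::'a. - x))"
    by (subst lborel_affine[of "-1" 0]) (simp_all add: density_1)
  then show ?thesis by (simp add: integral_distr)
qed

text \<open>
  Evenness of \<open>f\<close> puts its barycentre at the origin.
\<close>

lemma santalo_euclidean_bounded:
  fixes f g :: "'a::euclidean_space \<Rightarrow> real"
  assumes [measurable]: "f \<in> borel_measurable borel" "g \<in> borel_measurable borel"
    and f: "\<And>x. 0 \<le> f x" "\<And>x. f x \<le> K" "\<And>x. f x \<noteq> 0 \<Longrightarrow> norm x \<le> R"
    and g: "\<And>x. 0 \<le> g x" "\<And>x. g x \<le> L" "\<And>x. g x \<noteq> 0 \<Longrightarrow> norm x \<le> S"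
    and even: "\<And>x. f (- x) = f x"
    and fg: "\<And>x y. f x * g y \<le> exp (- (x \<bullet> y))"
  shows "(\<integral>x. f x \<partial>lborel) * (\<integral>x. g x \<partial>lborel) \<le> (4 * gauss_sq) ^ DIM('a)"
proof -
  define E where "E = (\<lambda>p. \<Sum>b\<in>(Basis::'a set). p b *\<^sub>R b)"
  have Em: "E \<in> measurable (PL Basis) borel" unfolding E_def by measurable
  have int: "(\<integral>x. u x \<partial>lborel) = (\<integral>p. u (E p) \<partial>PL Basis)" if [measurable]: "u \<in> borel_measurable borel" for u :: "'a \<Rightarrow> real"
    by (subst lborel_eq, fold E_def) (rule integral_distr[OF Em that])
  have coord: "E p \<bullet> i = p i" if "i \<in> Basis" for p i unfolding E_def using that by (rule inner_sum_left_Basis)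
  have pair: "E p \<bullet> E q = (\<Sum>i\<in>Basis. p i * q i)" for p q
    by (subst euclidean_inner) (simp add: coord)
  have bs: "bounded_support Basis (\<lambda>p. u (E p))"
    if m: "u \<in> borel_measurable borel" and u: "\<And>x. 0 \<le> u x" "\<And>x. u x \<le> K" "\<And>x. u x \<noteq> 0 \<Longrightarrow> norm x \<le> R" for u K R
  proof (rule bounded_supportI)
    show "(\<lambda>p. u (E p)) \<in> borel_measurable (PL Basis)" by (rule measurable_compose[OF Em m])
    show "\<bar>u (E p)\<bar> \<le> K" for p using u(1,2)[of "E p"] by simp
    show "\<bar>p i\<bar> \<le> R" if "u (E p) \<noteq> 0" "i \<in> Basis" for p i
      using Basis_le_norm[OF that(2), of "E p"] u(3)[OF that(1)] by (simp add: coord[OF that(2)])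
  qed
  have "(\<integral>p. f (E p) \<partial>PL Basis) * (\<integral>p. g (E p) \<partial>PL Basis) \<le> 1 * (4 * gauss_sq) ^ card (Basis :: 'a set)"
  proof (rule santalo_boundD[OF santalo_PL[OF finite_Basis]])
    show "bounded_support Basis (\<lambda>p. f (E p))" using f by (intro bs[where K=K and R=R]) auto
    show "bounded_support Basis (\<lambda>p. g (E p))" using g by (intro bs[where K=L and R=S]) auto
    show "f (E x) * g (E y) \<le> 1 * exp (- (\<Sum>i\<in>Basis. x i * y i))" for x y
      using fg[of "E x" "E y"] by (simp add: pair)
    show "(\<integral>p. p i * f (E p) \<partial>PL Basis) = 0" if "i \<in> Basis" for i
    proof -
      have "(\<integral>p. p i * f (E p) \<partial>PL Basis) = (\<integral>x. (x \<bullet> i) * f x \<partial>lborel)"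
        by (subst int) (simp_all add: coord[OF that])
      moreover have "(\<integral>x. (x \<bullet> i) * f x \<partial>lborel) = - (\<integral>x. (x \<bullet> i) * f x \<partial>lborel)"
        using integral_lborel_uminus[of "\<lambda>x. (x \<bullet> i) * f x"] by (simp add: even)
      ultimately show ?thesis by linarith
    qed
  qed (simp_all add: f(1) g(1))
  then show ?thesis by (simp add: int)
qed

definition trunc :: "nat \<Rightarrow> ('a::real_normed_vector \<Rightarrow> real) \<Rightarrow> 'a \<Rightarrow> real" where
  "trunc n f x = (if norm x \<le> real n then min (f x) (real n) else 0)"

lemma nn_integral_trunc:
  fixes f :: "'a::euclidean_space \<Rightarrow> real"
  assumes [measurable]: "f \<in> borel_measurable borel" and f: "\<And>x. 0 \<le> f x"
  shows "(\<integral>\<^sup>+x. ennreal (f x) \<partial>lborel) = (SUP n. \<integral>\<^sup>+x. ennreal (trunc n f x) \<partial>lborel)"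
proof -
  have "(SUP n. ennreal (trunc n f x)) = ennreal (f x)" for x
  proof (rule antisym)
    show "(SUP n. ennreal (trunc n f x)) \<le> ennreal (f x)"
      using f by (intro SUP_least ennreal_leI) (auto simp: trunc_def)
    obtain n :: nat where "max (norm x) (f x) \<le> real n" using real_arch_simple by blast
    then have "trunc n f x = f x" by (auto simp: trunc_def)
    then show "ennreal (f x) \<le> (SUP n. ennreal (trunc n f x))" by (metis SUP_upper UNIV_I)
  qed
  then have "(\<integral>\<^sup>+x. ennreal (f x) \<partial>lborel) = (\<integral>\<^sup>+x. (SUP n. ennreal (trunc n f x)) \<partial>lborel)" by simp
  also have "\<dots> = (SUP n. \<integral>\<^sup>+x. ennreal (trunc n f x) \<partial>lborel)"
  proof (rule nn_integral_monotone_convergence_SUP)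
    show "incseq (\<lambda>n x. ennreal (trunc n f x))"
      using f by (intro incseq_SucI le_funI ennreal_leI) (auto simp: trunc_def)
  qed (simp add: trunc_def)
  finally show ?thesis .
qed

lemma santalo_even:
  fixes f g :: "'a::euclidean_space \<Rightarrow> real"
  assumes [measurable]: "f \<in> borel_measurable borel" "g \<in> borel_measurable borel"
    and f: "\<And>x. 0 \<le> f x" and g: "\<And>x. 0 \<le> g x"
    and even: "\<And>x. f (- x) = f x"
    and fg: "\<And>x y. f x * g y \<le> exp (- (x \<bullet> y))"
  shows "(\<integral>\<^sup>+x. f x \<partial>lborel) * (\<integral>\<^sup>+x. g x \<partial>lborel) \<le> (4 * half_gauss\<^sup>2) ^ DIM('a)"
proof -
  have tm[measurable]: "trunc n u \<in> borel_measurable borel" if [measurable]: "u \<in> borel_measurable borel" for n and u :: "'a \<Rightarrow> real"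
    unfolding trunc_def[abs_def] by measurable
  have t0: "0 \<le> trunc n u x" "trunc n u x \<le> real n" "trunc n u x \<le> u x" if "\<And>x. 0 \<le> u x" for u n and x :: 'a
    using that[of x] by (auto simp: trunc_def)
  have ts: "trunc n u x \<noteq> 0 \<Longrightarrow> norm x \<le> real n" for u n and x :: 'a by (auto simp: trunc_def split: if_splits)
  have fin: "(\<integral>\<^sup>+x. ennreal (trunc n u x) \<partial>lborel) = ennreal (\<integral>x. trunc n u x \<partial>lborel)" 
    if [measurable]: "u \<in> borel_measurable borel" and u: "\<And>x. 0 \<le> u x" for u :: "'a \<Rightarrow> real" and n
  proof (rule nn_integral_eq_integral)
    have "integrable lborel (\<lambda>x::'a. real n * indicator (cball 0 (real n)) x)"
      by (intro integrable_mult_right integrable_real_indicator emeasure_lborel_cball_finite) simp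
    then show "integrable lborel (trunc n u)"
    proof (rule Bochner_Integration.integrable_bound)
      have "norm (trunc n u x) \<le> norm (real n * indicator (cball 0 (real n)) x)" for x :: 'a
      proof (cases "trunc n u x = 0")
        case False
        have "0 \<le> trunc n u x" "trunc n u x \<le> real n" by (rule t0(1)[OF u], rule t0(2)[OF u])
        then show ?thesis using ts[OF False] by simp
      qed simp
      then show "AE x in lborel. norm (trunc n u x) \<le> norm (real n * indicator (cball 0 (real n)) x)" by simp
    qed simp
  qed (use t0[OF u] in auto)
  have le: "(\<integral>\<^sup>+x. ennreal (trunc n f x) \<partial>lborel) * (\<integral>\<^sup>+x. ennreal (trunc m g x) \<partial>lborel) \<le> (4 * half_gauss\<^sup>2) ^ DIM('a)" for n m
  proof -
    have "(\<integral>x. trunc n f x \<partial>lborel) * (\<integral>x. trunc m g x \<partial>lborel) \<le> (4 * gauss_sq) ^ DIM('a)"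
    proof (rule santalo_euclidean_bounded[where K="real n" and R="real n" and L="real m" and S="real m"])
      show "trunc n f x * trunc m g y \<le> exp (- (x \<bullet> y))" for x y
        by (rule order_trans[OF mult_mono fg]) (use t0[OF f] t0[OF g] f g in auto)
      show "trunc n f (- x) = trunc n f x" for x by (simp add: trunc_def even)
    qed (use t0[OF f] t0[OF g] ts in auto)
    then have "ennreal ((\<integral>x. trunc n f x \<partial>lborel) * (\<integral>x. trunc m g x \<partial>lborel)) \<le> ennreal ((4 * gauss_sq) ^ DIM('a))"
      by (rule ennreal_leI)
    moreover have "ennreal ((4 * gauss_sq) ^ DIM('a)) = (4 * half_gauss\<^sup>2) ^ DIM('a)"
      using half_gauss_finite by (simp add: ennreal_power[symmetric] ennreal_mult)
    ultimately show ?thesis using t0[OF f] t0[OF g]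
      by (simp add: fin f g ennreal_mult)
  qed
  show ?thesis
    unfolding nn_integral_trunc[OF \<open>f \<in> _\<close> f] nn_integral_trunc[OF \<open>g \<in> _\<close> g]
      SUP_mult_right_ennreal SUP_mult_left_ennreal
    by (intro SUP_least le)
qed

text \<open>
  The radial factor in \<open>nn_integral_gauss_gauge\<close>: the integral of a Gaussian built from a gauge, divided by the volume
  of the unit ball of the gauge.
\<close>

definition gauss_moment :: "nat \<Rightarrow> ennreal" where
  "gauss_moment n = (\<integral>\<^sup>+t. ennreal (t ^ (n + 1) * exp (- t\<^sup>2 / 2)) * indicator {0<..} t \<partial>lborel)"

text \<open>
  \<open>exp (- a\<^sup>2 / 2)\<close> is the integral of \<open>t * exp (- t\<^sup>2 / 2)\<close> over \<open>t \<ge> a\<close>; after exchanging the integrals, homogeneity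
  scales the sublevel set at \<open>t\<close> to the one at \<open>1\<close>.
\<close>

lemma nn_integral_gauss_gauge:
  fixes N :: "'a::euclidean_space \<Rightarrow> real"
  assumes [measurable]: "N \<in> borel_measurable borel" and N0: "\<And>x. 0 \<le> N x"
    and hom: "\<And>t x. 0 < t \<Longrightarrow> N (t *\<^sub>R x) = t * N x"
  shows "(\<integral>\<^sup>+x. ennreal (exp (- (N x)\<^sup>2 / 2)) \<partial>lborel) = gauss_moment DIM('a) * emeasure lborel {x. N x \<le> 1}"
proof -
  let ?R = "\<lambda>t. (ennreal (t ^ (DIM('a) + 1) * exp (- t\<^sup>2 / 2)) * indicator {0<..} t) * emeasure lborel {x. N x \<le> 1}"
  let ?G = "\<lambda>x t. ennreal (t * exp (- t\<^sup>2 / 2)) * indicator {p. N (fst p) \<le> snd p} (x, t)"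
  have e: "(\<integral>\<^sup>+t. ennreal (t * exp (- t\<^sup>2 / 2)) * indicator {a..} t \<partial>lborel) = ennreal (exp (- a\<^sup>2 / 2))" if "0 \<le> a" for a :: real
  proof -
    have "(\<integral>\<^sup>+t. ennreal (t * exp (- t\<^sup>2 / 2)) * indicator {a..} t \<partial>lborel) = ennreal (0 - (- exp (- a\<^sup>2 / 2)))"
    proof (rule nn_integral_FTC_atLeast)
      show "((\<lambda>t::real. - exp (- t\<^sup>2 / 2)) \<longlongrightarrow> 0) at_top" by real_asymp
      show "((\<lambda>t::real. - exp (- t\<^sup>2 / 2)) has_real_derivative t * exp (- t\<^sup>2 / 2)) (at t)" for t
        by (auto intro!: derivative_eq_intros simp: power2_eq_square)
    qed (use that in auto)
    then show ?thesis by simp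
  qed
  have "(\<integral>\<^sup>+x. ennreal (exp (- (N x)\<^sup>2 / 2)) \<partial>lborel)
     = (\<integral>\<^sup>+x. \<integral>\<^sup>+t. ?G x t \<partial>lborel \<partial>lborel)"
    using N0 by (subst e[symmetric]) (auto intro!: nn_integral_cong simp: indicator_def)
  also have "\<dots> = (\<integral>\<^sup>+t. \<integral>\<^sup>+x. ?G x t \<partial>lborel \<partial>lborel)"
    by (rule lborel_pair.Fubini'[symmetric]) measurable
  also have "\<dots> = (\<integral>\<^sup>+t. ?R t \<partial>lborel)"
  proof (rule nn_integral_cong_AE)
    have "AE t in lborel. t \<noteq> (0::real)" by (rule AE_lborel_singleton)
    then show "AE t in lborel. (\<integral>\<^sup>+x. ?G x t \<partial>lborel)
      = ?R t"
    proof (rule AE_mp, intro AE_I2 impI)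
      fix t :: real assume "t \<noteq> 0"
      then consider "t < 0" | "t > 0" by linarith
      then show "(\<integral>\<^sup>+x. ?G x t \<partial>lborel)
      = ?R t"
      proof cases
        case 1
        then show ?thesis by (simp add: ennreal_neg mult_nonpos_nonneg)
      next
        case 2
        have "(\<integral>\<^sup>+x. indicator {x. N x \<le> t} x \<partial>lborel) = ennreal (t ^ DIM('a)) * (\<integral>\<^sup>+x. indicator {x. N x \<le> t} (t *\<^sub>R x) \<partial>(lborel :: 'a measure))"
          using 2 by (subst nn_integral_lborel_scaleR[of _ t]) auto
        also have "(\<integral>\<^sup>+x. indicator {x. N x \<le> t} (t *\<^sub>R x) \<partial>(lborel :: 'a measure)) = (\<integral>\<^sup>+x. indicator {x. N x \<le> 1} x \<partial>lborel)"
          using 2 by (intro nn_integral_cong) (auto simp: indicator_def hom)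
        finally have "(\<integral>\<^sup>+x. indicator {x. N x \<le> t} x \<partial>lborel) = ennreal (t ^ DIM('a)) * emeasure lborel {x. N x \<le> 1}"
          by (subst (asm) (2) nn_integral_indicator) auto
        moreover have "(\<integral>\<^sup>+x. ?G x t \<partial>lborel)
           = ennreal (t * exp (- t\<^sup>2 / 2)) * (\<integral>\<^sup>+x. indicator {x. N x \<le> t} x \<partial>lborel)"
          by (subst nn_integral_cmult[symmetric]) (auto intro!: nn_integral_cong simp: indicator_def)
        moreover have "ennreal (t * exp (- t\<^sup>2 / 2)) * ennreal (t ^ DIM('a)) = ennreal (t ^ (DIM('a) + 1) * exp (- t\<^sup>2 / 2)) * indicator {0<..} t"
          using 2 by (subst ennreal_mult[symmetric]) (auto simp: mult_ac)
        ultimately show ?thesis by (simp only: mult.assoc[symmetric])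
      qed
    qed
  qed
  also have "\<dots> = gauss_moment DIM('a) * emeasure lborel {x. N x \<le> 1}"
    unfolding gauss_moment_def by (rule nn_integral_multc) measurable
  finally show ?thesis .
qed

lemma nn_integral_gauss: "(\<integral>\<^sup>+x. ennreal (exp (- (norm x)\<^sup>2 / 2)) \<partial>(lborel :: 'a::euclidean_space measure)) = (2 * half_gauss) ^ DIM('a)"
proof -
  have 1: "(\<integral>\<^sup>+r. ennreal (exp (- r\<^sup>2 / 2)) \<partial>lborel) = 2 * half_gauss"
  proof -
    have "(\<integral>\<^sup>+r. ennreal (exp (- r\<^sup>2 / 2)) \<partial>lborel) = (\<integral>\<^sup>+r. ennreal (exp (- r\<^sup>2 / 2)) * indicator {0<..} r + ennreal (exp (- r\<^sup>2 / 2)) * indicator {0<..} (- r) \<partial>lborel)"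
    proof (rule nn_integral_cong_AE)
      have "AE t in lborel. t \<noteq> (0::real)" by (rule AE_lborel_singleton)
      then show "AE r in lborel. ennreal (exp (- r\<^sup>2 / 2)) = ennreal (exp (- r\<^sup>2 / 2)) * indicator {0<..} r + ennreal (exp (- r\<^sup>2 / 2)) * indicator {0<..} (- r)"
        by eventually_elim (auto simp: indicator_def)
    qed
    also have "\<dots> = half_gauss + (\<integral>\<^sup>+r. ennreal (exp (- r\<^sup>2 / 2)) * indicator {0<..} (- r) \<partial>lborel)"
      unfolding half_gauss_def by (rule nn_integral_add) measurable
    also have "(\<integral>\<^sup>+r. ennreal (exp (- r\<^sup>2 / 2)) * indicator {0<..} (- r) \<partial>lborel) = half_gauss"
      unfolding half_gauss_def by (subst nn_integral_real_affine[of _ "-1" 0]) auto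
    finally show ?thesis by (simp add: mult_2)
  qed
  have "exp (- (norm x)\<^sup>2 / 2) = (\<Prod>b\<in>Basis. exp (- (x \<bullet> b)\<^sup>2 / 2))" for x :: 'a
    unfolding power2_norm_eq_inner euclidean_inner[of x x]
    by (simp add: exp_sum[symmetric] sum_negf sum_divide_distrib power2_eq_square)
  then have "(\<integral>\<^sup>+x. ennreal (exp (- (norm x)\<^sup>2 / 2)) \<partial>(lborel :: 'a measure)) = (\<integral>\<^sup>+x. (\<Prod>b\<in>Basis. ennreal (exp (- (x \<bullet> b)\<^sup>2 / 2))) \<partial>(lborel :: 'a measure))"
    by (simp add: prod_ennreal)
  also have "\<dots> = (\<Prod>b\<in>(Basis::'a set). \<integral>\<^sup>+r. ennreal (exp (- r\<^sup>2 / 2)) \<partial>lborel)"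
    by (rule nn_integral_lborel_prod) auto
  finally show ?thesis unfolding 1 prod_constant .
qed

text \<open>
  The gauge \<open>N\<close> of the polar set satisfies \<open>x \<bullet> y \<le> h x * N y\<close>, hence \<open>- (x \<bullet> y) \<ge> - h\<^sup>2 / 2 - N\<^sup>2 / 2\<close> by the inequality
  of arithmetic and geometric means, and the functional inequality applies.
\<close>

theorem blaschke_santalo:
  fixes h :: "'a::euclidean_space \<Rightarrow> real"
  assumes h[measurable]: "h \<in> borel_measurable borel" and c: "c > 0" "\<And>x. c * norm x \<le> h x"
    and hom: "\<And>t x. 0 < t \<Longrightarrow> h (t *\<^sub>R x) = t * h x" and even: "\<And>x. h (- x) = h x"
  shows "emeasure lborel {x. h x \<le> 1} * emeasure lborel {y. \<forall>x. x \<bullet> y \<le> h x} \<le> (emeasure lborel (cball (0::'a) 1))\<^sup>2"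
proof -
  define K where "K = {x. h x \<le> 1}"
  have h0: "0 \<le> h x" for x using c(2)[of x] c(1) by (meson mult_nonneg_nonneg norm_ge_zero less_imp_le order_trans)
  have hz: "h 0 = 0" using hom[of 2 0] by simp
  have K0: "0 \<in> K" by (simp add: K_def hz)
  define N where "N = (\<lambda>y. SUP x\<in>K. x \<bullet> y)"
  have Kb: "norm x \<le> 1 / c" if "x \<in> K" for x
    using c(2)[of x] that c(1) by (simp add: K_def field_simps)
  have bdd: "bdd_above ((\<lambda>x. x \<bullet> y) ` K)" for y
  proof (rule bdd_aboveI2)
    fix x assume "x \<in> K"
    have "x \<bullet> y \<le> norm x * norm y" by (rule norm_cauchy_schwarz)
    also have "\<dots> \<le> 1 / c * norm y" using Kb[OF \<open>x \<in> K\<close>] by (intro mult_right_mono) auto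
    finally show "x \<bullet> y \<le> 1 / c * norm y" .
  qed
  have Nle: "N y \<le> t \<longleftrightarrow> (\<forall>x\<in>K. x \<bullet> y \<le> t)" for y t
    unfolding N_def using K0 by (subst cSUP_le_iff[OF _ bdd]) auto
  have N0: "0 \<le> N y" for y unfolding N_def using cSUP_upper[OF K0 bdd, of y] by simp
  have Nm[measurable]: "N \<in> borel_measurable borel"
  proof (rule borel_measurable_iff_le[THEN iffD2], intro allI)
    fix a
    have "{w. N w \<le> a} = (\<Inter>x\<in>K. {w. x \<bullet> w \<le> a})" by (auto simp: Nle)
    moreover have "closed (\<Inter>x\<in>K. {w. x \<bullet> w \<le> a})"
      by (intro closed_INT ballI closed_Collect_le continuous_intros)
    ultimately show "{w \<in> space borel. N w \<le> a} \<in> sets borel" by (simp add: borel_closed)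
  qed
  have Nhom: "N (t *\<^sub>R y) = t * N y" if t: "0 < t" for t y
  proof -
    have "N (t *\<^sub>R y) \<le> s \<longleftrightarrow> t * N y \<le> s" for s
    proof -
      have "t * N y \<le> s \<longleftrightarrow> N y \<le> s / t" using t by (simp add: field_simps)
      then show ?thesis unfolding Nle using t by (simp add: field_simps)
    qed
    then show ?thesis by (meson antisym order_refl)
  qed
  have dual: "x \<bullet> y \<le> h x * N y" for x y
  proof (cases "x = 0")
    case False
    then have hx: "h x > 0" using c(2)[of x] c(1) by (smt (verit) mult_pos_pos zero_less_norm_iff)
    then have "(1 / h x) *\<^sub>R x \<in> K" by (simp add: K_def hom)
    then have "((1 / h x) *\<^sub>R x) \<bullet> y \<le> N y" using Nle by blast
    then show ?thesis using hx by (simp add: field_simps)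
  qed (simp add: hz)
  let ?f = "\<lambda>x. exp (- (h x)\<^sup>2 / 2)" and ?g = "\<lambda>y. exp (- (N y)\<^sup>2 / 2)"
  have "(\<integral>\<^sup>+x. ?f x \<partial>lborel) * (\<integral>\<^sup>+x. ?g x \<partial>lborel) \<le> (4 * half_gauss\<^sup>2) ^ DIM('a)"
  proof (rule santalo_even)
    show "?f x * ?g y \<le> exp (- (x \<bullet> y))" for x y
    proof -
      have "2 * (h x * N y) \<le> (h x)\<^sup>2 + (N y)\<^sup>2" using zero_le_power2[of "h x - N y"] by (simp add: power2_eq_square algebra_simps)
      then have "- (h x)\<^sup>2 / 2 + - (N y)\<^sup>2 / 2 \<le> - (x \<bullet> y)" using dual[of x y] by (simp add: field_simps)
      then show ?thesis by (simp add: mult_exp_exp)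
    qed
  qed (auto simp: even)
  also have "(4 * half_gauss\<^sup>2) ^ DIM('a) = ((2 * half_gauss) ^ DIM('a))\<^sup>2"
  proof -
    have "4 * half_gauss\<^sup>2 = (2 * half_gauss)\<^sup>2" by (simp add: power_mult_distrib)
    then show ?thesis by (simp only: power_mult[symmetric] mult.commute)
  qed
  also have "(2 * half_gauss) ^ DIM('a) = gauss_moment DIM('a) * emeasure lborel {x::'a. norm x \<le> 1}"
    by (subst nn_integral_gauss[symmetric], rule nn_integral_gauss_gauge) auto
  also have "{x::'a. norm x \<le> 1} = cball 0 1" by auto
  also have "(\<integral>\<^sup>+x. ?f x \<partial>lborel) = gauss_moment DIM('a) * emeasure lborel K"
    unfolding K_def by (rule nn_integral_gauss_gauge) (auto simp: h0 hom)
  also have "(\<integral>\<^sup>+x. ?g x \<partial>lborel) = gauss_moment DIM('a) * emeasure lborel {y. N y \<le> 1}"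
    by (rule nn_integral_gauss_gauge) (auto simp: N0 Nhom)
  finally have le: "(gauss_moment DIM('a))\<^sup>2 * (emeasure lborel K * emeasure lborel {y. N y \<le> 1}) 
      \<le> (gauss_moment DIM('a))\<^sup>2 * (emeasure lborel (cball (0::'a) 1))\<^sup>2"
    by (simp add: power2_eq_square mult_ac)
  have gpos: "gauss_moment DIM('a) \<noteq> 0"
  proof
    assume "gauss_moment DIM('a) = 0"
    then have "AE t in lborel. ennreal (t ^ (DIM('a) + 1) * exp (- t\<^sup>2 / 2)) * indicator {0<..} t = 0"
      unfolding gauss_moment_def by (subst (asm) nn_integral_0_iff_AE) auto
    moreover have "t \<notin> {0<..<1}" if "ennreal (t ^ (DIM('a) + 1) * exp (- t\<^sup>2 / 2)) * indicator {0<..} t = 0" for t :: real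
    proof
      assume "t \<in> {0<..<1}"
      then have "t > 0" by simp
      then have "ennreal (t ^ (DIM('a) + 1) * exp (- t\<^sup>2 / 2)) = 0" using that by simp
      then have "t ^ (DIM('a) + 1) * exp (- t\<^sup>2 / 2) \<le> 0" by (simp only: ennreal_eq_0_iff)
      moreover have "0 < t ^ (DIM('a) + 1) * exp (- t\<^sup>2 / 2)"
        using \<open>t > 0\<close> by (intro mult_pos_pos zero_less_power exp_gt_zero)
      ultimately show False by linarith
    qed
    ultimately have "AE t in lborel. t \<notin> {0<..<1::real}" by (rule eventually_mono)
    then have "emeasure lborel {0<..<1::real} = 0"
      by (subst (asm) AE_iff_measurable[of "{0<..<1::real}"]) (auto simp del: greaterThanLessThan_iff)
    then show False by simp
  qed
  have gfin: "gauss_moment DIM('a) \<noteq> top"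
  proof
    assume "gauss_moment DIM('a) = top"
    moreover have "gauss_moment DIM('a) * emeasure lborel {x::'a. norm x \<le> 1} = (2 * half_gauss) ^ DIM('a)"
      by (subst nn_integral_gauss[symmetric], rule nn_integral_gauss_gauge[symmetric]) auto
    moreover have "(2 * half_gauss) ^ DIM('a) < top" using half_gauss_finite by (simp add: power_less_top_ennreal ennreal_mult_less_top)
    moreover have "emeasure lborel {x::'a. norm x \<le> 1} \<noteq> 0"
    proof -
      have "0 < emeasure lborel (ball (0::'a) 1)" by (simp add: emeasure_ball)
      also have "\<dots> \<le> emeasure lborel {x::'a. norm x \<le> 1}" by (intro emeasure_mono) auto
      finally show ?thesis by simp
    qed
    ultimately show False by (simp add: ennreal_top_mult)
  qed
  have "emeasure lborel K * emeasure lborel {y. N y \<le> 1} \<le> (emeasure lborel (cball (0::'a) 1))\<^sup>2"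
    using le gpos gfin by (subst (asm) ennreal_mult_le_mult_iff) (auto simp: power2_eq_square ennreal_mult_eq_top_iff)
  moreover have "emeasure lborel {y. \<forall>x. x \<bullet> y \<le> h x} \<le> emeasure lborel {y. N y \<le> 1}"
  proof (rule emeasure_mono)
    show "{y. \<forall>x. x \<bullet> y \<le> h x} \<subseteq> {y. N y \<le> 1}" by (auto simp: Nle K_def intro: order_trans)
  qed simp
  ultimately show ?thesis unfolding K_def by (meson mult_left_mono order_trans zero_le)
qed

section \<open>Change of variables for an arbitrary finite index type\<close>

text \<open>
  The theorem \<open>has_measure_differentiable_image\<close> assumes a well-ordered index type. A copy of the index type that
  carries the order of an initial segment of the natural numbers transfers it to every finite index type.
\<close>

typedef 'n idx = "{..<CARD('n::finite)}"
  by (rule exI[of _ 0]) simp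

instantiation idx :: (finite) "{finite, wellorder}"
begin

definition less_eq_idx :: "'a idx \<Rightarrow> 'a idx \<Rightarrow> bool" where
  "x \<le> y \<longleftrightarrow> Rep_idx x \<le> Rep_idx y"

definition less_idx :: "'a idx \<Rightarrow> 'a idx \<Rightarrow> bool" where
  "x < y \<longleftrightarrow> Rep_idx x < Rep_idx y"

instance
proof
  show "finite (UNIV :: 'a idx set)"
    by (rule finite_imageD[of Rep_idx])
       (auto simp: inj_on_def Rep_idx_inject type_definition.Rep_range[OF type_definition_idx])
  fix P :: "'a idx \<Rightarrow> bool" and a :: "'a idx"
  assume step: "\<And>x. (\<And>y. y < x \<Longrightarrow> P y) \<Longrightarrow> P x"
  show "P a"
    by (induction "Rep_idx a" arbitrary: a rule: less_induct) (auto intro: step simp: less_idx_def)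
qed (auto simp: less_eq_idx_def less_idx_def Rep_idx_inject)

end

lemma prod_Basis_cart:
  "(\<Prod>b\<in>(Basis::(real^'n::finite) set). g b) = (\<Prod>i\<in>UNIV. g (axis i 1))"
proof -
  have b: "(Basis::(real^'n) set) = range (\<lambda>i. axis i 1)" by (auto simp: Basis_vec_def)
  have i: "inj (\<lambda>i::'n. axis i (1::real))" by (auto simp: inj_def axis_eq_axis)
  show ?thesis unfolding b by (subst prod.reindex[OF i]) simp
qed

definition reindex :: "('m::finite \<Rightarrow> 'n::finite) \<Rightarrow> real^'n \<Rightarrow> real^'m" where
  "reindex q x = (\<chi> i. x $ q i)"

lemma linear_reindex: "linear (reindex q)"
  by (rule linearI) (simp_all add: reindex_def vec_eq_iff)

lemma continuous_reindex: "continuous_on S (reindex q)"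
  by (rule linear_continuous_on[OF linear_reindex[unfolded linear_conv_bounded_linear]])

lemma reindex_inv:
  assumes "bij q"
  shows "reindex q (reindex (inv q) y) = y" "reindex (inv q) (reindex q x) = x"
  using assms by (simp_all add: reindex_def vec_eq_iff bij_is_inj bij_is_surj surj_f_inv_f)

lemma distr_reindex:
  fixes q :: "'m::finite \<Rightarrow> 'n::finite"
  assumes q: "bij q"
  shows "distr lborel borel (reindex q) = (lborel :: (real^'m) measure)"
proof (rule lborel_eqI[symmetric])
  have [measurable]: "reindex q \<in> borel_measurable borel"
    by (intro borel_measurable_continuous_onI continuous_reindex)
  fix l u :: "real^'m" assume lu: "\<And>b. b \<in> Basis \<Longrightarrow> l \<bullet> b \<le> u \<bullet> b"
  have le: "l $ i \<le> u $ i" for i using lu[of "axis i 1"] by (auto simp: inner_axis axis_in_Basis_iff)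
  have "reindex q -` box l u = box (reindex (inv q) l) (reindex (inv q) u)"
  proof -
    have "(\<forall>i. l $ i < x $ q i \<and> x $ q i < u $ i) \<longleftrightarrow> (\<forall>j. l $ inv q j < x $ j \<and> x $ j < u $ inv q j)" for x :: "real^'n"
      using q by (metis bij_inv_eq_iff)
    then show ?thesis by (auto simp: mem_box_cart reindex_def)
  qed
  then have "emeasure (distr lborel borel (reindex q)) (box l u) = emeasure lborel (box (reindex (inv q) l) (reindex (inv q) u))"
    by (subst emeasure_distr) auto
  also have "\<dots> = (\<Prod>b\<in>Basis. (reindex (inv q) u - reindex (inv q) l) \<bullet> b)"
  proof (rule emeasure_lborel_box)
    fix b :: "real^'n" assume "b \<in> Basis"
    then obtain j where "b = axis j 1" by (auto simp: Basis_vec_def)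
    then show "reindex (inv q) l \<bullet> b \<le> reindex (inv q) u \<bullet> b" using le by (simp add: inner_axis reindex_def)
  qed
  also have "(\<Prod>b\<in>Basis. (reindex (inv q) u - reindex (inv q) l) \<bullet> b) = (\<Prod>j\<in>UNIV. u $ inv q j - l $ inv q j)"
    by (simp add: prod_Basis_cart inner_axis reindex_def)
  also have "\<dots> = (\<Prod>i\<in>UNIV. u $ i - l $ i)"
    using bij_imp_bij_inv[OF q] by (intro prod.reindex_bij_betw)
  also have "\<dots> = (\<Prod>b\<in>Basis. (u - l) \<bullet> b)"
    by (simp add: prod_Basis_cart inner_axis)
  finally show "emeasure (distr lborel borel (reindex q)) (box l u) = ennreal (\<Prod>b\<in>Basis. (u - l) \<bullet> b)" .
qed simp

lemma det_reindex:
  fixes q :: "'m::finite \<Rightarrow> 'n::finite" and A :: "real^'n^'n"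
  assumes q: "bij q"
  shows "det (\<chi> i j. A $ q i $ q j) = det A"
proof -
  let ?m = "map_permutation UNIV q"
  have inj: "inj q" using q by (rule bij_is_inj)
  have bij: "bij_betw ?m {p. p permutes UNIV} {p. p permutes UNIV}"
  proof (rule bij_betw_byWitness[where f'="map_permutation UNIV (inv q)"])
    show "\<forall>p\<in>{p. p permutes UNIV}. map_permutation UNIV (inv q) (?m p) = p"
      using q by (auto intro!: map_permutation_compose_inv simp: bij_is_inj)
    show "\<forall>p\<in>{p. p permutes UNIV}. ?m (map_permutation UNIV (inv q) p) = p"
      using q by (auto intro!: map_permutation_compose_inv bij_imp_bij_inv simp: bij_is_surj surj_f_inv_f)
    show "?m ` {p. p permutes UNIV} \<subseteq> {p. p permutes UNIV}"
      using q by (auto intro: map_permutation_permutes)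
    show "map_permutation UNIV (inv q) ` {p. p permutes UNIV} \<subseteq> {p. p permutes UNIV}"
      using bij_imp_bij_inv[OF q] by (auto intro: map_permutation_permutes)
  qed
  have "det A = (\<Sum>p | p permutes UNIV. of_int (sign p) * (\<Prod>i\<in>UNIV. A $ i $ p i))" by (simp add: det_def)
  also have "\<dots> = (\<Sum>p | p permutes UNIV. of_int (sign (?m p)) * (\<Prod>i\<in>UNIV. A $ i $ ?m p i))"
    using bij by (rule sum.reindex_bij_betw[symmetric])
  also have "\<dots> = (\<Sum>p | p permutes UNIV. of_int (sign p) * (\<Prod>i\<in>UNIV. A $ q i $ q (p i)))"
  proof (intro sum.cong refl)
    fix p :: "'m \<Rightarrow> 'm" assume p: "p \<in> {p. p permutes UNIV}"
    have "(\<Prod>i\<in>UNIV. A $ i $ ?m p i) = (\<Prod>i\<in>UNIV. A $ q i $ ?m p (q i))"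
      using q by (rule prod.reindex_bij_betw[symmetric])
    also have "\<dots> = (\<Prod>i\<in>UNIV. A $ q i $ q (p i))"
      by (simp add: map_permutation_apply[OF inj])
    finally show "of_int (sign (?m p)) * (\<Prod>i\<in>UNIV. A $ i $ ?m p i) = of_int (sign p) * (\<Prod>i\<in>UNIV. A $ q i $ q (p i))"
      using p by (simp add: sign_map_permutation[OF inj])
  qed
  finally show ?thesis by (simp add: det_def)
qed

lemma emeasure_range_differentiable_wellorder:
  fixes f :: "real^'n::{finite,wellorder} \<Rightarrow> real^'n::_"
  assumes der: "\<And>x. (f has_derivative f' x) (at x)" and inj: "inj f" and bdd: "bounded (range f)" and borel: "range f \<in> sets borel"
    and meas: "(\<lambda>x. det (matrix (f' x))) \<in> borel_measurable borel"
  shows "emeasure lborel (range f) = (\<integral>\<^sup>+x. ennreal \<bar>det (matrix (f' x))\<bar> \<partial>lborel)"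
proof -
  have lm: "range f \<in> lmeasurable"
    using bdd borel by (intro bounded_set_imp_lmeasurable) auto
  have "((\<lambda>x. \<bar>det (matrix (f' x))\<bar>) has_integral measure lebesgue (range f)) UNIV"
    using has_measure_differentiable_image[of UNIV f f' "measure lebesgue (range f)"] der inj lm by auto
  from nn_integral_has_integral_lebesgue[OF _ this]
  have "(\<integral>\<^sup>+x. ennreal \<bar>det (matrix (f' x))\<bar> \<partial>lborel) = ennreal (measure lebesgue (range f))" by simp
  also have "\<dots> = emeasure lebesgue (range f)" by (rule emeasure_eq_ennreal_measure[symmetric, OF fmeasurableD2[OF lm]])
  also have "\<dots> = emeasure lborel (range f)" using borel by simp
  finally show ?thesis ..
qed

lemma emeasure_range_differentiable:
  fixes f :: "real^'n::finite \<Rightarrow> real^'n"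
  assumes der: "\<And>x. (f has_derivative f' x) (at x)" and inj: "inj f" and bdd: "bounded (range f)"
    and meas[measurable]: "(\<lambda>x. det (matrix (f' x))) \<in> borel_measurable borel"
  shows "emeasure lborel (range f) = (\<integral>\<^sup>+x. ennreal \<bar>det (matrix (f' x))\<bar> \<partial>lborel)"
proof -
  have "CARD('n idx) = CARD('n)"
    using type_definition.card[OF type_definition_idx] by simp
  then obtain q :: "'n idx \<Rightarrow> 'n" where q: "bij q"
    using finite_same_card_bij[of "UNIV :: 'n idx set" "UNIV :: 'n set"] by auto
  let ?r = "reindex q" and ?s = "reindex (inv q)"
  note qi = bij_imp_bij_inv[OF q]
  have rm[measurable]: "?r \<in> borel_measurable borel" and sm[measurable]: "?s \<in> borel_measurable borel"
    by (intro borel_measurable_continuous_onI continuous_reindex)+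
  define F where "F = (\<lambda>y. ?r (f (?s y)))"
  define F' where "F' = (\<lambda>y z. ?r (f' (?s y) (?s z)))"
  have borel: "range g \<in> sets borel" if g: "continuous_on UNIV g" for g :: "real^'k::finite \<Rightarrow> real^'k"
  proof -
    have "range g = (\<Union>n::nat. g ` cball 0 (real n))"
    proof -
      have "\<exists>n::nat. x \<in> cball 0 (real n)" for x :: "real^'k" using real_arch_simple[of "norm x"] by auto
      then show ?thesis by blast
    qed
    moreover
    have "compact (g ` cball 0 (real n))" for n
      using g by (intro compact_continuous_image) (auto intro: continuous_on_subset)
    then have "(\<Union>n::nat. g ` cball 0 (real n)) \<in> sets borel"
      by (intro sets.countable_UN) (auto intro: borel_compact)
    ultimately show ?thesis by simp
  qed
  have cf: "continuous_on UNIV f"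
    using der by (auto intro!: has_derivative_continuous continuous_at_imp_continuous_on)
  have Fder: "(F has_derivative F' y) (at y)" for y
  proof -
    have bl: "bounded_linear ?r" "bounded_linear ?s" using linear_reindex by (simp_all add: linear_conv_bounded_linear)
    have 1: "(?s has_derivative ?s) (at y)" by (rule bounded_linear_imp_has_derivative[OF bl(2)])
    have 2: "((\<lambda>y. f (?s y)) has_derivative (\<lambda>z. f' (?s y) (?s z))) (at y)"
      by (rule has_derivative_compose[OF 1 der])
    show ?thesis unfolding F_def F'_def
      by (rule has_derivative_compose[OF 2 bounded_linear_imp_has_derivative[OF bl(1)]])
  qed
  have det: "det (matrix (F' y)) = det (matrix (f' (?s y)))" for y
  proof -
    have "inv q k = j \<longleftrightarrow> k = q j" for j k using bij_inv_eq_iff[OF q] by metis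
    then have "?s (axis j 1) = axis (q j) 1" for j
      by (simp add: reindex_def axis_def vec_eq_iff)
    then have "matrix (F' y) = (\<chi> i j. matrix (f' (?s y)) $ q i $ q j)"
      by (simp add: matrix_def F'_def vec_eq_iff) (simp add: reindex_def)
    then show ?thesis by (simp add: det_reindex[OF q])
  qed
  have rangeF: "range F = ?r ` range f"
    unfolding F_def using reindex_inv(2)[OF q] by (auto simp: image_iff) metis
  have Fb: "range F \<in> sets borel"
      unfolding F_def by (intro borel continuous_on_compose2[OF continuous_reindex[of UNIV]] continuous_on_compose2[OF cf] continuous_reindex) auto
  have "emeasure lborel (range F) = (\<integral>\<^sup>+y. ennreal \<bar>det (matrix (F' y))\<bar> \<partial>lborel)"
  proof (rule emeasure_range_differentiable_wellorder[OF Fder])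
    show "inj F" unfolding F_def
      using inj reindex_inv[OF q] by (auto simp: inj_def) metis
    show "bounded (range F)" unfolding rangeF
      by (intro bounded_linear_image bdd) (use linear_reindex in \<open>simp add: linear_conv_bounded_linear\<close>)
    show "range F \<in> sets borel" by (rule Fb)
    show "(\<lambda>y. det (matrix (F' y))) \<in> borel_measurable borel" unfolding det by measurable
  qed
  also have "\<dots> = (\<integral>\<^sup>+x. ennreal \<bar>det (matrix (f' x))\<bar> \<partial>lborel)"
    unfolding det by (subst distr_reindex[OF qi, symmetric], subst nn_integral_distr) (auto simp: reindex_inv[OF q])
  also have "emeasure lborel (range F) = emeasure lborel (range f)"
  proof -
    have "emeasure lborel (range F) = emeasure (distr lborel borel ?r) (range F)" by (simp add: distr_reindex[OF q])
    also have "\<dots> = emeasure lborel (?r -` range F)" using Fb by (subst emeasure_distr) auto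
    also have "?r -` range F = range f"
      unfolding rangeF using reindex_inv(2)[OF q] by (auto simp: image_iff) metis
    finally show ?thesis .
  qed
  finally show ?thesis .
qed

section \<open>A transport map onto the cube\<close>

lemma arctan_quadratic_bound:
  fixes a d :: real
  shows "\<bar>arctan (a + d) - arctan a - d / (1 + a\<^sup>2)\<bar> \<le> d\<^sup>2"
proof -
  have pos: "1 + b\<^sup>2 > (0::real)" for b by (simp add: add_pos_nonneg)
  have der: "((\<lambda>t. arctan (a + t) - t / (1 + a\<^sup>2)) has_field_derivative (1 / (1 + (a + t)\<^sup>2) - 1 / (1 + a\<^sup>2))) (at t within {min 0 d..max 0 d})" for t
    using pos[of a] by (auto intro!: derivative_eq_intros simp: inverse_eq_divide)
  have bd: "norm (1 / (1 + (a + t)\<^sup>2) - 1 / (1 + a\<^sup>2)) \<le> \<bar>d\<bar>" if t: "t \<in> {min 0 d..max 0 d}" for t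
  proof -
    let ?b = "a + t"
    have "1 / (1 + ?b\<^sup>2) - 1 / (1 + a\<^sup>2) = - t * (a + ?b) / ((1 + ?b\<^sup>2) * (1 + a\<^sup>2))"
      using pos[of a] pos[of ?b] by (simp add: divide_simps) (simp add: power2_eq_square algebra_simps)
    then have "norm (1 / (1 + ?b\<^sup>2) - 1 / (1 + a\<^sup>2)) = \<bar>t\<bar> * (\<bar>a + ?b\<bar> / ((1 + ?b\<^sup>2) * (1 + a\<^sup>2)))"
      using pos[of a] pos[of ?b] by (simp add: abs_mult)
    also have "\<bar>a + ?b\<bar> / ((1 + ?b\<^sup>2) * (1 + a\<^sup>2)) \<le> 1"
    proof -
      have "\<bar>c\<bar> \<le> (1 + c\<^sup>2) / 2" for c :: real
        using zero_le_power2[of "\<bar>c\<bar> - 1"] by (simp add: power2_eq_square algebra_simps)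
      from this[of a] this[of ?b] have "\<bar>a + ?b\<bar> \<le> (1 + a\<^sup>2) / 2 + (1 + ?b\<^sup>2) / 2" by linarith
      also have "\<dots> \<le> (1 + ?b\<^sup>2) * (1 + a\<^sup>2)"
      proof -
        have "(1 + A) / 2 + (1 + B) / 2 \<le> (1 + B) * (1 + A)" if "0 \<le> A" "0 \<le> B" for A B :: real
        proof -
          have e: "(1 + B) * (1 + A) = 1 + A + B + A * B" by (simp add: algebra_simps)
          define P where "P = A * B"
          have "0 \<le> P" unfolding P_def using that by (rule mult_nonneg_nonneg)
          then show ?thesis unfolding e P_def[symmetric] using that by (simp add: field_simps)
        qed
        then show ?thesis by simp
      qed
      finally show ?thesis using pos[of a] pos[of ?b] by (simp add: divide_le_eq)
    qed
    then have "\<bar>t\<bar> * (\<bar>a + ?b\<bar> / ((1 + ?b\<^sup>2) * (1 + a\<^sup>2))) \<le> \<bar>t\<bar> * 1" by (rule mult_left_mono) simp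
    also have "\<dots> \<le> \<bar>d\<bar>" using t by auto
    finally show ?thesis .
  qed
  have "norm ((arctan (a + d) - d / (1 + a\<^sup>2)) - (arctan (a + 0) - 0 / (1 + a\<^sup>2))) \<le> \<bar>d\<bar> * norm (d - 0)"
    by (rule field_differentiable_bound[OF _ der bd]) auto
  then show ?thesis by (simp add: power2_eq_square abs_mult algebra_simps)
qed

lemma has_derivative_quadratic:
  fixes f :: "'a::real_normed_vector \<Rightarrow> 'b::real_normed_vector"
  assumes L: "bounded_linear L" and q: "\<And>d. norm (f (x + d) - f x - L d) \<le> C * (norm d)\<^sup>2"
  shows "(f has_derivative L) (at x)"
  unfolding has_derivative_at
proof (intro conjI L)
  show "(\<lambda>d. norm (f (x + d) - f x - L d) / norm d) \<midarrow>0\<rightarrow> 0"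
  proof (rule Lim_null_comparison)
    show "\<forall>\<^sub>F d in at 0. norm (norm (f (x + d) - f x - L d) / norm d) \<le> C * norm d"
      using q by (intro always_eventually allI) (auto simp: divide_le_eq power2_eq_square mult.assoc)
    show "((\<lambda>d. C * norm d) \<longlongrightarrow> 0) (at 0)" by (auto intro!: tendsto_eq_intros)
  qed
qed

text \<open>
  Any increasing bijection onto \<open>(-1/2, 1/2)\<close> with a bounded Lipschitz derivative would serve; the range of length \<open>1\<close>
  matches the segments \<open>[- v w / 2, v w / 2]\<close> of which the zonoid is the sum.
\<close>

definition sigmoid :: "real \<Rightarrow> real" where "sigmoid t = arctan t / pi"
definition sigmoid_deriv :: "real \<Rightarrow> real" where "sigmoid_deriv t = 1 / (pi * (1 + t\<^sup>2))"

lemma sigmoid_deriv_pos: "0 < sigmoid_deriv t" "sigmoid_deriv t \<le> 1"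
proof -
  have p: "0 < 1 + t\<^sup>2" by (simp add: add_pos_nonneg)
  then show "0 < sigmoid_deriv t" by (simp add: sigmoid_deriv_def)
  have "1 * 1 \<le> pi * (1 + t\<^sup>2)" using pi_gt3 by (intro mult_mono) auto
  then show "sigmoid_deriv t \<le> 1" using p by (simp add: sigmoid_deriv_def divide_le_eq)
qed

lemma sigmoid_bound: "- (1 / 2) < sigmoid t" "sigmoid t < 1 / 2"
  using arctan_bounded[of t] by (simp_all add: sigmoid_def field_simps)

lemma sigmoid_less_iff: "sigmoid s < sigmoid t \<longleftrightarrow> s < t"
  by (simp add: sigmoid_def divide_less_cancel arctan_less_iff)

lemma sigmoid_quadratic: "\<bar>sigmoid (a + d) - sigmoid a - sigmoid_deriv a * d\<bar> \<le> d\<^sup>2"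
proof -
  have "sigmoid (a + d) - sigmoid a - sigmoid_deriv a * d = (arctan (a + d) - arctan a - d / (1 + a\<^sup>2)) / pi"
    by (simp add: sigmoid_def sigmoid_deriv_def diff_divide_distrib)
  then have "\<bar>sigmoid (a + d) - sigmoid a - sigmoid_deriv a * d\<bar> = \<bar>arctan (a + d) - arctan a - d / (1 + a\<^sup>2)\<bar> / pi"
    by (simp add: abs_divide)
  also have "\<dots> \<le> d\<^sup>2 / 1" using arctan_quadratic_bound[of a d] pi_gt3 by (intro frac_le) auto
  finally show ?thesis by simp
qed

lemma sigmoid_surj:
  assumes "- (1 / 2) < y" "y < 1 / 2"
  obtains t where "sigmoid t = y"
proof -
  have "- (pi / 2) < pi * y" "pi * y < pi / 2"
    using mult_strict_left_mono[OF assms(1) pi_gt_zero] mult_strict_left_mono[OF assms(2) pi_gt_zero] by simp_all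
  then have "arctan (tan (pi * y)) = pi * y" by (intro arctan_tan) auto
  then show ?thesis using that[of "tan (pi * y)"] by (simp add: sigmoid_def)
qed

lemma borel_sigmoid[measurable]: "sigmoid \<in> borel_measurable borel" "sigmoid_deriv \<in> borel_measurable borel"
  unfolding sigmoid_def[abs_def] sigmoid_deriv_def[abs_def] by measurable

text \<open>
  The integrand is the Jacobian of \<open>x \<mapsto> (sigmoid (U $ i \<bullet> x))\<^sub>i\<close>, which maps the space bijectively onto the open cube
  of side \<open>1\<close>.
\<close>

lemma nn_integral_sigmoid_deriv_prod:
  fixes U :: "real^'n::finite^'n"
  assumes U: "det U \<noteq> 0"
  shows "(\<integral>\<^sup>+x. ennreal ((\<Prod>i\<in>UNIV. sigmoid_deriv (U $ i \<bullet> x)) * \<bar>det U\<bar>) \<partial>lborel) = 1"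
proof -
  define P where "P = (\<lambda>x::real^'n. (\<chi> i. sigmoid (U $ i \<bullet> x)))"
  define P' where "P' = (\<lambda>x d::real^'n. (\<chi> i. sigmoid_deriv (U $ i \<bullet> x) * (U $ i \<bullet> d)))"
  define C where "C = (\<Sum>i\<in>UNIV. (norm (U $ i))\<^sup>2)"
  have inv: "invertible U" using U by (simp add: invertible_det_nz)
  have Ux: "(U *v x) $ i = U $ i \<bullet> x" for x i by (simp add: matrix_vector_mult_def inner_vec_def)
  have der: "(P has_derivative P' x) (at x)" for x
  proof (rule has_derivative_quadratic[where C=C])
    have "linear (P' x)" by (rule linearI) (simp_all add: P'_def vec_eq_iff inner_add_right algebra_simps)
    then show "bounded_linear (P' x)" by (simp add: linear_conv_bounded_linear)
    fix d
    have "norm (P (x + d) - P x - P' x d) \<le> (\<Sum>i\<in>UNIV. \<bar>(P (x + d) - P x - P' x d) $ i\<bar>)"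
      by (rule norm_le_l1_cart)
    also have "\<dots> \<le> (\<Sum>i\<in>UNIV. (norm (U $ i))\<^sup>2 * (norm d)\<^sup>2)"
    proof (rule sum_mono)
      fix i
      have "\<bar>(P (x + d) - P x - P' x d) $ i\<bar> \<le> (U $ i \<bullet> d)\<^sup>2"
        using sigmoid_quadratic[of "U $ i \<bullet> x" "U $ i \<bullet> d"] by (simp add: P_def P'_def inner_add_right)
      also have "\<dots> = \<bar>U $ i \<bullet> d\<bar>\<^sup>2" by simp
      also have "\<dots> \<le> (norm (U $ i) * norm d)\<^sup>2" by (intro power_mono Cauchy_Schwarz_ineq2) auto
      finally show "\<bar>(P (x + d) - P x - P' x d) $ i\<bar> \<le> (norm (U $ i))\<^sup>2 * (norm d)\<^sup>2" by (simp add: power_mult_distrib)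
    qed
    finally show "norm (P (x + d) - P x - P' x d) \<le> C * (norm d)\<^sup>2" by (simp add: C_def sum_distrib_right)
  qed
  have "matrix (P' x) = (\<chi> i. sigmoid_deriv (U $ i \<bullet> x) *s U $ i)" for x
    by (simp add: matrix_def P'_def vec_eq_iff inner_axis)
  then have det: "det (matrix (P' x)) = (\<Prod>i\<in>UNIV. sigmoid_deriv (U $ i \<bullet> x)) * det U" for x
    by (simp add: det_rows_mul)
  have range: "range P = box (\<chi> i. - (1/2)) (\<chi> i. 1/2)"
  proof safe
    fix x show "P x \<in> box (\<chi> i. - (1/2)) (\<chi> i. 1/2)"
      using sigmoid_bound by (simp add: mem_box_cart P_def)
  next
    fix y :: "real^'n" assume "y \<in> box (\<chi> i. - (1/2)) (\<chi> i. 1/2)"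
    then have "- (1 / 2) < y $ i" "y $ i < 1 / 2" for i by (auto simp: mem_box_cart)
    then have "\<exists>t. sigmoid t = y $ i" for i using sigmoid_surj by metis
    then obtain t where t: "\<And>i. sigmoid (t i) = y $ i" by metis
    obtain B where B: "U ** B = mat 1" using inv by (auto simp: invertible_def)
    define x where "x = B *v (\<chi> i. t i)"
    have "U *v x = (\<chi> i. t i)" by (simp add: x_def matrix_vector_mul_assoc B)
    then have "U $ i \<bullet> x = t i" for i using Ux[of x i] by simp
    then have "P x = y" by (simp add: P_def vec_eq_iff t)
    then show "y \<in> range P" by auto
  qed
  have "emeasure lborel (range P) = (\<integral>\<^sup>+x. ennreal \<bar>det (matrix (P' x))\<bar> \<partial>lborel)"
  proof (rule emeasure_range_differentiable[OF der])
    show "inj P"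
    proof (rule injI)
      fix x y assume "P x = P y"
      then have "sigmoid (U $ i \<bullet> x) = sigmoid (U $ i \<bullet> y)" for i by (simp add: P_def vec_eq_iff)
      then have "U $ i \<bullet> x = U $ i \<bullet> y" for i using sigmoid_less_iff by (metis less_irrefl linorder_neqE_linordered_idom)
      then have "U *v x = U *v y" by (simp add: vec_eq_iff Ux)
      then show "x = y" using inv inj_matrix_vector_mult by (metis injD)
    qed
    show "bounded (range P)" unfolding range by simp
    show "(\<lambda>x. det (matrix (P' x))) \<in> borel_measurable borel" unfolding det by measurable
  qed
  moreover have "emeasure lborel (range P) = 1"
  proof -
    have "emeasure lborel (box ((\<chi> i. - (1/2))::real^'n) (\<chi> i. 1/2)) = ennreal (\<Prod>b\<in>Basis. ((\<chi> i. 1/2) - (\<chi> i. - (1/2))) \<bullet> (b::real^'n))"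
      by (rule emeasure_lborel_box) (auto simp: Basis_vec_def inner_axis)
    also have "\<dots> = 1" by (simp add: prod_Basis_cart inner_axis)
    finally show ?thesis by (simp add: range)
  qed
  moreover have "\<bar>det (matrix (P' x))\<bar> = (\<Prod>i\<in>UNIV. sigmoid_deriv (U $ i \<bullet> x)) * \<bar>det U\<bar>" for x
    unfolding det abs_mult abs_prod using sigmoid_deriv_pos(1) by (simp add: abs_of_pos)
  ultimately show ?thesis by simp
qed

text \<open>
  Permuting the rows of \<open>A\<close> by \<open>\<tau>\<close> multiplies the determinant by the sign of \<open>\<tau>\<close>; summing over all \<open>\<tau>\<close> gives a sum
  that is symmetric in rows and columns.
\<close>

lemma gram_expansion:
  fixes A :: "real^'n::finite^'n"
  shows "fact CARD('n) * det A = (\<Sum>\<tau> | \<tau> permutes (UNIV::'n set). \<Sum>\<sigma> | \<sigma> permutes (UNIV::'n set).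
     of_int (sign \<tau>) * of_int (sign \<sigma>) * (\<Prod>i\<in>UNIV. A $ \<tau> i $ \<sigma> i))"
    (is "_ = ?S")
proof -
  have "?S = (\<Sum>\<tau> | \<tau> permutes (UNIV::'n set). det A)"
  proof (intro sum.cong refl)
    fix \<tau> assume \<tau>: "\<tau> \<in> {\<tau>. \<tau> permutes (UNIV::'n set)}"
    have "(\<Sum>\<sigma> | \<sigma> permutes (UNIV::'n set). of_int (sign \<tau>) * of_int (sign \<sigma>) * (\<Prod>i\<in>UNIV. A $ \<tau> i $ \<sigma> i))
      = of_int (sign \<tau>) * det (\<chi> i. A $ \<tau> i)"
      by (simp add: det_def sum_distrib_left mult.assoc)
    also have "\<dots> = of_int (sign \<tau>) * (of_int (sign \<tau>) * det A)"
      using det_permute_rows[of \<tau> A] \<tau> by simp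
    also have "\<dots> = det A" using sign_idempotent[of \<tau>] by (simp flip: mult.assoc of_int_mult)
    finally show "(\<Sum>\<sigma> | \<sigma> permutes (UNIV::'n set). of_int (sign \<tau>) * of_int (sign \<sigma>) * (\<Prod>i\<in>UNIV. A $ \<tau> i $ \<sigma> i)) = det A" .
  qed
  also have "\<dots> = fact CARD('n) * det A" by (simp add: card_permutations)
  finally show ?thesis ..
qed

lemma det_mult_expansion:
  fixes a b :: "'n::finite \<Rightarrow> real^'n" and c :: "'n \<Rightarrow> real"
  shows "(\<Prod>i\<in>UNIV. c i) * det (\<chi> i. a i) * det (\<chi> i. b i) = (\<Sum>\<tau> | \<tau> permutes (UNIV::'n set). \<Sum>\<sigma> | \<sigma> permutes (UNIV::'n set).
     of_int (sign \<tau>) * of_int (sign \<sigma>) * (\<Prod>i\<in>UNIV. c i * a i $ \<tau> i * b i $ \<sigma> i))"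
proof -
  have "det (\<chi> i. a i) * det (\<chi> i. b i) = (\<Sum>\<tau> | \<tau> permutes (UNIV::'n set). \<Sum>\<sigma> | \<sigma> permutes (UNIV::'n set).
     (of_int (sign \<tau>) * (\<Prod>i\<in>UNIV. a i $ \<tau> i)) * (of_int (sign \<sigma>) * (\<Prod>i\<in>UNIV. b i $ \<sigma> i)))"
    by (simp only: det_def sum_product vec_lambda_beta)
  then show ?thesis
    unfolding mult.assoc by (simp only: sum_distrib_left) (intro sum.cong refl, simp add: prod.distrib mult_ac)
qed

section \<open>The volume of a zonoid\<close>

text \<open>
  The zonoid generated by \<open>v\<close> is the integral over \<open>M\<close> of the segments \<open>[- v w / 2, v w / 2]\<close>; \<open>supp\<close> is its support
  function. \<open>grad_map\<close> and \<open>hess\<close> are the gradient and the Hessian of the convex function \<open>\<integral> norm (v w) * \<Phi> (u w \<bullet> x)\<close>,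
  where \<open>\<Phi>\<close> is a primitive of the sigmoid.
  The sigmoid is applied to \<open>u w \<bullet> x\<close> and not to \<open>v w \<bullet> x\<close>: this keeps \<open>hess\<close> finite when only the first moment of
  \<open>v\<close> is.
\<close>

locale zonoid = sigma_finite_measure M for M :: "'b measure" +
  fixes v :: "'b \<Rightarrow> real^'n::finite"
  assumes v_int: "integrable M v"
begin

definition u :: "'b \<Rightarrow> real^'n" where "u w = v w /\<^sub>R norm (v w)"
abbreviation supp :: "real^'n \<Rightarrow> real" where "supp x \<equiv> 1 / 2 * (\<integral>w. \<bar>v w \<bullet> x\<bar> \<partial>M)"

definition grad_map :: "real^'n \<Rightarrow> real^'n" where
  "grad_map x = (\<integral>w. sigmoid (u w \<bullet> x) *\<^sub>R v w \<partial>M)"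
definition hess :: "real^'n \<Rightarrow> real^'n^'n" where
  "hess x = (\<chi> i j. \<integral>w. sigmoid_deriv (u w \<bullet> x) * v w $ i * u w $ j \<partial>M)"

lemma v_meas[measurable]: "v \<in> borel_measurable M" using v_int by auto

lemma u_meas[measurable]: "u \<in> borel_measurable M" unfolding u_def[abs_def] by measurable

lemma u_le: "norm (u w) \<le> 1" and v_eq: "norm (v w) *\<^sub>R u w = v w"
  by (cases "v w = 0"; simp add: u_def)+

lemma inner_v: "v w \<bullet> x = norm (v w) * (u w \<bullet> x)"
  by (subst v_eq[symmetric]) (simp only: inner_scaleR_left)

lemma bounded_mult_integrable:
  fixes c :: "'b \<Rightarrow> real"
  assumes [measurable]: "c \<in> borel_measurable M" and "\<And>w. \<bar>c w\<bar> \<le> K"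
  shows "integrable M (\<lambda>w. c w *\<^sub>R v w)"
proof (rule Bochner_Integration.integrable_bound)
  show "integrable M (\<lambda>w. K *\<^sub>R v w)" using v_int by simp
  show "AE w in M. norm (c w *\<^sub>R v w) \<le> norm (K *\<^sub>R v w)"
  proof (intro AE_I2)
    fix w
    have "\<bar>c w\<bar> \<le> \<bar>K\<bar>" using assms(2)[of w] by linarith
    then show "norm (c w *\<^sub>R v w) \<le> norm (K *\<^sub>R v w)" by (simp add: mult_right_mono)
  qed
qed measurable

lemma sig_int: "integrable M (\<lambda>w. sigmoid (u w \<bullet> x) *\<^sub>R v w)"
proof (rule bounded_mult_integrable[where K=1])
  show "\<bar>sigmoid (u w \<bullet> x)\<bar> \<le> 1" for w using sigmoid_bound[of "u w \<bullet> x"] by linarith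
qed measurable

lemma inner_u_le: "\<bar>u w \<bullet> d\<bar> \<le> norm d"
proof -
  have "\<bar>u w \<bullet> d\<bar> \<le> norm (u w) * norm d" by (rule Cauchy_Schwarz_ineq2)
  also have "\<dots> \<le> 1 * norm d" by (intro mult_right_mono u_le) auto
  finally show ?thesis by simp
qed

lemma hess_int: "integrable M (\<lambda>w. (sigmoid_deriv (u w \<bullet> x) * (u w \<bullet> d)) *\<^sub>R v w)"
proof (rule bounded_mult_integrable[where K="norm d"])
  fix w
  have "\<bar>sigmoid_deriv (u w \<bullet> x) * (u w \<bullet> d)\<bar> \<le> 1 * norm d"
    unfolding abs_mult using sigmoid_deriv_pos[of "u w \<bullet> x"] inner_u_le by (intro mult_mono) auto
  then show "\<bar>sigmoid_deriv (u w \<bullet> x) * (u w \<bullet> d)\<bar> \<le> norm d" by simp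
qed measurable

lemma hess_entry_int: "integrable M (\<lambda>w. sigmoid_deriv (u w \<bullet> x) * v w $ i * u w $ j)"
  using integrable_inner_left[OF hess_int[of x "axis j 1"], of "axis i 1"]
  by (simp add: inner_axis mult_ac)

lemma grad_map_derivative: "(grad_map has_derivative ((*v) (hess x))) (at x)"
proof (rule has_derivative_quadratic[where C="\<integral>w. norm (v w) \<partial>M"])
  show "bounded_linear ((*v) (hess x))" by (rule matrix_vector_mul_bounded_linear)
  fix d :: "real^'n"
  let ?r = "\<lambda>w. sigmoid (u w \<bullet> (x + d)) - sigmoid (u w \<bullet> x) - sigmoid_deriv (u w \<bullet> x) * (u w \<bullet> d)"
  have hd: "hess x *v d = (\<integral>w. (sigmoid_deriv (u w \<bullet> x) * (u w \<bullet> d)) *\<^sub>R v w \<partial>M)"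
  proof (rule vec_eq_iff[THEN iffD2], intro allI)
    fix i
    have "(hess x *v d) $ i = (\<Sum>j\<in>UNIV. (\<integral>w. sigmoid_deriv (u w \<bullet> x) * v w $ i * u w $ j \<partial>M) * d $ j)"
      by (simp add: matrix_vector_mult_def hess_def)
    also have "\<dots> = (\<integral>w. (\<Sum>j\<in>UNIV. (sigmoid_deriv (u w \<bullet> x) * v w $ i * u w $ j) * d $ j) \<partial>M)"
      by (subst Bochner_Integration.integral_sum) (simp_all add: hess_entry_int)
    also have "\<dots> = (\<integral>w. ((sigmoid_deriv (u w \<bullet> x) * (u w \<bullet> d)) *\<^sub>R v w) \<bullet> axis i 1 \<partial>M)"
      by (intro Bochner_Integration.integral_cong refl) (simp add: inner_axis inner_vec_def[of "u _"] sum_distrib_left sum_distrib_right mult_ac)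
    also have "\<dots> = (\<integral>w. (sigmoid_deriv (u w \<bullet> x) * (u w \<bullet> d)) *\<^sub>R v w \<partial>M) $ i"
      by (subst integral_inner_left) (use hess_int in \<open>auto simp: inner_axis\<close>)
    finally show "(hess x *v d) $ i = (\<integral>w. (sigmoid_deriv (u w \<bullet> x) * (u w \<bullet> d)) *\<^sub>R v w \<partial>M) $ i" .
  qed
  have diff: "grad_map (x + d) - grad_map x - hess x *v d
    = (\<integral>w. (?r w) *\<^sub>R v w \<partial>M)"
    unfolding grad_map_def hd scaleR_diff_left
    by (simp only: Bochner_Integration.integral_diff[OF Bochner_Integration.integrable_diff[OF sig_int sig_int] hess_int]
      Bochner_Integration.integral_diff[OF sig_int sig_int])
  have "norm (grad_map (x + d) - grad_map x - hess x *v d) \<le> (\<integral>w. norm ((?r w) *\<^sub>R v w) \<partial>M)"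
    unfolding diff by (rule integral_norm_bound)
  also have "\<dots> \<le> (\<integral>w. (norm d)\<^sup>2 * norm (v w) \<partial>M)"
  proof (rule integral_mono')
    show "integrable M (\<lambda>w. (norm d)\<^sup>2 * norm (v w))" by (rule integrable_mult_right[OF integrable_norm[OF v_int]])
    fix w
    have "\<bar>?r w\<bar> \<le> \<bar>u w \<bullet> d\<bar>\<^sup>2"
      unfolding inner_add_right power2_abs by (rule sigmoid_quadratic)
    also have "\<dots> \<le> (norm d)\<^sup>2" by (rule power_mono[OF inner_u_le abs_ge_zero])
    finally show "norm ((?r w) *\<^sub>R v w) \<le> (norm d)\<^sup>2 * norm (v w)"
      unfolding norm_scaleR by (rule mult_right_mono) simp
  qed simp
  also have "\<dots> = (\<integral>w. norm (v w) \<partial>M) * (norm d)\<^sup>2" by simp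
  finally show "norm (grad_map (x + d) - grad_map x - hess x *v d) \<le> (\<integral>w. norm (v w) \<partial>M) * (norm d)\<^sup>2" .
qed

lemma supp_int: "integrable M (\<lambda>w. \<bar>v w \<bullet> x\<bar>)"
  by (rule integrable_abs[OF integrable_inner_left[OF v_int]])

lemma inner_grad_map: "(\<integral>w. (sigmoid (u w \<bullet> z) *\<^sub>R v w) \<bullet> x \<partial>M) = grad_map z \<bullet> x"
  unfolding grad_map_def by (rule integral_inner_left) (rule sig_int)

lemma grad_map_supp: "grad_map z \<bullet> x \<le> supp x"
proof -
  have "grad_map z \<bullet> x = (\<integral>w. (sigmoid (u w \<bullet> z) *\<^sub>R v w) \<bullet> x \<partial>M)"
    by (rule inner_grad_map[symmetric])
  also have "\<dots> \<le> (\<integral>w. 1 / 2 * \<bar>v w \<bullet> x\<bar> \<partial>M)"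
  proof (rule integral_mono)
    show "integrable M (\<lambda>w. (sigmoid (u w \<bullet> z) *\<^sub>R v w) \<bullet> x)" by (rule integrable_inner_left) (rule sig_int)
    show "integrable M (\<lambda>w. 1 / 2 * \<bar>v w \<bullet> x\<bar>)" by (rule integrable_mult_right[OF supp_int])
    fix w
    have "\<bar>sigmoid (u w \<bullet> z)\<bar> \<le> 1 / 2" using sigmoid_bound[of "u w \<bullet> z"] by linarith
    then have "\<bar>sigmoid (u w \<bullet> z) * (v w \<bullet> x)\<bar> \<le> 1 / 2 * \<bar>v w \<bullet> x\<bar>" unfolding abs_mult by (intro mult_right_mono) auto
    then show "(sigmoid (u w \<bullet> z) *\<^sub>R v w) \<bullet> x \<le> 1 / 2 * \<bar>v w \<bullet> x\<bar>" by simp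
  qed
  finally show ?thesis by simp
qed

lemma bounded_grad_map: "bounded (range grad_map)"
proof -
  have "norm (grad_map z) \<le> (\<integral>w. norm (v w) \<partial>M)" for z
  proof -
    have "norm (grad_map z) \<le> (\<integral>w. norm (sigmoid (u w \<bullet> z) *\<^sub>R v w) \<partial>M)"
      unfolding grad_map_def by (rule integral_norm_bound)
    also have "\<dots> \<le> (\<integral>w. norm (v w) \<partial>M)"
    proof (rule integral_mono')
      fix w
      have "\<bar>sigmoid (u w \<bullet> z)\<bar> \<le> 1" using sigmoid_bound[of "u w \<bullet> z"] by linarith
      then have "\<bar>sigmoid (u w \<bullet> z)\<bar> * norm (v w) \<le> 1 * norm (v w)" by (rule mult_right_mono) simp
      then show "norm (sigmoid (u w \<bullet> z) *\<^sub>R v w) \<le> norm (v w)" by simp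
    qed (simp_all add: integrable_norm[OF v_int])
    finally show ?thesis .
  qed
  then show ?thesis unfolding bounded_iff by auto
qed

text \<open>
  Strict monotonicity: \<open>(grad_map x - grad_map y) \<bullet> (x - y)\<close> is the integral of a non-negative function which vanishes
  only where \<open>v w \<bullet> (x - y) = 0\<close>.
\<close>

lemma inj_grad_map:
  assumes pos: "\<And>x. x \<noteq> 0 \<Longrightarrow> supp x \<noteq> 0"
  shows "inj grad_map"
proof (rule injI, rule ccontr)
  fix x y assume eq: "grad_map x = grad_map y" and ne: "x \<noteq> y"
  define I where "I w = (sigmoid (u w \<bullet> x) - sigmoid (u w \<bullet> y)) * (v w \<bullet> (x - y))" for w
  have I: "I w = (sigmoid (u w \<bullet> x) *\<^sub>R v w) \<bullet> (x - y) - (sigmoid (u w \<bullet> y) *\<^sub>R v w) \<bullet> (x - y)" for w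
    by (simp add: I_def algebra_simps)
  have ii: "integrable M (\<lambda>w. (sigmoid (u w \<bullet> z) *\<^sub>R v w) \<bullet> (x - y))" for z
    by (rule integrable_inner_left) (rule sig_int)
  have Iint: "integrable M I" unfolding I by (intro Bochner_Integration.integrable_diff ii)
  have "(\<integral>w. I w \<partial>M) = grad_map x \<bullet> (x - y) - grad_map y \<bullet> (x - y)"
    unfolding I by (subst Bochner_Integration.integral_diff[OF ii ii]) (simp only: inner_grad_map)
  then have zero: "(\<integral>w. I w \<partial>M) = 0" using eq by simp
  have key: "0 \<le> I w \<and> (I w = 0 \<longrightarrow> v w \<bullet> (x - y) = 0)" for w
  proof -
    have vu: "v w \<bullet> (x - y) = norm (v w) * (u w \<bullet> x - u w \<bullet> y)" by (simp add: inner_v inner_diff_right right_diff_distrib)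
    consider "v w = 0" | "v w \<noteq> 0" "u w \<bullet> x = u w \<bullet> y" | "v w \<noteq> 0" "u w \<bullet> x < u w \<bullet> y" | "v w \<noteq> 0" "u w \<bullet> y < u w \<bullet> x" by linarith
    then show ?thesis
    proof cases
      case 3
      then have "sigmoid (u w \<bullet> x) - sigmoid (u w \<bullet> y) < 0" using sigmoid_less_iff by simp
      moreover have "v w \<bullet> (x - y) < 0" unfolding vu using 3 by (intro mult_pos_neg) auto
      ultimately have "0 < I w" unfolding I_def by (rule mult_neg_neg)
      then show ?thesis by simp
    next
      case 4
      then have "0 < sigmoid (u w \<bullet> x) - sigmoid (u w \<bullet> y)" using sigmoid_less_iff by simp
      moreover have "0 < v w \<bullet> (x - y)" unfolding vu using 4 by (intro mult_pos_pos) auto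
      ultimately have "0 < I w" unfolding I_def by (rule mult_pos_pos)
      then show ?thesis by simp
    next
      case 2
      then show ?thesis unfolding I_def vu by simp
    qed (simp add: I_def)
  qed
  have "AE w in M. I w = 0"
    by (rule integral_nonneg_eq_0_iff_AE[THEN iffD1, OF Iint _ zero]) (use key in auto)
  then have "AE w in M. \<bar>v w \<bullet> (x - y)\<bar> = 0"
    by (rule eventually_mono) (use key in auto)
  then have "(\<integral>w. \<bar>v w \<bullet> (x - y)\<bar> \<partial>M) = 0" by (rule integral_eq_zero_AE)
  then show False using pos[of "x - y"] ne by simp
qed

abbreviation PM :: "('n \<Rightarrow> 'b) measure" where "PM \<equiv> (\<Pi>\<^sub>M i\<in>(UNIV::'n set). M)"

lemma PM_product: "product_sigma_finite (\<lambda>_::'n. M)"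
  by standard

abbreviation detv :: "('n \<Rightarrow> 'b) \<Rightarrow> real" where "detv w \<equiv> det (\<chi> i. v (w i))"
abbreviation detu :: "('n \<Rightarrow> 'b) \<Rightarrow> real" where "detu w \<equiv> det (\<chi> i. u (w i))"

text \<open>
  The integrand of the Cauchy-Binet expansion of \<open>det (hess x)\<close>, see \<open>det_hess\<close>.
\<close>

definition cauchy_binet :: "real^'n \<Rightarrow> ('n \<Rightarrow> 'b) \<Rightarrow> real" where
  "cauchy_binet x w = (\<Prod>i\<in>UNIV. sigmoid_deriv (u (w i) \<bullet> x)) * detv w * detu w"

text \<open>
  The vectors \<open>v (w i)\<close> are non-negative multiples of \<open>u (w i)\<close>, so both determinants have the same sign.
\<close>

lemma cauchy_binet_nonneg: "0 \<le> cauchy_binet x w"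
  and cauchy_binet_zero: "detu w = 0 \<longleftrightarrow> detv w = 0"
  and cauchy_binet_abs: "cauchy_binet x w = (\<Prod>i\<in>UNIV. sigmoid_deriv (u (w i) \<bullet> x)) * \<bar>detu w\<bar> * \<bar>detv w\<bar>"
proof -
  have "(\<chi> i. v (w i)) = (\<chi> i. norm (v (w i)) *s u (w i))"
    by (simp add: vec_eq_iff) (metis v_eq vector_scaleR_component real_scaleR_def)
  then have d: "detv w = (\<Prod>i\<in>UNIV. norm (v (w i))) * detu w"
    by (simp add: det_rows_mul)
  have n: "0 \<le> (\<Prod>i\<in>UNIV. norm (v (w i)))" by (simp add: prod_nonneg)
  have s: "0 \<le> (\<Prod>i\<in>UNIV. sigmoid_deriv (u (w i) \<bullet> x))" by (intro prod_nonneg) (simp add: less_imp_le sigmoid_deriv_pos)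
  have "detv w * detu w = \<bar>detu w\<bar> * \<bar>detv w\<bar>"
    unfolding d using n by (simp add: abs_mult mult_ac)
  then show abs: "cauchy_binet x w = (\<Prod>i\<in>UNIV. sigmoid_deriv (u (w i) \<bullet> x)) * \<bar>detu w\<bar> * \<bar>detv w\<bar>"
    unfolding cauchy_binet_def by (simp add: mult.assoc)
  show "0 \<le> cauchy_binet x w" unfolding abs using s by simp
  show "detu w = 0 \<longleftrightarrow> detv w = 0"
  proof
    assume "detv w = 0"
    show "detu w = 0"
    proof (cases "\<exists>i. v (w i) = 0")
      case True
      then obtain i where "v (w i) = 0" ..
      then have "row i (\<chi> i. u (w i)) = 0" by (simp add: row_def u_def vec_eq_iff)
      then show ?thesis by (rule det_zero_row)
    next
      case False
      then have "(\<Prod>i\<in>UNIV. norm (v (w i))) \<noteq> 0" by simp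
      then show ?thesis using d \<open>detv w = 0\<close> by simp
    qed
  qed (simp add: d)
qed

text \<open>
  Each product of entries of \<open>hess x\<close> is a product of integrals over \<open>M\<close>, that is, one integral over the product measure.
\<close>

lemma det_hess:
  shows "integrable PM (cauchy_binet x)" "(\<integral>w. cauchy_binet x w \<partial>PM) = fact CARD('n) * det (hess x)"
proof -
  interpret P: product_sigma_finite "\<lambda>_::'n. M" by (rule PM_product)
  define T where "T \<tau> \<sigma> w = of_int (sign \<tau>) * of_int (sign \<sigma>) * (\<Prod>i\<in>UNIV. sigmoid_deriv (u (w i) \<bullet> x) * v (w i) $ \<tau> i * u (w i) $ \<sigma> i)"
    for \<tau> \<sigma> :: "'n \<Rightarrow> 'n" and w :: "'n \<Rightarrow> 'b"
  have cb: "cauchy_binet x = (\<lambda>w. \<Sum>\<tau> | \<tau> permutes (UNIV::'n set). \<Sum>\<sigma> | \<sigma> permutes (UNIV::'n set). T \<tau> \<sigma> w)"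
    unfolding cauchy_binet_def T_def by (rule ext) (rule det_mult_expansion)
  have Ti: "integrable PM (T \<tau> \<sigma>)" for \<tau> \<sigma>
    unfolding T_def[abs_def]
    by (rule integrable_mult_right[OF P.product_integrable_prod]) (simp, rule hess_entry_int)
  show "integrable PM (cauchy_binet x)"
    unfolding cb by (intro Bochner_Integration.integrable_sum Ti)
  have TI: "(\<integral>w. T \<tau> \<sigma> w \<partial>PM) = of_int (sign \<tau>) * of_int (sign \<sigma>) * (\<Prod>i\<in>UNIV. hess x $ \<tau> i $ \<sigma> i)" for \<tau> \<sigma>
  proof -
    have "(\<integral>w. (\<Prod>i\<in>UNIV. sigmoid_deriv (u (w i) \<bullet> x) * v (w i) $ \<tau> i * u (w i) $ \<sigma> i) \<partial>PM) = (\<Prod>i\<in>UNIV. hess x $ \<tau> i $ \<sigma> i)"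
      by (subst P.product_integral_prod[of UNIV "\<lambda>i w. sigmoid_deriv (u w \<bullet> x) * v w $ \<tau> i * u w $ \<sigma> i"]) (simp, rule hess_entry_int, simp add: hess_def)
    then show ?thesis by (simp add: T_def)
  qed
  have "(\<integral>w. cauchy_binet x w \<partial>PM) = (\<Sum>\<tau> | \<tau> permutes (UNIV::'n set). \<Sum>\<sigma> | \<sigma> permutes (UNIV::'n set). (\<integral>w. T \<tau> \<sigma> w \<partial>PM))"
    unfolding cb by (subst Bochner_Integration.integral_sum, intro Bochner_Integration.integrable_sum Ti, intro sum.cong refl Bochner_Integration.integral_sum Ti)
  also have "\<dots> = fact CARD('n) * det (hess x)" unfolding TI gram_expansion ..
  finally show "(\<integral>w. cauchy_binet x w \<partial>PM) = fact CARD('n) * det (hess x)" .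
qed

lemma det_hess_nn: "(\<integral>\<^sup>+w. ennreal (cauchy_binet x w) \<partial>PM) = ennreal (fact CARD('n) * \<bar>det (hess x)\<bar>)"
proof -
  have "0 \<le> (\<integral>w. cauchy_binet x w \<partial>PM)" using cauchy_binet_nonneg by simp
  then have "0 \<le> det (hess x)" unfolding det_hess(2) by (metis fact_gt_zero zero_le_mult_iff not_le)
  moreover have "(\<integral>\<^sup>+w. ennreal (cauchy_binet x w) \<partial>PM) = ennreal (\<integral>w. cauchy_binet x w \<partial>PM)"
    using cauchy_binet_nonneg by (intro nn_integral_eq_integral det_hess(1)) auto
  ultimately show ?thesis unfolding det_hess(2) by simp
qed

lemma cauchy_binet_measurable: "(\<lambda>(x, w). cauchy_binet x w) \<in> borel_measurable (lborel \<Otimes>\<^sub>M PM)"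
proof -
  have c[measurable]: "(\<lambda>w. v (w i)) \<in> borel_measurable PM" "(\<lambda>w. u (w i)) \<in> borel_measurable PM" for i
    by (auto intro!: measurable_compose[OF measurable_component_singleton])
  have [measurable]: "(\<lambda>p. v (snd p i) $ k) \<in> borel_measurable (lborel \<Otimes>\<^sub>M PM)"
    "(\<lambda>p. u (snd p i) $ k) \<in> borel_measurable (lborel \<Otimes>\<^sub>M PM)" for i k
    unfolding cart_eq_inner_axis by measurable
  show ?thesis unfolding cauchy_binet_def det_def vec_lambda_beta split_beta' by measurable
qed

text \<open>
  Both sides are compared with the integral of \<open>cauchy_binet\<close> over \<open>x\<close> and \<open>w\<close>: integrating first over \<open>x\<close> gives the left side,
  and integrating first over \<open>w\<close> gives \<open>n!\<close> times the Jacobian of \<open>grad_map\<close>, whose range lies in the zonoid.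
\<close>

theorem zonoid_volume:
  assumes pos: "\<And>x. x \<noteq> 0 \<Longrightarrow> supp x \<noteq> 0"
  shows "(\<integral>\<^sup>+w. ennreal \<bar>detv w\<bar> \<partial>PM) \<le> fact CARD('n) * emeasure lborel {y. \<forall>x. x \<bullet> y \<le> supp x}"
proof -
  interpret P: product_sigma_finite "\<lambda>_::'n. M" by (rule PM_product)
  interpret PS: sigma_finite_measure PM by (rule P.sigma_finite) simp
  interpret PP: pair_sigma_finite "lborel :: (real^'n) measure" PM by standard
  have hm: "(\<lambda>x. det (hess x)) \<in> borel_measurable borel"
  proof -
    have "(\<lambda>x. (\<integral>w. cauchy_binet x w \<partial>PM) / fact CARD('n)) \<in> borel_measurable lborel"
      by (intro borel_measurable_divide PS.borel_measurable_lebesgue_integral cauchy_binet_measurable) simp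
    then show ?thesis unfolding det_hess(2) by simp
  qed
  have "(\<integral>\<^sup>+w. ennreal \<bar>detv w\<bar> \<partial>PM) = (\<integral>\<^sup>+w. \<integral>\<^sup>+x. ennreal (cauchy_binet x w) \<partial>lborel \<partial>PM)"
  proof (rule nn_integral_cong)
    fix w
    show "ennreal \<bar>detv w\<bar> = (\<integral>\<^sup>+x. ennreal (cauchy_binet x w) \<partial>lborel)"
    proof (cases "detu w = 0")
      case True
      then show ?thesis using cauchy_binet_zero[of w] by (simp add: cauchy_binet_def)
    next
      case False
      have [simp]: "0 \<le> (\<Prod>i\<in>UNIV. sigmoid_deriv (u (w i) \<bullet> x)) * \<bar>detu w\<bar>" for x
        by (intro mult_nonneg_nonneg prod_nonneg) (simp_all add: less_imp_le sigmoid_deriv_pos)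
      have "(\<integral>\<^sup>+x. ennreal (cauchy_binet x w) \<partial>lborel) = (\<integral>\<^sup>+x. ennreal ((\<Prod>i\<in>UNIV. sigmoid_deriv (u (w i) \<bullet> x)) * \<bar>detu w\<bar>) * ennreal \<bar>detv w\<bar> \<partial>lborel)"
        unfolding cauchy_binet_abs by (intro nn_integral_cong ennreal_mult) simp_all
      also have "\<dots> = (\<integral>\<^sup>+x. ennreal ((\<Prod>i\<in>UNIV. sigmoid_deriv (u (w i) \<bullet> x)) * \<bar>detu w\<bar>) \<partial>lborel) * ennreal \<bar>detv w\<bar>"
        by (rule nn_integral_multc) measurable
      also have "\<dots> = ennreal \<bar>detv w\<bar>"
        using nn_integral_sigmoid_deriv_prod[OF False] by simp
      finally show ?thesis ..
    qed
  qed
  also have "\<dots> = (\<integral>\<^sup>+x. \<integral>\<^sup>+w. ennreal (cauchy_binet x w) \<partial>PM \<partial>lborel)"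
    by (rule PP.Fubini') (use cauchy_binet_measurable in \<open>simp add: split_beta'\<close>)
  also have "\<dots> = (\<integral>\<^sup>+x. fact CARD('n) * ennreal \<bar>det (hess x)\<bar> \<partial>lborel)"
    unfolding det_hess_nn by (simp add: ennreal_mult ennreal_fact)
  also have "\<dots> = fact CARD('n) * (\<integral>\<^sup>+x. ennreal \<bar>det (hess x)\<bar> \<partial>lborel)"
    using hm by (intro nn_integral_cmult) simp
  also have "(\<integral>\<^sup>+x. ennreal \<bar>det (hess x)\<bar> \<partial>lborel) = emeasure lborel (range grad_map)"
    using emeasure_range_differentiable[OF grad_map_derivative inj_grad_map[OF pos] bounded_grad_map] hm by simp
  also have "\<dots> \<le> emeasure lborel {y. \<forall>x. x \<bullet> y \<le> supp x}"
  proof (rule emeasure_mono)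
    show "range grad_map \<subseteq> {y. \<forall>x. x \<bullet> y \<le> supp x}" using grad_map_supp by (auto simp: inner_commute)
    have "closed {y. \<forall>x. x \<bullet> y \<le> supp x}"
      by (intro closed_Collect_all closed_Collect_le continuous_intros)
    then show "{y. \<forall>x. x \<bullet> y \<le> supp x} \<in> sets lborel" by (simp add: borel_closed)
  qed
  finally show ?thesis by (simp add: mult_left_mono)
qed

end

section \<open>Volume in polar coordinates\<close>

text \<open>
  For \<open>x \<noteq> 0\<close> the integral of \<open>d * t ^ (d - 1) * norm x ^ d\<close> over \<open>0 < t < 1 / norm x\<close> is \<open>1\<close>. Inserting it and
  substituting \<open>x\<close> by \<open>x / t\<close> exchanges the unit ball of \<open>h\<close> for that of the norm.
\<close>

lemma emeasure_gauge_ball: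
  fixes h :: "'a::euclidean_space \<Rightarrow> real"
  assumes [measurable]: "h \<in> borel_measurable borel" and pos: "\<And>x. x \<noteq> 0 \<Longrightarrow> 0 < h x"
    and hom: "\<And>t x. 0 < t \<Longrightarrow> h (t *\<^sub>R x) = t * h x"
  shows "emeasure lborel {x. h x \<le> 1} = (\<integral>\<^sup>+x. ennreal ((norm x / h x) ^ DIM('a)) * indicator (ball 0 1 - {0}) x \<partial>lborel)"
proof -
  define d where "d = DIM('a)"
  have d: "d > 0" by (simp add: d_def)
  have in1: "(\<integral>\<^sup>+t. ennreal (real d * t ^ (d - 1)) * indicator {0<..<b} t \<partial>lborel) = ennreal (b ^ d)" if "0 < b" for b :: real
  proof -
    have "(\<integral>\<^sup>+t. ennreal (real d * t ^ (d - 1)) * indicator {0<..<b} t \<partial>lborel) = (\<integral>\<^sup>+t. ennreal (real d * t ^ (d - 1)) * indicator {0..b} t \<partial>lborel)"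
    proof (rule nn_integral_cong_AE)
      have "AE t in lborel. t \<noteq> (0::real)" "AE t in lborel. t \<noteq> b" by (rule AE_lborel_singleton)+
      then show "AE t in lborel. ennreal (real d * t ^ (d - 1)) * indicator {0<..<b} t = ennreal (real d * t ^ (d - 1)) * indicator {0..b} t"
        by eventually_elim (simp add: indicator_def less_le)
    qed
    also have "\<dots> = ennreal (b ^ d - 0 ^ d)"
      using that by (intro nn_integral_FTC_Icc) (auto intro!: derivative_eq_intros)
    finally show ?thesis using d by (simp add: zero_power)
  qed
  have in2: "(\<integral>\<^sup>+t. ennreal (real d / t ^ (d + 1)) * indicator {a..} t \<partial>lborel) = ennreal (1 / a ^ d)" if a: "0 < a" for a :: real
  proof -
    have "(\<integral>\<^sup>+t. ennreal (real d / t ^ (d + 1)) * indicator {a..} t \<partial>lborel) = ennreal (0 - (- (1 / a ^ d)))"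
    proof (rule nn_integral_FTC_atLeast)
      have "((\<lambda>t::real. inverse (t ^ d)) \<longlongrightarrow> 0) at_top"
        by (intro tendsto_inverse_0_at_top filterlim_pow_at_top d filterlim_ident)
      from tendsto_minus[OF this] show "((\<lambda>t::real. - (1 / t ^ d)) \<longlongrightarrow> 0) at_top"
        by (simp add: inverse_eq_divide)
      show "((\<lambda>t. - (1 / t ^ d)) has_real_derivative real d / t ^ (d + 1)) (at t)" if "a \<le> t" for t
      proof -
        have t: "t \<noteq> 0" using that a by auto
        have e: "t ^ (d - 1) * t = t ^ d" using d by (simp add: power_eq_if)
        have "((\<lambda>t. - (1 / t ^ d)) has_real_derivative real d * t ^ (d - 1) / (t ^ d * t ^ d)) (at t)"
          using t by (auto intro!: derivative_eq_intros simp: power2_eq_square)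
        moreover have "real d * t ^ (d - 1) / (t ^ d * t ^ d) = real d / t ^ (d + 1)"
          using t by (simp add: divide_simps flip: e)
        ultimately show ?thesis by simp
      qed
      show "0 \<le> real d / t ^ (d + 1)" if "a \<le> t" for t using that a by simp
    qed measurable
    then show ?thesis by simp
  qed
  have nz: "AE x in lborel. x \<noteq> (0::'a)" by (rule AE_lborel_singleton)
  let ?G = "\<lambda>x t. (indicator {x. h x \<le> 1} x * ennreal (norm x ^ d)) * (ennreal (real d * t ^ (d - 1)) * (indicator {0<..} t * indicator {..<1} (t * norm x)))"
  let ?H = "\<lambda>x t. (ennreal (norm x ^ d) * indicator {..<1} (norm x)) * (ennreal (real d / t ^ (d + 1)) * (indicator {0<..} t * indicator {..0} (h x - t)))"
  have "emeasure lborel {x. h x \<le> 1} = (\<integral>\<^sup>+x. indicator {x. h x \<le> 1} x \<partial>lborel)" by simp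
  also have "\<dots> = (\<integral>\<^sup>+x. \<integral>\<^sup>+t. ?G x t \<partial>lborel \<partial>lborel)"
  proof (rule nn_integral_cong_AE, use nz in eventually_elim)
    fix x :: 'a assume x: "x \<noteq> 0"
    have "(\<integral>\<^sup>+t. ?G x t \<partial>lborel) = (indicator {x. h x \<le> 1} x * ennreal (norm x ^ d)) * (\<integral>\<^sup>+t. ennreal (real d * t ^ (d - 1)) * (indicator {0<..} t * indicator {..<1} (t * norm x)) \<partial>lborel)"
      by (rule nn_integral_cmult) measurable
    also have "(\<integral>\<^sup>+t. ennreal (real d * t ^ (d - 1)) * (indicator {0<..} t * indicator {..<1} (t * norm x)) \<partial>lborel)
      = (\<integral>\<^sup>+t. ennreal (real d * t ^ (d - 1)) * indicator {0<..<1 / norm x} t \<partial>lborel)"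
      using x by (intro nn_integral_cong) (simp add: indicator_def pos_less_divide_eq)
    also have "\<dots> = ennreal ((1 / norm x) ^ d)" using x by (intro in1) simp
    also have "(indicator {x. h x \<le> 1} x * ennreal (norm x ^ d)) * ennreal ((1 / norm x) ^ d) = indicator {x. h x \<le> 1} x"
      using x by (simp add: mult.assoc ennreal_mult[symmetric] power_one_over)
    finally show "indicator {x. h x \<le> 1} x = (\<integral>\<^sup>+t. ?G x t \<partial>lborel)" ..
  qed
  also have "\<dots> = (\<integral>\<^sup>+t. \<integral>\<^sup>+x. ?G x t \<partial>lborel \<partial>lborel)"
    by (rule lborel_pair.Fubini'[symmetric]) measurable
  also have "\<dots> = (\<integral>\<^sup>+t. \<integral>\<^sup>+x. ?H x t \<partial>lborel \<partial>lborel)"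
  proof (rule nn_integral_cong)
    fix t :: real
    show "(\<integral>\<^sup>+x. ?G x t \<partial>lborel) = (\<integral>\<^sup>+x. ?H x t \<partial>lborel)"
    proof (cases "0 < t")
      case t: True
      have "(\<integral>\<^sup>+x. ?G x t \<partial>lborel) = ennreal (\<bar>1 / t\<bar> ^ DIM('a)) * (\<integral>\<^sup>+x. ?G ((1 / t) *\<^sub>R x) t \<partial>lborel)"
        using t by (intro nn_integral_lborel_scaleR) auto
      also have "\<dots> = (\<integral>\<^sup>+x. ennreal (\<bar>1 / t\<bar> ^ DIM('a)) * ?G ((1 / t) *\<^sub>R x) t \<partial>lborel)"
        by (rule nn_integral_cmult[symmetric]) measurable
      also have "\<dots> = (\<integral>\<^sup>+x. ?H x t \<partial>lborel)"
      proof (rule nn_integral_cong)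
        fix x :: 'a
        have i1: "indicator {x. h x \<le> 1} ((1 / t) *\<^sub>R x) = ((indicator {0<..} t * indicator {..0} (h x - t)) :: ennreal)"
          using t by (simp add: indicator_def hom field_simps)
        have i2: "(indicator {0<..} t * indicator {..<1} (t * norm ((1 / t) *\<^sub>R x))) = (indicator {..<1} (norm x) :: ennreal)"
          using t by (simp add: indicator_def)
        have "(1 / t) ^ d * ((1 / t * norm x) ^ d * (real d * t ^ (d - 1))) = norm x ^ d * (real d / t ^ (d + 1))"
        proof -
          have e: "t ^ (d - 1) * t = t ^ d" using d by (simp add: power_eq_if)
          show ?thesis using t by (simp add: power_mult_distrib power_one_over divide_simps) (simp add: mult_ac flip: e)
        qed
        then have r: "ennreal (\<bar>1 / t\<bar> ^ DIM('a)) * (ennreal (norm ((1 / t) *\<^sub>R x) ^ d) * ennreal (real d * t ^ (d - 1))) = ennreal (norm x ^ d) * ennreal (real d / t ^ (d + 1))"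
          using t by (simp add: ennreal_mult[symmetric] d_def[symmetric])
        show "ennreal (\<bar>1 / t\<bar> ^ DIM('a)) * ?G ((1 / t) *\<^sub>R x) t = ?H x t"
          unfolding i1 i2 using arg_cong[OF r, of "\<lambda>z. z * (indicator {..<1} (norm x) * (indicator {0<..} t * indicator {..0} (h x - t)))"]
          by (simp only: mult_ac)
      qed
      finally show ?thesis .
    qed simp
  qed
  also have "\<dots> = (\<integral>\<^sup>+x. \<integral>\<^sup>+t. ?H x t \<partial>lborel \<partial>lborel)"
    by (rule lborel_pair.Fubini') measurable
  also have "\<dots> = (\<integral>\<^sup>+x. ennreal ((norm x / h x) ^ DIM('a)) * indicator (ball 0 1 - {0}) x \<partial>lborel)"
  proof (rule nn_integral_cong_AE, use nz in eventually_elim)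
    fix x :: 'a assume x: "x \<noteq> 0"
    have hx: "0 < h x" by (rule pos[OF x])
    have "(\<integral>\<^sup>+t. ?H x t \<partial>lborel)
      = (ennreal (norm x ^ d) * indicator {..<1} (norm x)) * (\<integral>\<^sup>+t. ennreal (real d / t ^ (d + 1)) * (indicator {0<..} t * indicator {..0} (h x - t)) \<partial>lborel)"
      by (rule nn_integral_cmult) measurable
    also have "(\<integral>\<^sup>+t. ennreal (real d / t ^ (d + 1)) * (indicator {0<..} t * indicator {..0} (h x - t)) \<partial>lborel)
      = (\<integral>\<^sup>+t. ennreal (real d / t ^ (d + 1)) * indicator {h x..} t \<partial>lborel)"
      using hx by (intro nn_integral_cong) (auto simp: indicator_def)
    also have "\<dots> = ennreal (1 / h x ^ d)" by (rule in2[OF hx])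
    also have "(ennreal (norm x ^ d) * indicator {..<1} (norm x)) * ennreal (1 / h x ^ d) = (ennreal (norm x ^ d) * ennreal (1 / h x ^ d)) * indicator (ball 0 1 - {0}) x"
      using x by (simp add: indicator_def)
    also have "ennreal (norm x ^ d) * ennreal (1 / h x ^ d) = ennreal ((norm x / h x) ^ DIM('a))"
      using hx by (simp add: ennreal_mult[symmetric] power_divide d_def)
    finally show "(\<integral>\<^sup>+t. ?H x t \<partial>lborel)
      = ennreal ((norm x / h x) ^ DIM('a)) * indicator (ball 0 1 - {0}) x" .
  qed
  finally show ?thesis .
qed

text \<open>
  By definition of the surface measure the left side is an integral over the punctured unit ball of a function that is
  constant on rays.
\<close>

lemma integral_sphere_surface_powr:
  fixes h :: "real^'n::finite \<Rightarrow> real"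
  assumes h[measurable]: "h \<in> borel_measurable borel" and pos: "\<And>x. x \<noteq> 0 \<Longrightarrow> 0 < h x"
    and hom: "\<And>t x. 0 < t \<Longrightarrow> h (t *\<^sub>R x) = t * h x"
  shows "(LINT \<xi>|sphere_surface. h \<xi> powr (- real CARD('n))) = real CARD('n) * measure lborel {x. h x \<le> 1}"
proof -
  let ?n = "CARD('n)"
  let ?R = "restrict_space borel (sphere (0::real^'n) 1)"
  let ?B = "restrict_space lborel (ball (0::real^'n) 1 - {0})"
  have m: "(\<lambda>\<xi>. h \<xi> powr (- real ?n)) \<in> borel_measurable ?R"
    by (rule measurable_restrict_space1) measurable
  have "(LINT \<xi>|sphere_surface. h \<xi> powr (- real ?n)) = enn2real (\<integral>\<^sup>+\<xi>. ennreal (h \<xi> powr (- real ?n)) \<partial>sphere_surface)"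
    using m by (intro integral_eq_nn_integral) (auto simp: measurable_cong_sets[OF sets_sphere_surface refl])
  also have "(\<integral>\<^sup>+\<xi>. ennreal (h \<xi> powr (- real ?n)) \<partial>sphere_surface)
     = of_nat ?n * (\<integral>\<^sup>+\<xi>. ennreal (h \<xi> powr (- real ?n)) \<partial>distr ?B ?R (\<lambda>x. x /\<^sub>R norm x))"
    unfolding sphere_surface_def using m by (subst nn_integral_scale_measure) auto
  also have "(\<integral>\<^sup>+\<xi>. ennreal (h \<xi> powr (- real ?n)) \<partial>distr ?B ?R (\<lambda>x. x /\<^sub>R norm x))
     = (\<integral>\<^sup>+x. ennreal (h (x /\<^sub>R norm x) powr (- real ?n)) \<partial>?B)"
    using measurable_compose[OF m measurable_ennreal] by (intro nn_integral_distr measurable_radial_projection) simp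
  also have "\<dots> = (\<integral>\<^sup>+x. ennreal (h (x /\<^sub>R norm x) powr (- real ?n)) * indicator (ball 0 1 - {0}) x \<partial>lborel)"
    by (rule nn_integral_restrict_space) simp
  also have "\<dots> = (\<integral>\<^sup>+x. ennreal ((norm x / h x) ^ DIM(real^'n)) * indicator (ball 0 1 - {0}) x \<partial>lborel)"
  proof (rule nn_integral_cong)
    fix x :: "real^'n"
    show "ennreal (h (x /\<^sub>R norm x) powr (- real ?n)) * indicator (ball 0 1 - {0}) x = ennreal ((norm x / h x) ^ DIM(real^'n)) * indicator (ball 0 1 - {0}) x"
    proof (cases "x = 0")
      case False
      then have "h (x /\<^sub>R norm x) = h x / norm x" by (simp add: hom divide_inverse mult.commute)
      moreover have "0 < h x / norm x" using False pos by simp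
      ultimately have "h (x /\<^sub>R norm x) powr (- real ?n) = (norm x / h x) ^ DIM(real^'n)"
        by (simp add: powr_minus powr_realpow power_divide inverse_eq_divide)
      then show ?thesis by simp
    qed simp
  qed
  also have "\<dots> = emeasure lborel {x. h x \<le> 1}"
    by (rule emeasure_gauge_ball[symmetric]) (auto simp: pos hom)
  finally show ?thesis by (simp add: enn2real_mult measure_def)
qed

section \<open>The volume product of a zonoid and its polar\<close>

context zonoid
begin

lemma supp_Lipschitz: "\<bar>supp x - supp y\<bar> \<le> (\<integral>w. norm (v w) \<partial>M) * norm (x - y)"
proof -
  have "supp x - supp y = (\<integral>w. 1 / 2 * (\<bar>v w \<bullet> x\<bar> - \<bar>v w \<bullet> y\<bar>) \<partial>M)"
    using supp_int[of x] supp_int[of y] by (simp add: right_diff_distrib)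
  also have "\<bar>\<dots>\<bar> \<le> (\<integral>w. \<bar>1 / 2 * (\<bar>v w \<bullet> x\<bar> - \<bar>v w \<bullet> y\<bar>)\<bar> \<partial>M)" by (rule integral_abs_bound)
  also have "\<dots> \<le> (\<integral>w. norm (v w) * norm (x - y) \<partial>M)"
  proof (rule integral_mono')
    fix w
    have "\<bar>\<bar>v w \<bullet> x\<bar> - \<bar>v w \<bullet> y\<bar>\<bar> \<le> \<bar>v w \<bullet> (x - y)\<bar>" by (simp add: inner_diff_right)
    also have "\<dots> \<le> norm (v w) * norm (x - y)" by (rule Cauchy_Schwarz_ineq2)
    finally show "\<bar>1 / 2 * (\<bar>v w \<bullet> x\<bar> - \<bar>v w \<bullet> y\<bar>)\<bar> \<le> norm (v w) * norm (x - y)" by (simp add: abs_mult)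
  qed (auto intro!: integrable_mult_left integrable_norm v_int)
  finally show ?thesis by simp
qed

lemma supp_scale: "0 < t \<Longrightarrow> supp (t *\<^sub>R x) = t * supp x"
  by (simp add: abs_mult)

lemma continuous_supp: "continuous_on UNIV supp"
proof (rule lipschitz_on_continuous_on)
  show "(\<integral>w. norm (v w) \<partial>M)-lipschitz_on UNIV supp"
    using supp_Lipschitz by (intro lipschitz_onI) (auto simp: dist_norm)
qed

lemma supp_coercive:
  assumes pos: "\<And>x. x \<noteq> 0 \<Longrightarrow> supp x \<noteq> 0"
  obtains c where "c > 0" "\<And>x. c * norm x \<le> supp x"
proof -
  have s: "sphere (0::real^'n) 1 \<noteq> {}" by auto
  obtain x0 where x0: "x0 \<in> sphere 0 1" "\<And>x. x \<in> sphere 0 1 \<Longrightarrow> supp x0 \<le> supp x"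
    using continuous_attains_inf[OF compact_sphere s continuous_on_subset[OF continuous_supp]] by auto
  have "x0 \<noteq> 0" using x0 by auto
  moreover have "0 \<le> supp x0" by simp
  ultimately have c: "0 < supp x0" using pos[of x0] by linarith
  show ?thesis
  proof (rule that[OF c])
    fix x
    show "supp x0 * norm x \<le> supp x"
    proof (cases "x = 0")
      case False
      have "supp x0 \<le> supp ((1 / norm x) *\<^sub>R x)" by (rule x0(2)) (use False in simp)
      also have "\<dots> = (1 / norm x) * supp x" by (rule supp_scale) (use False in simp)
      finally show ?thesis using False by (simp add: field_simps)
    qed simp
  qed
qed

text \<open>
  Where the determinant does not vanish, some \<open>v (w i)\<close> is not orthogonal to \<open>\<xi>\<close>. The integrand is therefore bounded by a
  sum of products of functions of one \<open>w j\<close> each, and every product has a factor with integral \<open>0\<close>.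
\<close>

lemma degenerate_zero:
  assumes "\<xi> \<noteq> 0" "supp \<xi> = 0"
  shows "(\<integral>\<^sup>+w. ennreal \<bar>detv w\<bar> \<partial>PM) = 0"
proof -
  interpret P: product_sigma_finite "\<lambda>_::'n. M" by (rule PM_product)
  have "(\<integral>w. \<bar>v w \<bullet> \<xi>\<bar> \<partial>M) = 0" using assms(2) by simp
  then have ae: "AE w in M. \<bar>v w \<bullet> \<xi>\<bar> = 0"
    by (rule integral_nonneg_eq_0_iff_AE[THEN iffD1, OF supp_int, rotated]) simp
  define F where "F i j b = (if j = i then (if v b \<bullet> \<xi> = 0 then 0 else top) else (1::ennreal))" for i j :: 'n and b
  have Fm[measurable]: "F i j \<in> borel_measurable M" for i j unfolding F_def[abs_def] by measurable
  have F0: "(\<integral>\<^sup>+b. F i i b \<partial>M) = 0" for i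
    using ae by (subst nn_integral_0_iff_AE) (auto simp: F_def)
  have "(\<integral>\<^sup>+w. ennreal \<bar>detv w\<bar> \<partial>PM) \<le> (\<integral>\<^sup>+w. (\<Sum>i\<in>UNIV. \<Prod>j\<in>UNIV. F i j (w j)) \<partial>PM)"
  proof (rule nn_integral_mono)
    fix w
    show "ennreal \<bar>detv w\<bar> \<le> (\<Sum>i\<in>UNIV. \<Prod>j\<in>UNIV. F i j (w j))"
    proof (cases "\<exists>i. v (w i) \<bullet> \<xi> \<noteq> 0")
      case True
      then obtain i where i: "v (w i) \<bullet> \<xi> \<noteq> 0" ..
      have "(\<Prod>j\<in>UNIV. F i j (w j)) = F i i (w i) * (\<Prod>j\<in>UNIV - {i}. F i j (w j))"
        by (rule prod.remove) auto
      also have "(\<Prod>j\<in>UNIV - {i}. F i j (w j)) = 1" by (rule prod.neutral) (simp add: F_def)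
      finally have P: "(\<Prod>j\<in>UNIV. F i j (w j)) = top" using i by (simp add: F_def)
      have L: "(\<Prod>j\<in>UNIV. F i j (w j)) \<le> (\<Sum>i\<in>UNIV. \<Prod>j\<in>UNIV. F i j (w j))"
        by (rule member_le_sum) auto
      show ?thesis by (rule order_trans[OF top_greatest L[unfolded P]])
    next
      case False
      then have "(\<chi> i. v (w i)) *v \<xi> = 0" by (simp add: vec_eq_iff matrix_vector_mult_def inner_vec_def)
      then have "\<not> invertible (\<chi> i. v (w i))" using assms(1)
        by (metis inj_matrix_vector_mult injD matrix_vector_mult_0_right)
      then show ?thesis by (simp add: invertible_det_nz)
    qed
  qed
  also have "\<dots> = (\<Sum>i\<in>UNIV. \<integral>\<^sup>+w. (\<Prod>j\<in>UNIV. F i j (w j)) \<partial>PM)"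
    by (rule nn_integral_sum) measurable
  also have "\<dots> = (\<Sum>i\<in>UNIV. \<Prod>j\<in>UNIV. \<integral>\<^sup>+b. F i j b \<partial>M)"
    by (intro sum.cong refl P.product_nn_integral_prod) auto
  also have "\<dots> = 0" using F0 by (intro sum.neutral ballI prod_zero) auto
  finally show ?thesis by simp
qed

lemma det_measurable: "(\<lambda>w. \<bar>detv w\<bar>) \<in> borel_measurable PM"
proof -
  have c: "(\<lambda>w. v (w i)) \<in> borel_measurable PM" for i
    by (auto intro!: measurable_compose[OF measurable_component_singleton])
  have [measurable]: "(\<lambda>w. v (w i) $ k) \<in> borel_measurable PM" for i k
    unfolding cart_eq_inner_axis using c by measurable
  show ?thesis unfolding det_def vec_lambda_beta by measurable
qed

theorem zonoid_polar_inequality: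
  "(1 / real CARD('n) * (LINT \<xi>|sphere_surface. supp \<xi> powr (- real CARD('n)))) powr (- 1 / real CARD('n))
    \<ge> (1 / ((ball_volume TYPE('n))\<^sup>2 * fact CARD('n)) * (\<integral>w. \<bar>detv w\<bar> \<partial>PM)) powr (1 / real CARD('n))"
proof -
  let ?n = "CARD('n)"
  let ?W = "1 / ((ball_volume TYPE('n))\<^sup>2 * fact ?n) * (\<integral>w. \<bar>detv w\<bar> \<partial>PM)"
  have I: "(\<integral>w. \<bar>detv w\<bar> \<partial>PM) = enn2real (\<integral>\<^sup>+w. ennreal \<bar>detv w\<bar> \<partial>PM)"
    using det_measurable by (intro integral_eq_nn_integral) auto
  show ?thesis
  proof (cases "\<exists>\<xi>. \<xi> \<noteq> 0 \<and> supp \<xi> = 0")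
    case True
    then show ?thesis unfolding I using degenerate_zero by auto
  next
    case False
    then have pos: "\<And>x. x \<noteq> 0 \<Longrightarrow> supp x \<noteq> 0" by blast
    obtain c where c: "c > 0" "\<And>x. c * norm x \<le> supp x" using supp_coercive[OF pos] by blast
    have sm: "supp \<in> borel_measurable borel" by (intro borel_measurable_continuous_onI continuous_supp)
    have sp: "0 < supp x" if "x \<noteq> 0" for x
      using c(2)[of x] c(1) that by (meson less_le_trans mult_pos_pos zero_less_norm_iff)
    let ?K = "{x. supp x \<le> 1}"
    define V where "V = measure lborel ?K"
    have Kfin: "emeasure lborel ?K < \<infinity>"
    proof (rule emeasure_bounded_finite)
      have "norm x \<le> 1 / c" if "x \<in> ?K" for x using c(2)[of x] that c(1) by (simp add: field_simps)
      then show "bounded ?K" unfolding bounded_iff by blast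
    qed
    have Kpos: "0 < emeasure lborel ?K"
    proof -
      define C where "C = (\<integral>w. norm (v w) \<partial>M) + 1"
      have C: "C \<ge> 1" by (simp add: C_def)
      have "0 < emeasure lborel (ball (0::real^'n) (1 / C))" using C by (simp add: emeasure_ball)
      also have "\<dots> \<le> emeasure lborel ?K"
      proof (rule emeasure_mono)
        show "ball 0 (1 / C) \<subseteq> ?K"
        proof
          fix x :: "real^'n" assume x: "x \<in> ball 0 (1 / C)"
          have "supp x \<le> (\<integral>w. norm (v w) \<partial>M) * norm x" using supp_Lipschitz[of x 0] by simp
          also have "\<dots> \<le> C * norm x" by (intro mult_right_mono) (simp_all add: C_def)
          also have "\<dots> \<le> 1" using x C by (simp add: field_simps)
          finally show "x \<in> ?K" by simp
        qed
        show "?K \<in> sets lborel" using sm by simp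
      qed
      finally show ?thesis .
    qed
    have V: "V > 0" unfolding V_def measure_def using Kfin Kpos by (simp add: enn2real_positive_iff)
    have surf: "(LINT \<xi>|sphere_surface. supp \<xi> powr (- real ?n)) = real ?n * V"
      unfolding V_def by (rule integral_sphere_surface_powr[OF sm sp supp_scale])
    let ?N = "\<integral>\<^sup>+w. ennreal \<bar>detv w\<bar> \<partial>PM"
    let ?\<omega> = "emeasure lborel (cball (0::real^'n) 1)"
    have "emeasure lborel ?K * ?N \<le> emeasure lborel ?K * (fact ?n * emeasure lborel {y. \<forall>x. x \<bullet> y \<le> supp x})"
      by (intro mult_left_mono zonoid_volume[OF pos]) auto
    also have "\<dots> = fact ?n * (emeasure lborel ?K * emeasure lborel {y. \<forall>x. x \<bullet> y \<le> supp x})" by (simp only: mult_ac)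
    also have "\<dots> \<le> fact ?n * ?\<omega>\<^sup>2"
      by (intro mult_left_mono blaschke_santalo[OF sm c supp_scale]) auto
    finally have le: "emeasure lborel ?K * ?N \<le> fact ?n * ?\<omega>\<^sup>2" .
    have wfin: "?\<omega> < top" using emeasure_lborel_cball_finite[of "0::real^'n" 1] by simp
    have "enn2real (emeasure lborel ?K * ?N) \<le> enn2real (fact ?n * ?\<omega>\<^sup>2)"
      by (rule enn2real_mono[OF le]) (use wfin in \<open>simp add: ennreal_mult_less_top power_less_top_ennreal flip: ennreal_fact\<close>)
    then have main: "V * (\<integral>w. \<bar>detv w\<bar> \<partial>PM) \<le> fact ?n * (ball_volume TYPE('n))\<^sup>2"
      unfolding I V_def ball_volume_def measure_def by (simp add: enn2real_mult power2_eq_square flip: ennreal_fact)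
    have w: "0 < ball_volume TYPE('n)"
    proof -
      have "0 < measure lborel (ball (0::real^'n) 1)" by (simp add: content_ball)
      also have "\<dots> \<le> measure lborel (cball (0::real^'n) 1)"
        by (intro measure_mono_fmeasurable ball_subset_cball) (auto intro: fmeasurable_compact)
      finally show ?thesis by (simp add: ball_volume_def)
    qed
    have "?W \<le> 1 / V"
      using main V w by (simp add: field_simps)
    then have "(?W) powr (1 / real ?n) \<le> (1 / V) powr (1 / real ?n)"
      by (intro powr_mono2) (auto intro!: mult_nonneg_nonneg integral_nonneg_AE)
    also have "(1 / V) powr (1 / real ?n) = V powr (- 1 / real ?n)"
      using V by (simp add: powr_minus_divide powr_divide)
    finally have "(?W) powr (1 / real ?n) \<le> V powr (- 1 / real ?n)" .
    moreover have "1 / real ?n * (real ?n * V) = V" by simp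
    ultimately show ?thesis unfolding surf by (simp only:)
  qed
qed

end

theorem mainTheorem7:
  fixes f :: "real^'n::finite \<Rightarrow> real" and grad :: "real^'n \<Rightarrow> real^'n"
  assumes "CARD('n) \<ge> 2"
    and "\<exists>x. f x \<noteq> 0"
    and "\<forall>x. f x \<ge> 0"
    and "continuous_on UNIV f"
    and "compactly_supported f"
    and "has_weak_gradient f grad"
    and "integrable lebesgue grad"
  shows "(1 / real CARD('n) *
            (LINT \<xi>|sphere_surface.
               (1 / 2 * (LINT x|lebesgue. \<bar>grad x \<bullet> \<xi>\<bar>)) powr (- real CARD('n))))
           powr (- 1 / real CARD('n))
       \<ge> (1 / ((ball_volume TYPE('n))\<^sup>2 * fact CARD('n)) *
            (LINT x|(\<Pi>\<^sub>M i\<in>(UNIV :: 'n set). lebesgue). D (\<lambda>i. grad (x i))))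
           powr (1 / real CARD('n))"
proof -
  have "sigma_finite_measure (lebesgue :: (real^'n) measure)"
  proof
    have "\<exists>n::nat. x \<in> cball 0 (real n)" for x :: "real^'n" using real_arch_simple[of "norm x"] by auto
    then have "\<Union> (range (\<lambda>n::nat. cball (0::real^'n) (real n))) = space lebesgue" by auto
    moreover have "emeasure lebesgue (cball (0::real^'n) (real n)) \<noteq> \<infinity>" for n
      using emeasure_lborel_cball_finite[of "0::real^'n" "real n"] by (simp add: less_top)
    ultimately show "\<exists>A. countable A \<and> A \<subseteq> sets (lebesgue :: (real^'n) measure) \<and> \<Union> A = space lebesgue \<and> (\<forall>a\<in>A. emeasure lebesgue a \<noteq> \<infinity>)"
      by (intro exI[of _ "range (\<lambda>n::nat. cball 0 (real n))"]) auto
  qed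
  then interpret zonoid "lebesgue :: (real^'n) measure" grad
    using assms(7) by (simp add: zonoid_def zonoid_axioms_def)
  have "D (\<lambda>i. grad (x i)) = \<bar>det (\<chi> i. grad (x i))\<bar>" for x :: "'n \<Rightarrow> real^'n"
  proof -
    have "(\<chi> i j. grad (x j) $ i) = transpose (\<chi> i. grad (x i))" by (simp add: transpose_def vec_eq_iff)
    then show ?thesis by (simp add: D_def det_transpose)
  qed
  then show ?thesis using zonoid_polar_inequality by simp
qed

end
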